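(* Let $G$ be a finite group, $x\in G$, and let $\{0\}\to A\to E\xrightarrow{\partial}G\to\{1\}$ be a central extension of groups. Let $\Phi^x=(\psi^x,\phi^x)$ be the unframed Reidemeister pair derived from it, namely $\phi^x(g,h)=\{hx^{-1},gx^{-1}\}$, $\psi^x(g,h)=\{g,h\}\{hg^{-1},x\}$, for the crossed module $(\partial\colon E\to G,\bullet)$ with $g\bullet e=s(g)es(g)^{-1}$, where $s\colon G\to E$ is any section of $\partial$ and $\{g,h\}=[s(g),s(h)]$. Let $K$ be an oriented knot with a base point $p$, let $m_p,l_p\in\pi_1(C_K)$ be the associated meridian and longitude, and let $L_K$ be the associated string knot. Then, in $\mathbb Z[E]$, $$\sum_{a\in G}\langle 1_G|I_{\Phi^x}(L_K)|a\rangle=\sum_{f\colon\pi_1(C_K)\to G\ \text{with}\ f(m_p)=x}\hat f(l_p),$$ where the sum on the right is over group homomorphisms $f$, and $\hat f\colon\pi_1(C_K)\wedge\pi_1(C_K)\cong[\pi_1(C_K),\pi_1(C_K)]\to E$ is the homomorphism determined by $\hat f(u\wedge v)=\{f(v),f(u)\}^{-1}$.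
   Context: **Notation.** $[a,b]=aba^{-1}b^{-1}$. Central extension means that $\partial$ is surjective and $A=\ker\partial$ is central in $E$. Neither $\bullet$ nor $\{\,,\}$ depends on the section $s$. **Non-abelian wedge product.** For a group $P$, $P\otimes P$ is the group generated by symbols $g\otimes h$ ($g,h\in P$) with relations $gh\otimes k=(ghg^{-1}\otimes gkg^{-1})(g\otimes k)$ and $g\otimes hk=(g\otimes h)(hgh^{-1}\otimes hkh^{-1})$ for all $g,h,k\in P$; $P\wedge P$ is its quotient by the relations $g\otimes g=1$, and $g\wedge h$ is the image of $g\otimes h$. There is a surjective homomorphism $\delta\colon P\wedge P\to[P,P]$, $g\wedge h\mapsto[g,h]$, with kernel $H_2(P;\mathbb Z)$. For $P=\pi_1(C_K)$ one has $H_2(P;\mathbb Z)=0$, so $\delta$ is an isomorphism $P\wedge P\cong[P,P]$; since $l_p\in[P,P]$, $\hat f(l_p)$ makes sense. For a homomorphism $f\colon P\to G$, the assignment $u\wedge v\mapsto\{f(v),f(u)\}^{-1}$ respects the defining relations and defines the homomorphism $\hat f$. **Meridian and longitude.** $C_K=S^3\setminus n(K)$ with $n(K)$ an open regular neighbourhood of $K$; $m_p$ is the meridian at $p$ (direction given by the right-hand rule) and $l_p$ is the longitude (parallel to $K$, linking number zero with $K$). Concretely, for a diagram of $K$ cut at $p$, with arcs $a_1,\dots,a_n$ met successively when travelling along $K$ from $p$ to $p$, $\pi_1(C_K)$ has the Wirtinger generators $g_{a_i}$; if $\theta_i=\pm1$ is the sign of the crossing separating $a_i$ from $a_{i+1}$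 and $a_{j_i}$ is its over-arc, the relations are $g_{a_{i+1}}=g_{a_{j_i}}^{-\theta_i}g_{a_i}g_{a_{j_i}}^{\theta_i}$, $g_{a_n}=g_{a_1}$, and $m_p=g_{a_1}$, $l_p=\prod_{i=1}^{n-1}g_{a_i}^{-\theta_i}g_{a_{j_i}}^{\theta_i}$ (product in increasing order of $i$). **String knots.** A string knot is an oriented tangle whose underlying 1-manifold is an interval, with one end-point at the top and one at the bottom, oriented downwards. Closing gives a bijection between isotopy classes of string knots and of oriented knots; $L_K$ is the string knot whose closure is $K$. **Crossed modules.** A crossed module of groups $\mathcal G=(\partial\colon E\to G,\bullet)$ is a group homomorphism $\partial\colon E\to G$ with a left action $\bullet$ of $G$ on $E$ by automorphisms such that $\partial(g\bullet e)=g\,\partial(e)\,g^{-1}$ and $\partial(e)\bullet f=efe^{-1}$ for all $g\in G$, $e,f\in E$. **Reidemeister pairs.** A pair $\Phi=(\psi,\phi)$ of functions $\psi,\phi\colon G\times G\to E$ is an *unframed Reidemeister pair* if for all $X,Y,T\in G$: (R1) $\psi(X,X)=1_E$; (R2) $\phi(X,Y)\,\psi(X,Z)=1_E$ where $Z=X^{-1}\partial\phi(X,Y)^{-1}YX$; (R3) $\phi(Y,X)\cdot(Y\bullet\phi(T,Z))\cdot\phi(T,Y)=(X\bullet\phi(T,Y))\cdot\phi(T,X)\cdot(T\bullet\phi(V,W))$ where $Z=Y^{-1}\partial\phi(Y,X)^{-1}XY$, $V=T^{-1}\partial\phi(T,Y)^{-1}YT$, $W=T^{-1}\partial\phi(T,X)^{-1}XT$.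 **The category $\mathcal C(\mathcal G)$.** Objects are the elements of $G$. Morphisms $U\to V$ are pairs $(U,e)$ with $e\in E$, $\partial(e)=VU^{-1}$ (written $U\xrightarrow{e}V$). The composite of $U\xrightarrow{e}V$ followed by $V\xrightarrow{f}W$ is $U\xrightarrow{fe}W$. The tensor product is $U\otimes V=UV$ on objects, and the tensor product of $U\xrightarrow{e}V$ and $W\xrightarrow{f}X$ is $UW\xrightarrow{(V\bullet f)\,e}VX$. **Diagrams.** The source of a tangle is at the top, the target at the bottom. An oriented tangle diagram is sliced into horizontal strips, each containing vertical strands and at most one elementary piece: the (positive) crossing $X_+$ (both strands oriented downwards, over-strand from top right to bottom left, under-strand from top left to bottom right), the (negative) crossing $X_-$ (both strands oriented downwards, over-strand from top left to bottom right, under-strand from top right to bottom left), and cups (local minima) and caps (local maxima) with either orientation. Crossings with upward strands are expressed through these pieces. **Reidemeister $\mathcal G$-colourings and state sum.** For a diagram $D$ of a string knot whose top and bottom end-points are coloured by $a,b\in G$, a Reidemeister $\mathcal G$-colouring $F$ assigns an element of $G$ to each arc and an element of $E$ to each crossing, so that the top arc is coloured $a$, the bottom arc $b$, and: at each $X_+$ with over-arc coloured $X$, lower (bottom right) under-arc coloured $Y$, upper (top left) under-arc coloured $Z$, the crossing is coloured $\psi(X,Y)$ and $Z=\partial\psi(X,Y)^{-1}XYX^{-1}$; at each $X_-$ with over-arc coloured $X$, lower (bottom left) under-arc coloured $Y$, upper (top right) under-arc coloured $Z$, the crossing is coloured $\phi(X,Y)$ and $Z=X^{-1}\partial\phi(X,Y)^{-1}YX$.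 The evaluation $e(F)$ is the morphism $a\to b$ of $\mathcal C(\mathcal G)$ obtained by tensoring horizontally and composing vertically (from top to bottom) the following morphisms: $X_+\mapsto ZX\xrightarrow{\psi(X,Y)}XY$; $X_-\mapsto XZ\xrightarrow{\phi(X,Y)}YX$; a vertical strand coloured $X$ gives the identity of $X$ if oriented downwards and of $X^{-1}$ if upwards; cups give $XX^{-1}\xrightarrow{1_E}1_G$ or $X^{-1}X\xrightarrow{1_E}1_G$ and caps give $1_G\xrightarrow{1_E}X^{-1}X$ or $1_G\xrightarrow{1_E}XX^{-1}$, according to orientation. The state sum is $\langle a|I_\Phi(D)|b\rangle=\sum_Fe(F)\in\mathbb N[\mathrm{Hom}_{\mathcal C(\mathcal G)}(a,b)]$; for an unframed Reidemeister pair it depends only on the string knot. Since $\mathrm{Hom}_{\mathcal C(\mathcal G)}(1_G,a)$ is identified with $\{e\in E:\partial(e)=a\}$, the element $\langle1_G|I_\Phi(D)|a\rangle$ is regarded as an element of $\mathbb Z[E]$. *)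

theory Defs
  imports "HOL-Algebra.Generated_Groups" "HOL-Library.FuncSet" "HOL-Library.Poly_Mapping"
begin

section \<open>Groups given by generators and relations\<close>

text \<open>A word is a list of letters; \<open>(a, True)\<close> stands for the generator \<open>a\<close> and
  \<open>(a, False)\<close> for its inverse.  A relation is a pair \<open>(r, r')\<close> of words, read as \<open>r = r'\<close>.\<close>

type_synonym 'a word = "('a \<times> bool) list"

definition words :: "'a set \<Rightarrow> 'a word set" where
  "words S = lists (S \<times> UNIV)"

inductive_set presented_eq :: "'a set \<Rightarrow> ('a word \<times> 'a word) set \<Rightarrow> ('a word \<times> 'a word) set"
  for S R where
  refl: "u \<in> words S \<Longrightarrow> (u, u) \<in> presented_eq S R"
| sym: "(u, v) \<in> presented_eq S R \<Longrightarrow> (v, u) \<in> presented_eq S R"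
| trans: "(u, v) \<in> presented_eq S R \<Longrightarrow> (v, w) \<in> presented_eq S R \<Longrightarrow> (u, w) \<in> presented_eq S R"
| cancel: "u \<in> words S \<Longrightarrow> v \<in> words S \<Longrightarrow> a \<in> S \<Longrightarrow>
    (u @ [(a, e), (a, \<not> e)] @ v, u @ v) \<in> presented_eq S R"
| relation: "u \<in> words S \<Longrightarrow> v \<in> words S \<Longrightarrow> r \<in> words S \<Longrightarrow> r' \<in> words S \<Longrightarrow> (r, r') \<in> R \<Longrightarrow>
    (u @ r @ v, u @ r' @ v) \<in> presented_eq S R"

definition presented_group :: "'a set \<Rightarrow> ('a word \<times> 'a word) set \<Rightarrow> 'a word set monoid" where
  "presented_group S R =
    \<lparr>carrier = words S // presented_eq S R,
     monoid.mult = (\<lambda>A B. \<Union>u\<in>A. \<Union>v\<in>B. presented_eq S R `` {u @ v}),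
     monoid.one = presented_eq S R `` {[]}\<rparr>"

definition generator :: "'a set \<Rightarrow> ('a word \<times> 'a word) set \<Rightarrow> 'a \<Rightarrow> 'a word set" where
  "generator S R a = presented_eq S R `` {[(a, True)]}"

definition hom_determined_by ::
    "'a set \<Rightarrow> ('a word \<times> 'a word) set \<Rightarrow> ('b, 'm) monoid_scheme \<Rightarrow> ('a \<Rightarrow> 'b) \<Rightarrow> 'a word set \<Rightarrow> 'b" where
  "hom_determined_by S R H h =
    (THE F. F \<in> hom (presented_group S R) H \<and> F \<in> extensional (carrier (presented_group S R)) \<and>
            (\<forall>a\<in>S. F (generator S R a) = h a))"


section \<open>The non-abelian wedge product\<close>

definition commutator :: "('a, 'm) monoid_scheme \<Rightarrow> 'a \<Rightarrow> 'a \<Rightarrow> 'a" where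
  "commutator P a b = a \<otimes>\<^bsub>P\<^esub> b \<otimes>\<^bsub>P\<^esub> inv\<^bsub>P\<^esub> a \<otimes>\<^bsub>P\<^esub> inv\<^bsub>P\<^esub> b"

definition conj_by :: "('a, 'm) monoid_scheme \<Rightarrow> 'a \<Rightarrow> 'a \<Rightarrow> 'a" where
  "conj_by P g h = g \<otimes>\<^bsub>P\<^esub> h \<otimes>\<^bsub>P\<^esub> inv\<^bsub>P\<^esub> g"

definition tensor_relations ::
    "('a, 'm) monoid_scheme \<Rightarrow> (('a \<times> 'a) word \<times> ('a \<times> 'a) word) set" where
  "tensor_relations P =
    {([((g \<otimes>\<^bsub>P\<^esub> h, k), True)], [((conj_by P g h, conj_by P g k), True), ((g, k), True)]) | g h k.
       g \<in> carrier P \<and> h \<in> carrier P \<and> k \<in> carrier P} \<union>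
    {([((g, h \<otimes>\<^bsub>P\<^esub> k), True)], [((g, h), True), ((conj_by P h g, conj_by P h k), True)]) | g h k.
       g \<in> carrier P \<and> h \<in> carrier P \<and> k \<in> carrier P}"

definition wedge_relations ::
    "('a, 'm) monoid_scheme \<Rightarrow> (('a \<times> 'a) word \<times> ('a \<times> 'a) word) set" where
  "wedge_relations P = tensor_relations P \<union> {([((g, g), True)], []) | g. g \<in> carrier P}"

definition wedge_square :: "('a, 'm) monoid_scheme \<Rightarrow> ('a \<times> 'a) word set monoid" where
  "wedge_square P = presented_group (carrier P \<times> carrier P) (wedge_relations P)"

text \<open>The map \<open>\<delta>\<close> from the wedge square of \<open>P\<close> to \<open>[P, P]\<close>, sending \<open>g \<and> h\<close> to \<open>[g, h]\<close>.\<close>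

definition wedge_to_derived :: "('a, 'm) monoid_scheme \<Rightarrow> ('a \<times> 'a) word set \<Rightarrow> 'a" where
  "wedge_to_derived P =
    hom_determined_by (carrier P \<times> carrier P) (wedge_relations P)
      (P\<lparr>carrier := derived P (carrier P)\<rparr>) (\<lambda>(g, h). commutator P g h)"


section \<open>String knot diagrams\<close>

datatype dir = Down | Up

datatype piece = XPlus | XMinus | Cup dir | Cap dir

datatype strip =
  Strip (left_strands: "dir list") (strip_piece: "piece option") (right_strands: "dir list")

text \<open>A diagram is a list of horizontal strips, from top to bottom.  The argument of
  \<^term>\<open>Cup\<close> (local minimum) and \<^term>\<open>Cap\<close> (local maximum) is the direction of the left leg; the
  right leg is opposite.  At both crossings the two strands go down; the over-strand of
  \<^term>\<open>XPlus\<close> goes from top right to bottom left, that of \<^term>\<open>XMinus\<close> from top left to bottom right.\<close>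

fun opposite :: "dir \<Rightarrow> dir" where
  "opposite Down = Up"
| "opposite Up = Down"

fun piece_top :: "piece option \<Rightarrow> dir list" where
  "piece_top (Some XPlus) = [Down, Down]"
| "piece_top (Some XMinus) = [Down, Down]"
| "piece_top (Some (Cup o1)) = [o1, opposite o1]"
| "piece_top (Some (Cap o1)) = []"
| "piece_top None = []"

fun piece_bottom :: "piece option \<Rightarrow> dir list" where
  "piece_bottom (Some XPlus) = [Down, Down]"
| "piece_bottom (Some XMinus) = [Down, Down]"
| "piece_bottom (Some (Cup o1)) = []"
| "piece_bottom (Some (Cap o1)) = [o1, opposite o1]"
| "piece_bottom None = []"

definition strip_top :: "strip \<Rightarrow> dir list" where
  "strip_top t = left_strands t @ piece_top (strip_piece t) @ right_strands t"

definition strip_bottom :: "strip \<Rightarrow> dir list" where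
  "strip_bottom t = left_strands t @ piece_bottom (strip_piece t) @ right_strands t"

primrec tangle_diagram :: "dir list \<Rightarrow> strip list \<Rightarrow> dir list \<Rightarrow> bool" where
  "tangle_diagram u [] v \<longleftrightarrow> u = v"
| "tangle_diagram u (t # D) v \<longleftrightarrow> u = strip_top t \<and> tangle_diagram (strip_bottom t) D v"

text \<open>The point \<open>(k, i)\<close> is the \<open>i\<close>-th strand (from the left) on the \<open>k\<close>-th horizontal line;
  line \<open>k\<close> is the top of strip \<open>k\<close> and line \<open>Suc k\<close> its bottom.  Line \<open>0\<close> carries a
  single downward strand, since only string knots are considered.\<close>

type_synonym point = "nat \<times> nat"

definition level :: "strip list \<Rightarrow> nat \<Rightarrow> dir list" where
  "level D k = (case k of 0 \<Rightarrow> [Down] | Suc j \<Rightarrow> strip_bottom (D ! j))"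

definition points :: "strip list \<Rightarrow> point set" where
  "points D = {(k, i). k \<le> length D \<and> i < length (level D k)}"

abbreviation piece_at :: "strip list \<Rightarrow> nat \<Rightarrow> piece option" where
  "piece_at D k \<equiv> strip_piece (D ! k)"

definition offset :: "strip list \<Rightarrow> nat \<Rightarrow> nat" where
  "offset D k = length (left_strands (D ! k))"

definition crossings :: "strip list \<Rightarrow> nat set" where
  "crossings D = {k. k < length D \<and> piece_at D k \<in> {Some XPlus, Some XMinus}}"

text \<open>End-points of the two strands of the crossing in strip \<open>k\<close>: over-strand and under-strand,
  each at its top (incoming) and bottom (outgoing) end.\<close>

definition over_top :: "strip list \<Rightarrow> nat \<Rightarrow> point" where
  "over_top D k = (k, if piece_at D k = Some XPlus then offset D k + 1 else offset D k)"

definition over_bottom :: "strip list \<Rightarrow> nat \<Rightarrow> point" where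
  "over_bottom D k = (Suc k, if piece_at D k = Some XPlus then offset D k else offset D k + 1)"

definition under_top :: "strip list \<Rightarrow> nat \<Rightarrow> point" where
  "under_top D k = (k, if piece_at D k = Some XPlus then offset D k else offset D k + 1)"

definition under_bottom :: "strip list \<Rightarrow> nat \<Rightarrow> point" where
  "under_bottom D k = (Suc k, if piece_at D k = Some XPlus then offset D k + 1 else offset D k)"

text \<open>Steps along the oriented tangle, from a point to the next one; those staying on the same arc
  are separated from those passing under a crossing.\<close>

definition oriented :: "dir \<Rightarrow> point \<Rightarrow> point \<Rightarrow> point \<times> point" where
  "oriented o1 p q = (if o1 = Down then (p, q) else (q, p))"

definition vertical_steps :: "strip list \<Rightarrow> nat \<Rightarrow> (point \<times> point) set" where
  "vertical_steps D k = (let l = left_strands (D ! k); r = right_strands (D ! k);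
       mt = offset D k + length (piece_top (piece_at D k));
       mb = offset D k + length (piece_bottom (piece_at D k)) in
     {oriented (l ! i) (k, i) (Suc k, i) | i. i < length l} \<union>
     {oriented (r ! i) (k, mt + i) (Suc k, mb + i) | i. i < length r})"

definition piece_steps :: "strip list \<Rightarrow> nat \<Rightarrow> (point \<times> point) set" where
  "piece_steps D k = (case piece_at D k of
       None \<Rightarrow> {}
     | Some XPlus \<Rightarrow> {(over_top D k, over_bottom D k)}
     | Some XMinus \<Rightarrow> {(over_top D k, over_bottom D k)}
     | Some (Cup o1) \<Rightarrow> {oriented o1 (k, offset D k) (k, offset D k + 1)}
     | Some (Cap o1) \<Rightarrow> {oriented o1 (Suc k, offset D k + 1) (Suc k, offset D k)})"

definition arc_steps :: "strip list \<Rightarrow> (point \<times> point) set" where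
  "arc_steps D = (\<Union>k<length D. vertical_steps D k \<union> piece_steps D k)"

definition under_steps :: "strip list \<Rightarrow> (point \<times> point) set" where
  "under_steps D = (\<lambda>k. (under_top D k, under_bottom D k)) ` crossings D"

text \<open>A tangle with one end-point at the top and one at the bottom, oriented downwards, whose
  underlying 1-manifold is connected, hence an interval.\<close>

definition string_knot_diagram :: "strip list \<Rightarrow> bool" where
  "string_knot_diagram D \<longleftrightarrow> tangle_diagram [Down] D [Down] \<and>
    (\<forall>p\<in>points D. \<forall>q\<in>points D.
       (p, q) \<in> (arc_steps D \<union> under_steps D \<union> (arc_steps D \<union> under_steps D)\<inverse>)\<^sup>*)"

definition arc :: "strip list \<Rightarrow> point \<Rightarrow> point set" where
  "arc D p = (arc_steps D \<union> (arc_steps D)\<inverse>)\<^sup>* `` {p}"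

definition arcs :: "strip list \<Rightarrow> point set set" where
  "arcs D = arc D ` points D"

definition top_arc :: "strip list \<Rightarrow> point set" where
  "top_arc D = arc D (0, 0)"

definition bottom_arc :: "strip list \<Rightarrow> point set" where
  "bottom_arc D = arc D (length D, 0)"

definition over_arc :: "strip list \<Rightarrow> nat \<Rightarrow> point set" where
  "over_arc D k = arc D (over_top D k)"

definition upper_under_arc :: "strip list \<Rightarrow> nat \<Rightarrow> point set" where
  "upper_under_arc D k = arc D (under_top D k)"

definition lower_under_arc :: "strip list \<Rightarrow> nat \<Rightarrow> point set" where
  "lower_under_arc D k = arc D (under_bottom D k)"

definition crossing_sign :: "strip list \<Rightarrow> nat \<Rightarrow> int" where
  "crossing_sign D k = (if piece_at D k = Some XPlus then 1 else -1)"


section \<open>The knot group, meridian and longitude\<close>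

text \<open>A string knot diagram \<open>D\<close> is a diagram, cut at the base point, of the oriented knot obtained by
  closing it.  Its group is given by the Wirtinger presentation of the cut diagram; the
  last relation identifies the two ends.\<close>

definition wirtinger_relations :: "strip list \<Rightarrow> (point set word \<times> point set word) set" where
  "wirtinger_relations D =
    {([(lower_under_arc D k, True)],
      [(over_arc D k, crossing_sign D k = -1),
       (upper_under_arc D k, True),
       (over_arc D k, crossing_sign D k = 1)]) | k. k \<in> crossings D} \<union>
    {([(bottom_arc D, True)], [(top_arc D, True)])}"

definition knot_group :: "strip list \<Rightarrow> point set word set monoid" where
  "knot_group D = presented_group (arcs D) (wirtinger_relations D)"

definition wirtinger_generator :: "strip list \<Rightarrow> point set \<Rightarrow> point set word set" where
  "wirtinger_generator D a = generator (arcs D) (wirtinger_relations D) a"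

definition crossing_after :: "strip list \<Rightarrow> point set \<Rightarrow> nat" where
  "crossing_after D a = (THE k. k \<in> crossings D \<and> upper_under_arc D k = a)"

text \<open>The arcs met successively when travelling from the top to the bottom end-point, numbered from
  \<open>0\<close>.  There are \<open>card (crossings D) + 1\<close> of them; larger indices are meaningless.\<close>

primrec travel_arc :: "strip list \<Rightarrow> nat \<Rightarrow> point set" where
  "travel_arc D 0 = top_arc D"
| "travel_arc D (Suc i) = lower_under_arc D (crossing_after D (travel_arc D i))"

definition meridian :: "strip list \<Rightarrow> point set word set" where
  "meridian D = wirtinger_generator D (travel_arc D 0)"

definition longitude_factor :: "strip list \<Rightarrow> nat \<Rightarrow> point set word set" where
  "longitude_factor D i = (let k = crossing_after D (travel_arc D i) in
     wirtinger_generator D (travel_arc D i) [^]\<^bsub>knot_group D\<^esub> (- crossing_sign D k)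
     \<otimes>\<^bsub>knot_group D\<^esub> wirtinger_generator D (over_arc D k) [^]\<^bsub>knot_group D\<^esub> crossing_sign D k)"

definition longitude :: "strip list \<Rightarrow> point set word set" where
  "longitude D = foldr (\<lambda>i w. longitude_factor D i \<otimes>\<^bsub>knot_group D\<^esub> w)
     [0..<card (crossings D)] \<one>\<^bsub>knot_group D\<^esub>"


section \<open>Crossed modules, Reidemeister pairs and the state sum\<close>

locale crossed_module = group_hom E G bd
  for E :: "('e, 'm) monoid_scheme" (structure)
    and G :: "('g, 'n) monoid_scheme" (structure) and bd :: "'e \<Rightarrow> 'g" +
  fixes act :: "'g \<Rightarrow> 'e \<Rightarrow> 'e"
  assumes act_hom: "g \<in> carrier G \<Longrightarrow> act g \<in> hom E E"
    and act_one: "e \<in> carrier E \<Longrightarrow> act \<one>\<^bsub>G\<^esub> e = e"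
    and act_mult: "\<lbrakk>g \<in> carrier G; h \<in> carrier G; e \<in> carrier E\<rbrakk> \<Longrightarrow>
      act (g \<otimes>\<^bsub>G\<^esub> h) e = act g (act h e)"
    and bd_act: "\<lbrakk>g \<in> carrier G; e \<in> carrier E\<rbrakk> \<Longrightarrow>
      bd (act g e) = g \<otimes>\<^bsub>G\<^esub> bd e \<otimes>\<^bsub>G\<^esub> inv\<^bsub>G\<^esub> g"
    and peiffer: "\<lbrakk>e \<in> carrier E; f \<in> carrier E\<rbrakk> \<Longrightarrow>
      act (bd e) f = e \<otimes>\<^bsub>E\<^esub> f \<otimes>\<^bsub>E\<^esub> inv\<^bsub>E\<^esub> e"
begin

text \<open>A morphism of the category of the crossed module is a pair \<open>(U, e)\<close>; its target is
  \<open>bd e \<otimes> U\<close>.  In \<open>cat_comp m m'\<close>, \<open>m\<close> is followed by \<open>m'\<close>.\<close>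

definition cat_target :: "'g \<times> 'e \<Rightarrow> 'g" where
  "cat_target m = bd (snd m) \<otimes>\<^bsub>G\<^esub> fst m"

definition cat_id :: "'g \<Rightarrow> 'g \<times> 'e" where
  "cat_id U = (U, \<one>\<^bsub>E\<^esub>)"

definition cat_comp :: "'g \<times> 'e \<Rightarrow> 'g \<times> 'e \<Rightarrow> 'g \<times> 'e" where
  "cat_comp m m' = (fst m, snd m' \<otimes>\<^bsub>E\<^esub> snd m)"

definition cat_tensor :: "'g \<times> 'e \<Rightarrow> 'g \<times> 'e \<Rightarrow> 'g \<times> 'e" where
  "cat_tensor m m' = (fst m \<otimes>\<^bsub>G\<^esub> fst m', act (cat_target m) (snd m') \<otimes>\<^bsub>E\<^esub> snd m)"

end

locale unframed_reidemeister_pair = crossed_module E G bd act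
  for E :: "('e, 'm) monoid_scheme" (structure) and G :: "('g, 'n) monoid_scheme" (structure)
    and bd :: "'e \<Rightarrow> 'g" and act :: "'g \<Rightarrow> 'e \<Rightarrow> 'e" +
  fixes psi :: "'g \<Rightarrow> 'g \<Rightarrow> 'e" and phi :: "'g \<Rightarrow> 'g \<Rightarrow> 'e"
  assumes psi_closed: "\<lbrakk>X \<in> carrier G; Y \<in> carrier G\<rbrakk> \<Longrightarrow> psi X Y \<in> carrier E"
    and phi_closed: "\<lbrakk>X \<in> carrier G; Y \<in> carrier G\<rbrakk> \<Longrightarrow> phi X Y \<in> carrier E"
    and R1: "X \<in> carrier G \<Longrightarrow> psi X X = \<one>\<^bsub>E\<^esub>"
    and R2: "\<lbrakk>X \<in> carrier G; Y \<in> carrier G;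
        Z = inv\<^bsub>G\<^esub> X \<otimes>\<^bsub>G\<^esub> inv\<^bsub>G\<^esub> (bd (phi X Y)) \<otimes>\<^bsub>G\<^esub> Y \<otimes>\<^bsub>G\<^esub> X\<rbrakk> \<Longrightarrow>
      phi X Y \<otimes>\<^bsub>E\<^esub> psi X Z = \<one>\<^bsub>E\<^esub>"
    and R3: "\<lbrakk>X \<in> carrier G; Y \<in> carrier G; T \<in> carrier G;
        Z = inv\<^bsub>G\<^esub> Y \<otimes>\<^bsub>G\<^esub> inv\<^bsub>G\<^esub> (bd (phi Y X)) \<otimes>\<^bsub>G\<^esub> X \<otimes>\<^bsub>G\<^esub> Y;
        V = inv\<^bsub>G\<^esub> T \<otimes>\<^bsub>G\<^esub> inv\<^bsub>G\<^esub> (bd (phi T Y)) \<otimes>\<^bsub>G\<^esub> Y \<otimes>\<^bsub>G\<^esub> T;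
        W = inv\<^bsub>G\<^esub> T \<otimes>\<^bsub>G\<^esub> inv\<^bsub>G\<^esub> (bd (phi T X)) \<otimes>\<^bsub>G\<^esub> X \<otimes>\<^bsub>G\<^esub> T\<rbrakk> \<Longrightarrow>
      phi Y X \<otimes>\<^bsub>E\<^esub> act Y (phi T Z) \<otimes>\<^bsub>E\<^esub> phi T Y =
      act X (phi T Y) \<otimes>\<^bsub>E\<^esub> phi T X \<otimes>\<^bsub>E\<^esub> act T (phi V W)"
begin

text \<open>A colouring is a pair \<open>(c, w)\<close>: \<open>c\<close> colours the arcs by \<open>G\<close> and \<open>w\<close> the crossings by \<open>E\<close>.\<close>

definition coloured_at :: "strip list \<Rightarrow> (point set \<Rightarrow> 'g) \<Rightarrow> (nat \<Rightarrow> 'e) \<Rightarrow> nat \<Rightarrow> bool" where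
  "coloured_at D c w k =
    (let X = c (over_arc D k); Y = c (lower_under_arc D k); Z = c (upper_under_arc D k) in
     if piece_at D k = Some XPlus
     then w k = psi X Y \<and>
          Z = inv\<^bsub>G\<^esub> (bd (psi X Y)) \<otimes>\<^bsub>G\<^esub> X \<otimes>\<^bsub>G\<^esub> Y \<otimes>\<^bsub>G\<^esub> inv\<^bsub>G\<^esub> X
     else w k = phi X Y \<and>
          Z = inv\<^bsub>G\<^esub> X \<otimes>\<^bsub>G\<^esub> inv\<^bsub>G\<^esub> (bd (phi X Y)) \<otimes>\<^bsub>G\<^esub> Y \<otimes>\<^bsub>G\<^esub> X)"

definition colourings :: "strip list \<Rightarrow> 'g \<Rightarrow> 'g \<Rightarrow> ((point set \<Rightarrow> 'g) \<times> (nat \<Rightarrow> 'e)) set" where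
  "colourings D a b =
    {(c, w). c \<in> arcs D \<rightarrow>\<^sub>E carrier G \<and> w \<in> crossings D \<rightarrow>\<^sub>E carrier E \<and>
             c (top_arc D) = a \<and> c (bottom_arc D) = b \<and> (\<forall>k\<in>crossings D. coloured_at D c w k)}"

definition strand_object :: "strip list \<Rightarrow> (point set \<Rightarrow> 'g) \<Rightarrow> point \<Rightarrow> 'g" where
  "strand_object D c p = (if level D (fst p) ! snd p = Down then c (arc D p) else inv\<^bsub>G\<^esub> c (arc D p))"

definition piece_morphism ::
    "strip list \<Rightarrow> (point set \<Rightarrow> 'g) \<Rightarrow> (nat \<Rightarrow> 'e) \<Rightarrow> nat \<Rightarrow> 'g \<times> 'e" where
  "piece_morphism D c w k = (case piece_at D k of
       None \<Rightarrow> cat_id \<one>\<^bsub>G\<^esub>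
     | Some XPlus \<Rightarrow> (c (upper_under_arc D k) \<otimes>\<^bsub>G\<^esub> c (over_arc D k), w k)
     | Some XMinus \<Rightarrow> (c (over_arc D k) \<otimes>\<^bsub>G\<^esub> c (upper_under_arc D k), w k)
     | Some (Cup o1) \<Rightarrow>
         (strand_object D c (k, offset D k) \<otimes>\<^bsub>G\<^esub> strand_object D c (k, offset D k + 1), \<one>\<^bsub>E\<^esub>)
     | Some (Cap o1) \<Rightarrow> (\<one>\<^bsub>G\<^esub>, \<one>\<^bsub>E\<^esub>))"

definition strip_morphism ::
    "strip list \<Rightarrow> (point set \<Rightarrow> 'g) \<Rightarrow> (nat \<Rightarrow> 'e) \<Rightarrow> nat \<Rightarrow> 'g \<times> 'e" where
  "strip_morphism D c w k =
    foldr cat_tensor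
      (map (\<lambda>i. cat_id (strand_object D c (k, i))) [0..<offset D k]
       @ [piece_morphism D c w k]
       @ map (\<lambda>i. cat_id (strand_object D c (k, i)))
           [offset D k + length (piece_top (piece_at D k))..<length (strip_top (D ! k))])
      (cat_id \<one>\<^bsub>G\<^esub>)"

definition evaluation :: "strip list \<Rightarrow> (point set \<Rightarrow> 'g) \<Rightarrow> (nat \<Rightarrow> 'e) \<Rightarrow> 'g \<times> 'e" where
  "evaluation D c w =
    foldl cat_comp (cat_id (c (top_arc D))) (map (strip_morphism D c w) [0..<length D])"

text \<open>Formal sums with coefficients in the natural numbers are taken inside the free abelian group.\<close>

definition state_sum :: "strip list \<Rightarrow> 'g \<Rightarrow> 'g \<Rightarrow> ('g \<times> 'e) \<Rightarrow>\<^sub>0 int" where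
  "state_sum D a b = (\<Sum>(c, w)\<in>colourings D a b. frag_of (evaluation D c w))"

text \<open>The identification of a morphism from the unit object with the element of \<open>E\<close> labelling
  it, extended linearly.\<close>

definition state_sum_from_one :: "strip list \<Rightarrow> 'g \<Rightarrow> 'e \<Rightarrow>\<^sub>0 int" where
  "state_sum_from_one D a = frag_extend (\<lambda>m. frag_of (snd m)) (state_sum D \<one>\<^bsub>G\<^esub> a)"

end


section \<open>Central extensions and the derived Reidemeister pair\<close>

locale central_extension = group_hom E G bd
  for E :: "('e, 'm) monoid_scheme" (structure)
    and G :: "('g, 'n) monoid_scheme" (structure) and bd :: "'e \<Rightarrow> 'g" +
  assumes bd_surj: "bd ` carrier E = carrier G"
    and kernel_central: "\<lbrakk>a \<in> kernel E G bd; e \<in> carrier E\<rbrakk> \<Longrightarrow> a \<otimes>\<^bsub>E\<^esub> e = e \<otimes>\<^bsub>E\<^esub> a"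

definition is_section ::
    "('e, 'm) monoid_scheme \<Rightarrow> ('g, 'n) monoid_scheme \<Rightarrow> ('e \<Rightarrow> 'g) \<Rightarrow> ('g \<Rightarrow> 'e) \<Rightarrow> bool" where
  "is_section E G bd s \<longleftrightarrow> s \<in> carrier G \<rightarrow> carrier E \<and> (\<forall>g\<in>carrier G. bd (s g) = g)"

definition bracket :: "('e, 'm) monoid_scheme \<Rightarrow> ('g \<Rightarrow> 'e) \<Rightarrow> 'g \<Rightarrow> 'g \<Rightarrow> 'e" where
  "bracket E s g h = commutator E (s g) (s h)"

definition section_action :: "('e, 'm) monoid_scheme \<Rightarrow> ('g \<Rightarrow> 'e) \<Rightarrow> 'g \<Rightarrow> 'e \<Rightarrow> 'e" where
  "section_action E s g e = s g \<otimes>\<^bsub>E\<^esub> e \<otimes>\<^bsub>E\<^esub> inv\<^bsub>E\<^esub> (s g)"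

definition phi_at ::
    "('e, 'm) monoid_scheme \<Rightarrow> ('g, 'n) monoid_scheme \<Rightarrow> ('g \<Rightarrow> 'e) \<Rightarrow> 'g \<Rightarrow> 'g \<Rightarrow> 'g \<Rightarrow> 'e" where
  "phi_at E G s x g h = bracket E s (h \<otimes>\<^bsub>G\<^esub> inv\<^bsub>G\<^esub> x) (g \<otimes>\<^bsub>G\<^esub> inv\<^bsub>G\<^esub> x)"

definition psi_at ::
    "('e, 'm) monoid_scheme \<Rightarrow> ('g, 'n) monoid_scheme \<Rightarrow> ('g \<Rightarrow> 'e) \<Rightarrow> 'g \<Rightarrow> 'g \<Rightarrow> 'g \<Rightarrow> 'e" where
  "psi_at E G s x g h = bracket E s g h \<otimes>\<^bsub>E\<^esub> bracket E s (h \<otimes>\<^bsub>G\<^esub> inv\<^bsub>G\<^esub> g) x"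

text \<open>\<open>hat\<close> is the composite of the inverse of \<open>\<delta>\<close> with the homomorphism determined by
  \<open>u \<and> v \<mapsto> {f(v), f(u)}\<inverse>\<close>.  For knot groups \<open>\<delta>\<close> is an isomorphism, so \<^term>\<open>inv_into\<close> is its inverse.\<close>

definition wedge_hom ::
    "('e, 'm) monoid_scheme \<Rightarrow> ('g \<Rightarrow> 'e) \<Rightarrow> ('p, 'k) monoid_scheme \<Rightarrow> ('p \<Rightarrow> 'g) \<Rightarrow>
     ('p \<times> 'p) word set \<Rightarrow> 'e" where
  "wedge_hom E s P f =
    hom_determined_by (carrier P \<times> carrier P) (wedge_relations P) E
      (\<lambda>(u, v). inv\<^bsub>E\<^esub> (bracket E s (f v) (f u)))"

definition hat ::
    "('e, 'm) monoid_scheme \<Rightarrow> ('g \<Rightarrow> 'e) \<Rightarrow> ('p, 'k) monoid_scheme \<Rightarrow> ('p \<Rightarrow> 'g) \<Rightarrow> 'p \<Rightarrow> 'e" where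
  "hat E s P f l =
    wedge_hom E s P f (inv_into (carrier (wedge_square P)) (wedge_to_derived P) l)"

context group
begin

lemma inv_cancel:
  assumes "a \<in> carrier G" "b \<in> carrier G"
  shows "a \<otimes> (inv a \<otimes> b) = b" "inv a \<otimes> (a \<otimes> b) = b"
  using assms by (simp_all add: m_assoc[symmetric])

lemmas word_simps =
  m_assoc inv_mult_group inv_cancel m_closed inv_closed inv_inv r_inv l_inv r_one l_one

lemma word_identity_R2:
  assumes "a \<in> carrier G" "b \<in> carrier G" "x \<in> carrier G"
    and "z = inv x \<otimes> b \<otimes> inv a \<otimes> x \<otimes> a"
  shows "commutator G (b \<otimes> inv x) (a \<otimes> inv x) \<otimes>
      (commutator G a z \<otimes> commutator G (z \<otimes> inv a) x) = \<one>"
  unfolding assms(4) commutator_def using assms(1-3) by (simp only: word_simps)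

lemma word_identity_R3:
  assumes "a \<in> carrier G" "b \<in> carrier G" "t \<in> carrier G" "x \<in> carrier G"
    and "z = inv x \<otimes> a \<otimes> inv b \<otimes> x \<otimes> b"
    and "v = inv x \<otimes> b \<otimes> inv t \<otimes> x \<otimes> t"
    and "w = inv x \<otimes> a \<otimes> inv t \<otimes> x \<otimes> t"
  shows "commutator G (a \<otimes> inv x) (b \<otimes> inv x) \<otimes>
      (b \<otimes> commutator G (z \<otimes> inv x) (t \<otimes> inv x) \<otimes> inv b) \<otimes>
      commutator G (b \<otimes> inv x) (t \<otimes> inv x) =
    (a \<otimes> commutator G (b \<otimes> inv x) (t \<otimes> inv x) \<otimes> inv a) \<otimes>
      commutator G (a \<otimes> inv x) (t \<otimes> inv x) \<otimes>
      (t \<otimes> commutator G (w \<otimes> inv x) (v \<otimes> inv x) \<otimes> inv t)"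
  unfolding assms(5-7) commutator_def using assms(1-4) by (simp only: word_simps)

end

context central_extension
begin

lemma central_diff:
  assumes "a \<in> carrier E" "b \<in> carrier E" "bd a = bd b"
  obtains z where "z \<in> kernel E G bd" "a = b \<otimes>\<^bsub>E\<^esub> z"
proof
  show "inv\<^bsub>E\<^esub> b \<otimes>\<^bsub>E\<^esub> a \<in> kernel E G bd"
    using assms by (simp add: kernel_def)
  show "a = b \<otimes>\<^bsub>E\<^esub> (inv\<^bsub>E\<^esub> b \<otimes>\<^bsub>E\<^esub> a)"
    using assms by (simp add: G.inv_cancel)
qed

lemma conj_lift:
  assumes "a \<in> carrier E" "b \<in> carrier E" "bd a = bd b" "e \<in> carrier E"
  shows "a \<otimes>\<^bsub>E\<^esub> e \<otimes>\<^bsub>E\<^esub> inv\<^bsub>E\<^esub> a = b \<otimes>\<^bsub>E\<^esub> e \<otimes>\<^bsub>E\<^esub> inv\<^bsub>E\<^esub> b"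
proof -
  obtain z where z: "z \<in> kernel E G bd" "a = b \<otimes>\<^bsub>E\<^esub> z"
    using central_diff assms by blast
  have zc: "z \<in> carrier E" using z by (simp add: kernel_def)
  have "a \<otimes>\<^bsub>E\<^esub> e \<otimes>\<^bsub>E\<^esub> inv\<^bsub>E\<^esub> a = b \<otimes>\<^bsub>E\<^esub> (z \<otimes>\<^bsub>E\<^esub> e) \<otimes>\<^bsub>E\<^esub> (inv\<^bsub>E\<^esub> z \<otimes>\<^bsub>E\<^esub> inv\<^bsub>E\<^esub> b)"
    using z(2) zc assms by (simp add: G.m_assoc G.inv_mult_group)
  also have "z \<otimes>\<^bsub>E\<^esub> e = e \<otimes>\<^bsub>E\<^esub> z"
    using kernel_central z assms by simp
  also have "b \<otimes>\<^bsub>E\<^esub> (e \<otimes>\<^bsub>E\<^esub> z) \<otimes>\<^bsub>E\<^esub> (inv\<^bsub>E\<^esub> z \<otimes>\<^bsub>E\<^esub> inv\<^bsub>E\<^esub> b) = b \<otimes>\<^bsub>E\<^esub> e \<otimes>\<^bsub>E\<^esub> inv\<^bsub>E\<^esub> b"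
    using zc assms by (simp add: G.m_assoc G.inv_cancel)
  finally show ?thesis .
qed

lemma commutator_lift:
  assumes "a \<in> carrier E" "a' \<in> carrier E" "bd a = bd a'"
    and "b \<in> carrier E" "b' \<in> carrier E" "bd b = bd b'"
  shows "commutator E a b = commutator E a' b'"
proof -
  have "commutator E a b = (a' \<otimes>\<^bsub>E\<^esub> b \<otimes>\<^bsub>E\<^esub> inv\<^bsub>E\<^esub> a') \<otimes>\<^bsub>E\<^esub> inv\<^bsub>E\<^esub> b"
    unfolding commutator_def conj_lift[OF assms(1-3) assms(4)] ..
  also have "\<dots> = a' \<otimes>\<^bsub>E\<^esub> (b \<otimes>\<^bsub>E\<^esub> inv\<^bsub>E\<^esub> a' \<otimes>\<^bsub>E\<^esub> inv\<^bsub>E\<^esub> b)"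
    using assms by (simp add: G.m_assoc)
  also have "b \<otimes>\<^bsub>E\<^esub> inv\<^bsub>E\<^esub> a' \<otimes>\<^bsub>E\<^esub> inv\<^bsub>E\<^esub> b = b' \<otimes>\<^bsub>E\<^esub> inv\<^bsub>E\<^esub> a' \<otimes>\<^bsub>E\<^esub> inv\<^bsub>E\<^esub> b'"
    using assms by (intro conj_lift) simp_all
  also have "a' \<otimes>\<^bsub>E\<^esub> (b' \<otimes>\<^bsub>E\<^esub> inv\<^bsub>E\<^esub> a' \<otimes>\<^bsub>E\<^esub> inv\<^bsub>E\<^esub> b') = commutator E a' b'"
    using assms by (simp add: commutator_def G.m_assoc)
  finally show ?thesis .
qed

lemma bd_commutator:
  assumes "a \<in> carrier E" "b \<in> carrier E"
  shows "bd (commutator E a b) = commutator G (bd a) (bd b)"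
  using assms by (simp add: commutator_def)

context
  fixes s assumes s: "is_section E G bd s"
begin

lemma s_closed: "g \<in> carrier G \<Longrightarrow> s g \<in> carrier E"
  and bd_s: "g \<in> carrier G \<Longrightarrow> bd (s g) = g"
  using s by (auto simp: is_section_def)

lemma bracket_lift:
  "\<lbrakk>a \<in> carrier E; b \<in> carrier E\<rbrakk> \<Longrightarrow> bracket E s (bd a) (bd b) = commutator E a b"
  unfolding bracket_def by (rule commutator_lift) (simp_all add: s_closed bd_s)

lemma section_action_lift:
  "\<lbrakk>a \<in> carrier E; e \<in> carrier E\<rbrakk> \<Longrightarrow> section_action E s (bd a) e = a \<otimes>\<^bsub>E\<^esub> e \<otimes>\<^bsub>E\<^esub> inv\<^bsub>E\<^esub> a"
  unfolding section_action_def by (rule conj_lift) (simp_all add: s_closed bd_s)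

lemma section_crossed_module: "crossed_module E G bd (section_action E s)"
proof unfold_locales
  fix g assume g: "g \<in> carrier G"
  show "section_action E s g \<in> hom E E"
    using g s_closed[OF g]
    by (auto simp: hom_def section_action_def G.m_assoc G.inv_cancel)
next
  fix e assume "e \<in> carrier E"
  then show "section_action E s \<one>\<^bsub>G\<^esub> e = e"
    using section_action_lift[of "\<one>\<^bsub>E\<^esub>" e] by simp
next
  fix g h e assume a: "g \<in> carrier G" "h \<in> carrier G" "e \<in> carrier E"
  have "section_action E s (bd (s g \<otimes>\<^bsub>E\<^esub> s h)) e = section_action E s g (section_action E s h e)"
    using a by (subst section_action_lift)
      (simp_all add: s_closed section_action_def G.m_assoc G.inv_mult_group)
  then show "section_action E s (g \<otimes>\<^bsub>G\<^esub> h) e = section_action E s g (section_action E s h e)"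
    using a by (simp add: s_closed bd_s)
next
  fix g e assume "g \<in> carrier G" "e \<in> carrier E"
  then show "bd (section_action E s g e) = g \<otimes>\<^bsub>G\<^esub> bd e \<otimes>\<^bsub>G\<^esub> inv\<^bsub>G\<^esub> g"
    by (simp add: section_action_def s_closed bd_s)
next
  fix e f assume "e \<in> carrier E" "f \<in> carrier E"
  then show "section_action E s (bd e) f = e \<otimes>\<^bsub>E\<^esub> f \<otimes>\<^bsub>E\<^esub> inv\<^bsub>E\<^esub> e"
    by (rule section_action_lift)
qed

theorem derived_reidemeister_pair:
  assumes x: "x \<in> carrier G"
  shows "unframed_reidemeister_pair E G bd (section_action E s) (psi_at E G s x) (phi_at E G s x)"
proof -
  interpret crossed_module E G bd "section_action E s"
    by (rule section_crossed_module)
  define x' where "x' = s x"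
  have x': "x' \<in> carrier E" "x = bd x'"
    using x by (simp_all add: x'_def s_closed bd_s)
  have phi: "phi_at E G s x (bd a) (bd b) = commutator E (b \<otimes>\<^bsub>E\<^esub> inv\<^bsub>E\<^esub> x') (a \<otimes>\<^bsub>E\<^esub> inv\<^bsub>E\<^esub> x')"
    if "a \<in> carrier E" "b \<in> carrier E" for a b
    using that x' bracket_lift[of "b \<otimes>\<^bsub>E\<^esub> inv\<^bsub>E\<^esub> x'" "a \<otimes>\<^bsub>E\<^esub> inv\<^bsub>E\<^esub> x'"]
    by (simp add: phi_at_def)
  have psi: "psi_at E G s x (bd a) (bd b) =
      commutator E a b \<otimes>\<^bsub>E\<^esub> commutator E (b \<otimes>\<^bsub>E\<^esub> inv\<^bsub>E\<^esub> a) x'"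
    if "a \<in> carrier E" "b \<in> carrier E" for a b
    using that x' bracket_lift[of a b] bracket_lift[of "b \<otimes>\<^bsub>E\<^esub> inv\<^bsub>E\<^esub> a" x']
    by (simp add: psi_at_def)
  have lift: "\<exists>a. a \<in> carrier E \<and> X = bd a" if "X \<in> carrier G" for X
    using that s_closed bd_s by metis
  have under: "inv\<^bsub>G\<^esub> (bd a) \<otimes>\<^bsub>G\<^esub> inv\<^bsub>G\<^esub> (bd (phi_at E G s x (bd a) (bd b))) \<otimes>\<^bsub>G\<^esub> bd b \<otimes>\<^bsub>G\<^esub> bd a =
      bd (inv\<^bsub>E\<^esub> x' \<otimes>\<^bsub>E\<^esub> b \<otimes>\<^bsub>E\<^esub> inv\<^bsub>E\<^esub> a \<otimes>\<^bsub>E\<^esub> x' \<otimes>\<^bsub>E\<^esub> a)"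
    if ab: "a \<in> carrier E" "b \<in> carrier E" for a b
  proof -
    have "inv\<^bsub>E\<^esub> x' \<otimes>\<^bsub>E\<^esub> b \<otimes>\<^bsub>E\<^esub> inv\<^bsub>E\<^esub> a \<otimes>\<^bsub>E\<^esub> x' \<otimes>\<^bsub>E\<^esub> a =
        inv\<^bsub>E\<^esub> a \<otimes>\<^bsub>E\<^esub> inv\<^bsub>E\<^esub> (commutator E (b \<otimes>\<^bsub>E\<^esub> inv\<^bsub>E\<^esub> x') (a \<otimes>\<^bsub>E\<^esub> inv\<^bsub>E\<^esub> x')) \<otimes>\<^bsub>E\<^esub> b \<otimes>\<^bsub>E\<^esub> a"
      using ab x' by (simp add: commutator_def G.m_assoc G.inv_mult_group G.inv_cancel)
    moreover have "commutator E (b \<otimes>\<^bsub>E\<^esub> inv\<^bsub>E\<^esub> x') (a \<otimes>\<^bsub>E\<^esub> inv\<^bsub>E\<^esub> x') \<in> carrier E"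
      using ab x' by (simp add: commutator_def)
    ultimately show ?thesis
      using ab by (simp add: phi)
  qed
  show ?thesis
  proof unfold_locales
    fix X Y assume "X \<in> carrier G" "Y \<in> carrier G"
    then show "psi_at E G s x X Y \<in> carrier E" "phi_at E G s x X Y \<in> carrier E"
      using x by (simp_all add: psi_at_def phi_at_def bracket_def commutator_def s_closed)
  next
    fix X assume "X \<in> carrier G"
    then obtain a where a: "a \<in> carrier E" "X = bd a" using lift by blast
    show "psi_at E G s x X X = \<one>\<^bsub>E\<^esub>"
      using a x'(1) by (simp add: psi commutator_def G.m_assoc G.inv_cancel)
  next
    fix X Y Z
    assume XY: "X \<in> carrier G" "Y \<in> carrier G"
      and Z: "Z = inv\<^bsub>G\<^esub> X \<otimes>\<^bsub>G\<^esub> inv\<^bsub>G\<^esub> (bd (phi_at E G s x X Y)) \<otimes>\<^bsub>G\<^esub> Y \<otimes>\<^bsub>G\<^esub> X"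
    obtain a where a: "a \<in> carrier E" "X = bd a" using XY lift by blast
    obtain b where b: "b \<in> carrier E" "Y = bd b" using XY lift by blast
    define z where "z = inv\<^bsub>E\<^esub> x' \<otimes>\<^bsub>E\<^esub> b \<otimes>\<^bsub>E\<^esub> inv\<^bsub>E\<^esub> a \<otimes>\<^bsub>E\<^esub> x' \<otimes>\<^bsub>E\<^esub> a"
    have z: "z \<in> carrier E" "Z = bd z"
      using a(1) b(1) x'(1) Z[unfolded a b under[OF a(1) b(1)]] unfolding z_def by blast+
    show "phi_at E G s x X Y \<otimes>\<^bsub>E\<^esub> psi_at E G s x X Z = \<one>\<^bsub>E\<^esub>"
      unfolding z(2) a(2) b(2) phi[OF a(1) b(1)] psi[OF a(1) z(1)]
      by (rule G.word_identity_R2[OF a(1) b(1) x'(1) z_def])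
  next
    fix X Y T Z V W
    assume XYT: "X \<in> carrier G" "Y \<in> carrier G" "T \<in> carrier G"
      and Z: "Z = inv\<^bsub>G\<^esub> Y \<otimes>\<^bsub>G\<^esub> inv\<^bsub>G\<^esub> (bd (phi_at E G s x Y X)) \<otimes>\<^bsub>G\<^esub> X \<otimes>\<^bsub>G\<^esub> Y"
      and V: "V = inv\<^bsub>G\<^esub> T \<otimes>\<^bsub>G\<^esub> inv\<^bsub>G\<^esub> (bd (phi_at E G s x T Y)) \<otimes>\<^bsub>G\<^esub> Y \<otimes>\<^bsub>G\<^esub> T"
      and W: "W = inv\<^bsub>G\<^esub> T \<otimes>\<^bsub>G\<^esub> inv\<^bsub>G\<^esub> (bd (phi_at E G s x T X)) \<otimes>\<^bsub>G\<^esub> X \<otimes>\<^bsub>G\<^esub> T"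
    obtain a where a: "a \<in> carrier E" "X = bd a" using XYT lift by blast
    obtain b where b: "b \<in> carrier E" "Y = bd b" using XYT lift by blast
    obtain t where t: "t \<in> carrier E" "T = bd t" using XYT lift by blast
    define z where "z = inv\<^bsub>E\<^esub> x' \<otimes>\<^bsub>E\<^esub> a \<otimes>\<^bsub>E\<^esub> inv\<^bsub>E\<^esub> b \<otimes>\<^bsub>E\<^esub> x' \<otimes>\<^bsub>E\<^esub> b"
    have z: "z \<in> carrier E" "Z = bd z"
      using b(1) a(1) x'(1) Z[unfolded b a under[OF b(1) a(1)]] unfolding z_def by blast+
    define v where "v = inv\<^bsub>E\<^esub> x' \<otimes>\<^bsub>E\<^esub> b \<otimes>\<^bsub>E\<^esub> inv\<^bsub>E\<^esub> t \<otimes>\<^bsub>E\<^esub> x' \<otimes>\<^bsub>E\<^esub> t"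
    have v: "v \<in> carrier E" "V = bd v"
      using t(1) b(1) x'(1) V[unfolded t b under[OF t(1) b(1)]] unfolding v_def by blast+
    define w where "w = inv\<^bsub>E\<^esub> x' \<otimes>\<^bsub>E\<^esub> a \<otimes>\<^bsub>E\<^esub> inv\<^bsub>E\<^esub> t \<otimes>\<^bsub>E\<^esub> x' \<otimes>\<^bsub>E\<^esub> t"
    have w: "w \<in> carrier E" "W = bd w"
      using t(1) a(1) x'(1) W[unfolded t a under[OF t(1) a(1)]] unfolding w_def by blast+
    have closed: "commutator E (p \<otimes>\<^bsub>E\<^esub> inv\<^bsub>E\<^esub> x') (q \<otimes>\<^bsub>E\<^esub> inv\<^bsub>E\<^esub> x') \<in> carrier E"
      if "p \<in> carrier E" "q \<in> carrier E" for p q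
      using that x'(1) by (simp add: commutator_def)
    show "phi_at E G s x Y X \<otimes>\<^bsub>E\<^esub> section_action E s Y (phi_at E G s x T Z) \<otimes>\<^bsub>E\<^esub> phi_at E G s x T Y =
      section_action E s X (phi_at E G s x T Y) \<otimes>\<^bsub>E\<^esub> phi_at E G s x T X \<otimes>\<^bsub>E\<^esub>
      section_action E s T (phi_at E G s x V W)"
      unfolding z(2) v(2) w(2) a(2) b(2) t(2) phi[OF b(1) a(1)] phi[OF t(1) z(1)]
        phi[OF t(1) b(1)] phi[OF t(1) a(1)] phi[OF v(1) w(1)]
        section_action_lift[OF b(1) closed[OF z(1) t(1)]] section_action_lift[OF a(1) closed[OF b(1) t(1)]]
        section_action_lift[OF t(1) closed[OF w(1) v(1)]]
      by (rule G.word_identity_R3[OF a(1) b(1) t(1) x'(1) z_def v_def w_def])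
  qed
qed

end

end

end

theory Submission
  imports Defs
begin

text \<open>Write \<open>P\<close> for the knot group.  Let \<open>\<lambda>\<^sub>a\<close> be the partial product of the longitude up to the arc \<open>a\<close>;
  then the Wirtinger generator of \<open>a\<close> is \<open>\<lambda>\<^sub>a\<inverse> m \<lambda>\<^sub>a\<close>.  A homomorphism \<open>f\<close> with \<open>f m = x\<close>
  gives the colouring \<open>c a = f \<lambda>\<^sub>a\<close>, and a colouring \<open>c\<close> with top colour \<open>1\<close> gives back \<open>f\<close> through
  \<open>f (g\<^sub>a) = (c a)\<inverse> x (c a)\<close>; the colouring rules of the derived Reidemeister pair say exactly that these
  are inverse to each other.

  The homology of \<open>P\<close> is not needed.  The product of the strands on a horizontal line is preserved by the
  crossing relations, so the relation closing up the Wirtinger presentation is redundant, and \<open>f\<close>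
  lifts to a homomorphism \<open>F\<close> from \<open>P\<close> to \<open>E\<close>.  On commutators \<open>u \<and> v \<mapsto> {f(v), f(u)}\<inverse>\<close> is
  \<open>F [u, v]\<close>, so \<open>hat\<close> is \<open>F\<close> on the derived subgroup.  With the arcs coloured by \<open>F \<lambda>\<^sub>a\<close> in \<open>E\<close>, the
  evaluation is bottom times inverse of top on every elementary piece, hence on the whole diagram,
  where it equals \<open>F l\<close>.\<close>

section \<open>Presented groups\<close>

text \<open>Let \<open>X\<close> colour the over-arc, \<open>Y\<close> the lower and
  \<open>Z\<close> the upper under-arc. After cancellation the rules of the derived pair become
  \<open>x Y = Z (X^-1 x X)\<close> at a positive crossing and \<open>x Z = Y (X^-1 x X)\<close> at
  a negative one. In both cases \<open>Y\<close> is \<open>Z\<close> times a power of the conjugate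
  of \<open>x\<close> by \<open>Z\<close> and the opposite power of the conjugate of
  \<open>x\<close> by \<open>X\<close>: the factor of the longitude at this crossing, under
  \<open>f\<close>. For colours lifted to \<open>E\<close> the same equation holds exactly, and it
  makes the weight equal to bottom times inverse of top without a central error term, since brackets
  do not see which lifts are used.

  The obstacle is combinatorial. The longitude is a product over arcs met in order, found by
  definite descriptions, whereas a diagram is only known to be connected when directions are
  ignored. Counting the under-crossings before a point turns arcs into numbers, which provides the
  order and an induction over arcs. At a crossing this induction may not have reached the over-arc
  yet; the over-arc is therefore controlled only through its conjugate of \<open>x\<close>, which
  \<open>f\<close> supplies for all arcs at once.\<close>

lemma words_simps [simp]:
  "[] \<in> words S" "(a, e) # w \<in> words S \<longleftrightarrow> a \<in> S \<and> w \<in> words S"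
  "u @ v \<in> words S \<longleftrightarrow> u \<in> words S \<and> v \<in> words S"
  by (auto simp: words_def)

lemma presented_eq_in_words:
  "(u, v) \<in> presented_eq S R \<Longrightarrow> u \<in> words S \<and> v \<in> words S"
  by (induction rule: presented_eq.induct) auto

lemma equiv_presented_eq: "equiv (words S) (presented_eq S R)"
proof (rule equivI)
  show "presented_eq S R \<subseteq> words S \<times> words S"
    using presented_eq_in_words by fast
  show "refl_on (words S) (presented_eq S R)"
    by (auto intro!: refl_onI presented_eq.refl)
  show "sym (presented_eq S R)"
    by (auto intro!: symI intro: presented_eq.sym)
  show "trans (presented_eq S R)"
    by (rule transI) (rule presented_eq.trans)
qed

text \<open>Only \<open>cancel\<close> and \<open>relation\<close> carry a context, so congruence is
  obtained by absorbing \<open>p\<close> and \<open>q\<close> into the context of each elementary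
  step.\<close>

lemma presented_eq_context:
  assumes "(u, v) \<in> presented_eq S R" "p \<in> words S" "q \<in> words S"
  shows "(p @ u @ q, p @ v @ q) \<in> presented_eq S R"
  using assms
proof (induction rule: presented_eq.induct)
  case (cancel u v a e)
  then show ?case using presented_eq.cancel[of "p @ u" S "v @ q" a e R] by simp
next
  case (relation u v r r')
  then show ?case using presented_eq.relation[of "p @ u" S "v @ q" r r' R] by simp
next
  case (trans u v w)
  then show ?case by (metis presented_eq.trans)
qed (auto intro: presented_eq.refl presented_eq.sym)

lemma presented_eq_append:
  assumes "(u, u') \<in> presented_eq S R" "(v, v') \<in> presented_eq S R"
  shows "(u @ v, u' @ v') \<in> presented_eq S R"
proof (rule presented_eq.trans)
  show "(u @ v, u' @ v) \<in> presented_eq S R"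
    using presented_eq_context[OF assms(1), of "[]" v] presented_eq_in_words[OF assms(2)] by simp
  show "(u' @ v, u' @ v') \<in> presented_eq S R"
    using presented_eq_context[OF assms(2), of u' "[]"] presented_eq_in_words[OF assms(1)] by simp
qed

lemma presented_mult:
  assumes "u \<in> words S" "v \<in> words S"
  shows "presented_eq S R `` {u} \<otimes>\<^bsub>presented_group S R\<^esub> presented_eq S R `` {v} =
    presented_eq S R `` {u @ v}"
proof -
  have "congruent2 (presented_eq S R) (presented_eq S R) (\<lambda>u v. presented_eq S R `` {u @ v})"
    by (intro congruent2I') (auto intro!: equiv_class_eq[OF equiv_presented_eq] presented_eq_append)
  then show ?thesis
    using UN_equiv_class2[OF equiv_presented_eq equiv_presented_eq _ assms]
    by (simp add: presented_group_def)
qed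

lemma presented_carrierE:
  assumes "A \<in> carrier (presented_group S R)"
  obtains w where "w \<in> words S" "A = presented_eq S R `` {w}"
  using assms by (auto simp: presented_group_def elim: quotientE)

lemma presented_carrierI:
  "w \<in> words S \<Longrightarrow> presented_eq S R `` {w} \<in> carrier (presented_group S R)"
  by (auto simp: presented_group_def intro: quotientI)

lemma presented_one: "\<one>\<^bsub>presented_group S R\<^esub> = presented_eq S R `` {[]}"
  by (simp add: presented_group_def)

definition inverse_word :: "'a word \<Rightarrow> 'a word" where
  "inverse_word w = map (\<lambda>(a, e). (a, \<not> e)) (rev w)"

lemma inverse_word_in_words: "w \<in> words S \<Longrightarrow> inverse_word w \<in> words S"
  by (auto simp: inverse_word_def words_def)

lemma inverse_word_cancel: "w \<in> words S \<Longrightarrow> (inverse_word w @ w, []) \<in> presented_eq S R"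
proof (induction w)
  case Nil
  then show ?case by (simp add: inverse_word_def presented_eq.refl)
next
  case (Cons b w)
  obtain a e where b: "b = (a, e)" by (cases b)
  have w: "a \<in> S" "w \<in> words S" using Cons.prems by (simp_all add: b)
  \<comment> \<open>The double negation is kept so that the middle matches
    \<open>presented_eq.cancel\<close> for a letter of the opposite sign.\<close>
  have "inverse_word (b # w) @ b # w = inverse_word w @ [(a, \<not> e), (a, \<not> \<not> e)] @ w"
    by (simp add: inverse_word_def b)
  moreover have "(inverse_word w @ [(a, \<not> e), (a, \<not> \<not> e)] @ w, inverse_word w @ w) \<in> presented_eq S R"
    using w by (intro presented_eq.cancel inverse_word_in_words)
  ultimately show ?case
    using Cons.IH[OF w(2)] by (metis presented_eq.trans)
qed

lemma group_presented: "group (presented_group S R)"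
proof (rule groupI)
  fix x y assume "x \<in> carrier (presented_group S R)" "y \<in> carrier (presented_group S R)"
  then show "x \<otimes>\<^bsub>presented_group S R\<^esub> y \<in> carrier (presented_group S R)"
    by (elim presented_carrierE) (simp add: presented_mult presented_carrierI)
next
  show "\<one>\<^bsub>presented_group S R\<^esub> \<in> carrier (presented_group S R)"
    by (simp add: presented_one presented_carrierI)
next
  fix x y z
  assume "x \<in> carrier (presented_group S R)" "y \<in> carrier (presented_group S R)"
    "z \<in> carrier (presented_group S R)"
  then show "x \<otimes>\<^bsub>presented_group S R\<^esub> y \<otimes>\<^bsub>presented_group S R\<^esub> z =
      x \<otimes>\<^bsub>presented_group S R\<^esub> (y \<otimes>\<^bsub>presented_group S R\<^esub> z)"
    by (elim presented_carrierE) (simp add: presented_mult)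
next
  fix x assume "x \<in> carrier (presented_group S R)"
  then obtain w where w: "w \<in> words S" "x = presented_eq S R `` {w}" by (rule presented_carrierE)
  show "\<one>\<^bsub>presented_group S R\<^esub> \<otimes>\<^bsub>presented_group S R\<^esub> x = x"
    using w by (simp add: presented_one presented_mult)
  show "\<exists>y\<in>carrier (presented_group S R). y \<otimes>\<^bsub>presented_group S R\<^esub> x = \<one>\<^bsub>presented_group S R\<^esub>"
  proof (rule bexI)
    show "presented_eq S R `` {inverse_word w} \<otimes>\<^bsub>presented_group S R\<^esub> x = \<one>\<^bsub>presented_group S R\<^esub>"
      using w by (simp add: presented_mult inverse_word_in_words presented_one
          equiv_class_eq[OF equiv_presented_eq inverse_word_cancel])
  qed (simp add: w inverse_word_in_words presented_carrierI)
qed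

lemma generator_closed: "a \<in> S \<Longrightarrow> generator S R a \<in> carrier (presented_group S R)"
  by (simp add: generator_def presented_carrierI)

section \<open>Evaluation of words and the universal property of a presentation\<close>

definition word_value :: "('b, 'm) monoid_scheme \<Rightarrow> ('a \<Rightarrow> 'b) \<Rightarrow> 'a word \<Rightarrow> 'b" where
  "word_value H h w = foldr (\<lambda>(a, e) z. (if e then h a else inv\<^bsub>H\<^esub> h a) \<otimes>\<^bsub>H\<^esub> z) w \<one>\<^bsub>H\<^esub>"

lemma word_value_simps [simp]:
  "word_value H h [] = \<one>\<^bsub>H\<^esub>"
  "word_value H h ((a, e) # w) = (if e then h a else inv\<^bsub>H\<^esub> h a) \<otimes>\<^bsub>H\<^esub> word_value H h w"
  by (simp_all add: word_value_def)

lemma (in group) word_value_closed: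
  "h \<in> S \<rightarrow> carrier G \<Longrightarrow> w \<in> words S \<Longrightarrow> word_value G h w \<in> carrier G"
  by (induction w) (auto simp: Pi_iff)

lemma (in group) word_value_append:
  "\<lbrakk>h \<in> S \<rightarrow> carrier G; u \<in> words S; v \<in> words S\<rbrakk> \<Longrightarrow>
    word_value G h (u @ v) = word_value G h u \<otimes> word_value G h v"
  by (induction u) (auto simp: m_assoc word_value_closed Pi_iff)

lemma (in group) word_value_presented_eq:
  assumes "(u, v) \<in> presented_eq S R" and h: "h \<in> S \<rightarrow> carrier G"
    and R: "\<And>r r'. (r, r') \<in> R \<Longrightarrow> word_value G h r = word_value G h r'"
  shows "word_value G h u = word_value G h v"
  using assms(1)
proof (induction rule: presented_eq.induct)
  case (cancel u v a e)
  have ha: "h a \<in> carrier G" using h cancel(3) by auto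
  have "word_value G h ([(a, e), (a, \<not> e)] @ v) = word_value G h v"
    using ha word_value_closed[OF h cancel(2)] by (simp add: inv_cancel)
  then show ?case
    using cancel by (simp add: word_value_append[OF h])
next
  case (relation u v r r')
  then show ?case by (simp add: word_value_append[OF h] R)
qed auto

text \<open>Von Dyck's theorem. A class is evaluated at an arbitrary member, because evaluation is
  constant on classes.\<close>

lemma (in group) presented_hom_exists:
  assumes h: "h \<in> S \<rightarrow> carrier G"
    and R: "\<And>r r'. (r, r') \<in> R \<Longrightarrow> word_value G h r = word_value G h r'"
  obtains F where "F \<in> hom (presented_group S R) G" "\<And>a. a \<in> S \<Longrightarrow> F (generator S R a) = h a"
proof
  let ?F = "\<lambda>A. word_value G h (SOME u. u \<in> A)"
  have F: "?F (presented_eq S R `` {w}) = word_value G h w" if "w \<in> words S" for w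
  proof -
    have "w \<in> presented_eq S R `` {w}" using that by (simp add: presented_eq.refl)
    then have "(w, SOME u. u \<in> presented_eq S R `` {w}) \<in> presented_eq S R"
      by (metis ImageE singletonD someI)
    then show ?thesis using word_value_presented_eq[OF _ h R] by force
  qed
  show "?F \<in> hom (presented_group S R) G"
  proof (rule homI)
    fix A assume "A \<in> carrier (presented_group S R)"
    then show "?F A \<in> carrier G"
      by (elim presented_carrierE) (simp only: F word_value_closed[OF h])
  next
    fix A B assume "A \<in> carrier (presented_group S R)" "B \<in> carrier (presented_group S R)"
    then show "?F (A \<otimes>\<^bsub>presented_group S R\<^esub> B) = ?F A \<otimes> ?F B"
      by (elim presented_carrierE) (simp only: presented_mult words_simps F word_value_append[OF h])
  qed
  show "?F (generator S R a) = h a" if "a \<in> S" for a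
    using that h F[of "[(a, True)]"] by (auto simp: generator_def Pi_iff)
qed

text \<open>Writes every element as a product of generators and their inverses. This yields both the
  validity of the relations in the presented group and, with \<open>hom_word_value\<close>, the
  uniqueness of homomorphisms.\<close>

lemma word_class_eq_word_value:
  "w \<in> words S \<Longrightarrow>
    presented_eq S R `` {w} = word_value (presented_group S R) (generator S R) w"
proof (induction w)
  case Nil
  then show ?case by (simp add: presented_one)
next
  case (Cons b w)
  interpret P: group "presented_group S R" by (rule group_presented)
  obtain a e where b: "b = (a, e)" by (cases b)
  have w: "a \<in> S" "w \<in> words S" using Cons.prems by (simp_all add: b)
  have "presented_eq S R `` {[(a, False)]} \<otimes>\<^bsub>presented_group S R\<^esub> generator S R a =
      \<one>\<^bsub>presented_group S R\<^esub>"
    using w presented_eq.cancel[of "[]" S "[]" a False R]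
    by (simp add: generator_def presented_mult presented_one equiv_class_eq_iff[OF equiv_presented_eq])
  then have "inv\<^bsub>presented_group S R\<^esub> (generator S R a) = presented_eq S R `` {[(a, False)]}"
    using w by (intro P.inv_equality) (simp_all add: generator_closed presented_carrierI)
  then have "(if e then generator S R a else inv\<^bsub>presented_group S R\<^esub> (generator S R a)) =
      presented_eq S R `` {[(a, e)]}"
    by (simp add: generator_def)
  then show ?case
    using w Cons.IH[symmetric] by (simp add: b presented_mult)
qed

lemma (in group_hom) hom_word_value:
  "g \<in> S \<rightarrow> carrier G \<Longrightarrow> w \<in> words S \<Longrightarrow>
    h (word_value G g w) = word_value H (\<lambda>a. h (g a)) w"
proof (induction w)
  case (Cons b w)
  then show ?case by (cases b) (auto simp: G.word_value_closed Pi_iff)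
qed simp

lemma presented_relation:
  assumes "(r, r') \<in> R" "r \<in> words S" "r' \<in> words S"
  shows "word_value (presented_group S R) (generator S R) r =
    word_value (presented_group S R) (generator S R) r'"
  using assms presented_eq.relation[of "[]" S "[]" r r' R]
  by (simp flip: word_class_eq_word_value add: equiv_class_eq_iff[OF equiv_presented_eq])

lemma (in group) presented_hom_eq:
  assumes F: "F \<in> hom (presented_group S R) G" and F': "F' \<in> hom (presented_group S R) G"
    and eq: "\<And>a. a \<in> S \<Longrightarrow> F (generator S R a) = F' (generator S R a)"
    and A: "A \<in> carrier (presented_group S R)"
  shows "F A = F' A"
proof -
  obtain w where w: "w \<in> words S" "A = presented_eq S R `` {w}"
    using A by (rule presented_carrierE)
  have gen: "generator S R \<in> S \<rightarrow> carrier (presented_group S R)"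
    by (simp add: generator_closed)
  interpret P: group "presented_group S R" by (rule group_presented)
  interpret F: group_hom "presented_group S R" G F
    using F by unfold_locales
  interpret F': group_hom "presented_group S R" G F'
    using F' by unfold_locales
  have "word_value G (\<lambda>a. F (generator S R a)) w = word_value G (\<lambda>a. F' (generator S R a)) w"
    using w(1) by (induction w) (auto simp: eq)
  then show ?thesis
    using w F.hom_word_value[OF gen w(1)] F'.hom_word_value[OF gen w(1)]
    by (simp add: word_class_eq_word_value)
qed

text \<open>The values on generators fix a homomorphism on the carrier, and extensionality fixes it
  elsewhere; this is why a restriction appears.\<close>

lemma (in group) hom_determined_by_eq:
  assumes F: "F \<in> hom (presented_group S R) G"
    and eq: "\<And>a. a \<in> S \<Longrightarrow> F (generator S R a) = h a"
  shows "hom_determined_by S R G h = restrict F (carrier (presented_group S R))"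
  unfolding hom_determined_by_def
proof (rule the_equality)
  interpret P: group "presented_group S R" by (rule group_presented)
  have "restrict F (carrier (presented_group S R)) \<in> hom (presented_group S R) G"
    using F by (simp add: hom_def Pi_iff)
  then show "restrict F (carrier (presented_group S R)) \<in> hom (presented_group S R) G \<and>
      restrict F (carrier (presented_group S R)) \<in> extensional (carrier (presented_group S R)) \<and>
      (\<forall>a\<in>S. restrict F (carrier (presented_group S R)) (generator S R a) = h a)"
    by (simp add: eq generator_closed)
next
  fix F' assume F': "F' \<in> hom (presented_group S R) G \<and>
      F' \<in> extensional (carrier (presented_group S R)) \<and> (\<forall>a\<in>S. F' (generator S R a) = h a)"
  show "F' = restrict F (carrier (presented_group S R))"
  proof (rule extensionalityI)
    show "F' \<in> extensional (carrier (presented_group S R))" using F' by blast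
    fix A assume "A \<in> carrier (presented_group S R)"
    then show "F' A = restrict F (carrier (presented_group S R)) A"
      using F' presented_hom_eq[of F' S R F] F eq by simp
  qed simp
qed

section \<open>The wedge square\<close>

lemma (in group) conj_by_closed [simp]:
  "g \<in> carrier G \<Longrightarrow> h \<in> carrier G \<Longrightarrow> conj_by G g h \<in> carrier G"
  by (simp add: conj_by_def)

lemma (in group) commutator_closed [simp]:
  "g \<in> carrier G \<Longrightarrow> h \<in> carrier G \<Longrightarrow> commutator G g h \<in> carrier G"
  by (simp add: commutator_def)

lemma (in group) inv_commutator:
  "g \<in> carrier G \<Longrightarrow> h \<in> carrier G \<Longrightarrow> inv (commutator G g h) = commutator G h g"
  by (simp add: commutator_def inv_mult_group m_assoc)

lemma (in group) commutator_in_derived: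
  "\<lbrakk>g \<in> carrier G; h \<in> carrier G\<rbrakk> \<Longrightarrow> commutator G g h \<in> derived G (carrier G)"
  unfolding derived_def commutator_def by (rule generate.incl) auto

lemma (in group) commutator_wedge_relations:
  assumes "(r, r') \<in> wedge_relations G"
  shows "word_value G (\<lambda>(g, h). commutator G g h) r = word_value G (\<lambda>(g, h). commutator G g h) r'"
proof -
  \<comment> \<open>These are identities of the free group: after expansion
    \<open>word_simps\<close> reduces both sides to the same word.\<close>
  have "commutator G (g \<otimes> h) k = commutator G (conj_by G g h) (conj_by G g k) \<otimes> commutator G g k"
    "commutator G g (h \<otimes> k) = commutator G g h \<otimes> commutator G (conj_by G h g) (conj_by G h k)"
    if "g \<in> carrier G" "h \<in> carrier G" "k \<in> carrier G" for g h k
    unfolding commutator_def conj_by_def using that by (simp_all only: word_simps)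
  moreover have "commutator G g g = \<one>" if "g \<in> carrier G" for g
    unfolding commutator_def using that by (simp only: word_simps)
  ultimately show ?thesis
    using assms by (auto simp: wedge_relations_def tensor_relations_def)
qed

lemma (in group) wedge_to_derived:
  shows "wedge_to_derived G \<in> hom (wedge_square G) G"
    and "wedge_to_derived G ` carrier (wedge_square G) = derived G (carrier G)"
    and "\<And>g h. \<lbrakk>g \<in> carrier G; h \<in> carrier G\<rbrakk> \<Longrightarrow>
      wedge_to_derived G (generator (carrier G \<times> carrier G) (wedge_relations G) (g, h)) =
      commutator G g h"
proof -
  let ?S = "carrier G \<times> carrier G" and ?c = "\<lambda>(g, h). commutator G g h"
  let ?D = "G\<lparr>carrier := derived G (carrier G)\<rparr>"
  have sub: "subgroup (derived G (carrier G)) G"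
    by (rule derived_is_subgroup) simp
  interpret D: group ?D
    using subgroup.subgroup_is_group[OF sub group_axioms] .
  have c: "?c \<in> ?S \<rightarrow> carrier ?D"
    by (auto intro: commutator_in_derived)
  \<comment> \<open>The group \<open>?D\<close> has its own inverse operation; on a subgroup it
    agrees with the one of \<open>G\<close>.\<close>
  have val: "word_value ?D ?c w = word_value G ?c w" if "w \<in> words ?S" for w
    using that
    by (induction w) (auto simp: m_inv_consistent[OF sub commutator_in_derived])
  have rel: "word_value ?D ?c r = word_value ?D ?c r'" if "(r, r') \<in> wedge_relations G" for r r'
  proof -
    have "r \<in> words ?S" "r' \<in> words ?S"
      using that by (auto simp: wedge_relations_def tensor_relations_def)
    then show ?thesis using commutator_wedge_relations[OF that] by (simp add: val)
  qed
  obtain F where F: "F \<in> hom (wedge_square G) ?D"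
      "\<And>a. a \<in> ?S \<Longrightarrow> F (generator ?S (wedge_relations G) a) = ?c a"
    using D.presented_hom_exists[OF c rel] unfolding wedge_square_def by metis
  have delta: "wedge_to_derived G = restrict F (carrier (wedge_square G))"
    using D.hom_determined_by_eq[of F ?S "wedge_relations G" ?c] F
    by (simp add: wedge_to_derived_def wedge_square_def)
  interpret W: group "wedge_square G"
    unfolding wedge_square_def by (rule group_presented)
  have gen: "generator ?S (wedge_relations G) a \<in> carrier (wedge_square G)" if "a \<in> ?S" for a
    unfolding wedge_square_def using that by (rule generator_closed)
  show hom: "wedge_to_derived G \<in> hom (wedge_square G) G"
    using F(1) subgroup.mem_carrier[OF sub] by (fastforce simp: delta hom_def)
  show comm: "wedge_to_derived G (generator ?S (wedge_relations G) (g, h)) = commutator G g h"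
    if "g \<in> carrier G" "h \<in> carrier G" for g h
    using that gen F(2)[of "(g, h)"] by (simp add: delta)
  interpret delta: group_hom "wedge_square G" G "wedge_to_derived G"
    using hom by unfold_locales
  show "wedge_to_derived G ` carrier (wedge_square G) = derived G (carrier G)"
  proof
    show "wedge_to_derived G ` carrier (wedge_square G) \<subseteq> derived G (carrier G)"
      using F(1) by (auto simp: delta hom_def)
    show "derived G (carrier G) \<subseteq> wedge_to_derived G ` carrier (wedge_square G)"
      unfolding derived_def
    proof (rule generate_subgroup_incl)
      show "subgroup (wedge_to_derived G ` carrier (wedge_square G)) G"
        using delta.img_is_subgroup .
      show "derived_set G (carrier G) \<subseteq> wedge_to_derived G ` carrier (wedge_square G)"
      proof
        fix c assume "c \<in> derived_set G (carrier G)"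
        then obtain g h where gh: "g \<in> carrier G" "h \<in> carrier G" "c = commutator G g h"
          by (auto simp: commutator_def)
        then show "c \<in> wedge_to_derived G ` carrier (wedge_square G)"
          using imageI[OF gen, of "(g, h)" "wedge_to_derived G"] comm[OF gh(1,2)] by simp
      qed
    qed
  qed
qed

text \<open>A lift of \<open>f\<close> through the central extension computes \<open>hat\<close>, whether or not \<open>\<delta>\<close> is injective.\<close>

lemma (in central_extension) hat_eq_lift:
  assumes s: "is_section E G bd s" and "group P" and F: "F \<in> hom P E"
    and f: "\<And>u. u \<in> carrier P \<Longrightarrow> f u = bd (F u)"
    and l: "l \<in> derived P (carrier P)"
  shows "hat E s P f l = F l"
proof -
  interpret P: group P by fact
  let ?S = "carrier P \<times> carrier P" and ?R = "wedge_relations P"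
  let ?b = "\<lambda>(u, v). inv\<^bsub>E\<^esub> (bracket E s (f v) (f u))"
  interpret F: group_hom P E F
    using F by unfold_locales
  have hom: "F \<circ> wedge_to_derived P \<in> hom (wedge_square P) E"
    using P.wedge_to_derived(1) F by (rule Group.hom_compose)
  have val: "(F \<circ> wedge_to_derived P) (generator ?S ?R a) = ?b a" if "a \<in> ?S" for a
  proof -
    from that obtain u v where a: "a = (u, v)" "u \<in> carrier P" "v \<in> carrier P" by blast
    \<comment> \<open>Inverting a commutator swaps its entries, and the bracket may be computed with
      the lifts provided by \<open>F\<close> instead of those of \<open>s\<close>.\<close>
    have "?b a = commutator E (F u) (F v)"
      using a F.hom_closed by (simp only: f bracket_lift[OF s] G.inv_commutator prod.case)
    also have "\<dots> = F (commutator P u v)"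
      using a by (simp add: commutator_def)
    finally show ?thesis using a by (simp add: P.wedge_to_derived(3))
  qed
  have wedge: "wedge_hom E s P f = restrict (F \<circ> wedge_to_derived P) (carrier (wedge_square P))"
    unfolding wedge_hom_def
    using G.hom_determined_by_eq[of "F \<circ> wedge_to_derived P" ?S ?R ?b] hom val
    by (simp add: wedge_square_def)
  have l': "l \<in> wedge_to_derived P ` carrier (wedge_square P)"
    using l by (simp add: P.wedge_to_derived(2))
  show ?thesis
    unfolding hat_def wedge using inv_into_into[OF l'] f_inv_into_f[OF l'] by simp
qed

section \<open>Travelling along a string knot\<close>

text \<open>For a diagram, \<open>A\<close> will be the steps along arcs and \<open>B\<close> the
  steps under a crossing, so that the runs of \<open>A\<close> are the arcs. Connectedness is
  undirected, as in the definition of a diagram; that everything lies on one directed path is a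
  consequence.\<close>

locale marked_path =
  fixes A B :: "('p \<times> 'p) set" and V :: "'p set" and p0 p1 :: 'p
  assumes deterministic: "\<lbrakk>(p, q) \<in> A \<union> B; (p, q') \<in> A \<union> B\<rbrakk> \<Longrightarrow> q = q'"
    and codeterministic: "\<lbrakk>(p, q) \<in> A \<union> B; (p', q) \<in> A \<union> B\<rbrakk> \<Longrightarrow> p = p'"
    and disjoint: "A \<inter> B = {}"
    and marks_finite: "finite B"
    and steps_closed: "A \<union> B \<subseteq> V \<times> V"
    and start: "p0 \<in> V" "\<And>p. (p, p0) \<notin> A \<union> B"
    and stop: "p1 \<in> V" "\<And>p. (p1, p) \<notin> A \<union> B"
    and connected: "q \<in> V \<Longrightarrow> (p0, q) \<in> (A \<union> B \<union> (A \<union> B)\<inverse>)\<^sup>*"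
begin

definition position :: "'p \<Rightarrow> nat" where
  "position q = (THE n. (p0, q) \<in> (A \<union> B) ^^ n)"

text \<open>A marked step is counted by its source, so the count goes up exactly at its
  target.\<close>

definition marks_before :: "'p \<Rightarrow> nat" where
  "marks_before q = card {e \<in> B. position (fst e) < position q}"

lemma step_ends: "(p, q) \<in> A \<union> B \<Longrightarrow> p \<in> V \<and> q \<in> V"
  using steps_closed by blast

text \<open>Follow the undirected path. A step traversed backwards undoes the last step of the
  directed path, by codeterminism; at \<open>p0\<close> there is nothing to undo, since no step
  enters it.\<close>

lemma reachable:
  assumes "q \<in> V"
  shows "(p0, q) \<in> (A \<union> B)\<^sup>*"
  using connected[OF assms]
proof (induction rule: rtrancl_induct)
  case (step q q')
  then consider "(q, q') \<in> A \<union> B" | "(q', q) \<in> A \<union> B" by blast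
  then show ?case
  proof cases
    case 1
    then show ?thesis using step.IH by (rule rtrancl_into_rtrancl[rotated])
  next
    case 2
    note reversed = this
    from step.IH show ?thesis
    proof (cases rule: rtranclE)
      case base
      then show ?thesis using reversed start(2) by blast
    next
      case (step q'')
      then show ?thesis using reversed codeterministic by blast
    qed
  qed
qed simp

text \<open>Two paths ending at the same point have the same last step. Removing last steps in
  parallel, both must arrive at \<open>p0\<close> together, because nothing enters
  \<open>p0\<close>; in particular there are no cycles, and \<open>position\<close> is well
  defined.\<close>

lemma relpow_unique: "(p0, q) \<in> (A \<union> B) ^^ n \<Longrightarrow> (p0, q) \<in> (A \<union> B) ^^ m \<Longrightarrow> n = m"
proof (induction n arbitrary: q m)
  case 0
  then show ?case using start by (cases m) auto
next
  case (Suc n)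
  from Suc.prems(1) obtain p where p: "(p0, p) \<in> (A \<union> B) ^^ n" "(p, q) \<in> A \<union> B"
    by (rule relpow_Suc_E)
  show ?case
  proof (cases m)
    case 0
    then show ?thesis using p Suc.prems(2) start(2) by simp
  next
    case (Suc m')
    then obtain p' where "(p0, p') \<in> (A \<union> B) ^^ m'" "(p', q) \<in> A \<union> B"
      using Suc.prems(2) by (auto elim: relpow_Suc_E)
    then show ?thesis using Suc.IH p codeterministic Suc by blast
  qed
qed

lemma position_eq: "(p0, q) \<in> (A \<union> B) ^^ n \<Longrightarrow> position q = n"
  unfolding position_def using relpow_unique by blast

lemma at_position: "q \<in> V \<Longrightarrow> (p0, q) \<in> (A \<union> B) ^^ position q"
  using reachable position_eq by (metis rtrancl_power)

lemma position_start: "position p0 = 0"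
  by (rule position_eq) simp

lemma relpow_deterministic:
  "(p, q) \<in> (A \<union> B) ^^ n \<Longrightarrow> (p, q') \<in> (A \<union> B) ^^ n \<Longrightarrow> q = q'"
proof (induction n arbitrary: q q')
  case (Suc n)
  then show ?case by (metis relpow_Suc_E deterministic)
qed simp

text \<open>The path from \<open>p0\<close> to \<open>q'\<close> is cut after
  \<open>position q\<close> steps; by determinism the cut point is \<open>q\<close>.\<close>

lemma path_between:
  assumes "q \<in> V" "q' \<in> V" "position q \<le> position q'"
  shows "(q, q') \<in> (A \<union> B) ^^ (position q' - position q)"
proof -
  have "(p0, q') \<in> (A \<union> B) ^^ position q O (A \<union> B) ^^ (position q' - position q)"
    using at_position[OF assms(2)] assms(3) by (simp flip: relpow_add)
  then show ?thesis
    using relpow_deterministic[OF at_position[OF assms(1)]] by auto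
qed

lemma position_inj: "\<lbrakk>q \<in> V; q' \<in> V; position q = position q'\<rbrakk> \<Longrightarrow> q = q'"
  using path_between[of q q'] by simp

lemma position_step: "(p, q) \<in> A \<union> B \<Longrightarrow> position q = Suc (position p)"
  using steps_closed by (intro position_eq relpow_Suc_I[OF at_position]) auto

lemma marks_before_mono: "position q \<le> position q' \<Longrightarrow> marks_before q \<le> marks_before q'"
  unfolding marks_before_def using marks_finite by (intro card_mono) auto

text \<open>The only step leaving \<open>p\<close> is the unmarked one, and \<open>p\<close> is the
  only point at its position, so no marked step starts there.\<close>

lemma marks_before_unmarked:
  assumes "(p, q) \<in> A"
  shows "marks_before q = marks_before p"
proof -
  have "position (fst e) \<noteq> position p" if "e \<in> B" for e
  proof
    assume "position (fst e) = position p"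
    then have "fst e = p" using that assms steps_closed by (intro position_inj) auto
    then have "e = (p, q)" using that assms deterministic by (cases e) auto
    then show False using that assms disjoint by auto
  qed
  then have "{e \<in> B. position (fst e) < position q} = {e \<in> B. position (fst e) < position p}"
    using position_step[of p q] assms by (auto simp: less_Suc_eq)
  then show ?thesis by (simp add: marks_before_def)
qed

lemma marks_before_marked:
  assumes "(p, q) \<in> B"
  shows "marks_before q = Suc (marks_before p)"
proof -
  have marked: "e = (p, q)" if "e \<in> B" "position (fst e) = position p" for e
  proof -
    have "fst e = p" using that assms steps_closed by (intro position_inj) auto
    then show ?thesis using that assms deterministic by (cases e) auto
  qed
  have "{e \<in> B. position (fst e) < position q} =
      insert (p, q) {e \<in> B. position (fst e) < position p}"
  proof (intro equalityI subsetI)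
    fix e assume "e \<in> {e \<in> B. position (fst e) < position q}"
    then have "e \<in> B" "position (fst e) < position p \<or> position (fst e) = position p"
      using position_step[of p q] assms by (auto simp: less_Suc_eq)
    then show "e \<in> insert (p, q) {e \<in> B. position (fst e) < position p}"
      using marked by blast
  next
    fix e assume "e \<in> insert (p, q) {e \<in> B. position (fst e) < position p}"
    then show "e \<in> {e \<in> B. position (fst e) < position q}"
      using position_step[of p q] assms by auto
  qed
  then show ?thesis using marks_finite by (simp add: marks_before_def)
qed

lemma marks_before_start: "marks_before p0 = 0"
  by (simp add: marks_before_def position_start)

text \<open>A marked step starting at or behind \<open>p1\<close> would have its source on a
  directed path out of \<open>p1\<close>, but no step leaves \<open>p1\<close>.\<close>

lemma marks_before_stop: "marks_before p1 = card B"
proof -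
  have "position (fst e) < position p1" if "e \<in> B" for e
  proof (rule ccontr)
    assume "\<not> ?thesis"
    moreover have e: "fst e \<in> V" using that steps_closed by auto
    ultimately have "(p1, fst e) \<in> (A \<union> B) ^^ (position (fst e) - position p1)"
      using stop(1) by (intro path_between) auto
    then have "(p1, fst e) \<in> (A \<union> B)\<^sup>*" by (rule relpow_imp_rtrancl)
    then have "fst e = p1" using stop(2) by (auto elim: converse_rtranclE)
    then show False using that stop(2)[of "snd e"] by auto
  qed
  then have "{e \<in> B. position (fst e) < position p1} = B" by auto
  then show ?thesis by (simp add: marks_before_def)
qed

text \<open>Passing the marked step at the earlier of two positions already raises the count, so
  equal counts force equal positions.\<close>

lemma marked_unique:
  assumes "(p, q) \<in> B" "(p', q') \<in> B" "marks_before p = marks_before p'"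
  shows "p = p'"
proof -
  have V: "p \<in> V" "p' \<in> V" using assms steps_closed by auto
  have "\<not> position p < position p'" if "(p, q) \<in> B" "marks_before p = marks_before p'" for p q p'
    using that marks_before_marked[of p q] marks_before_mono[of q p'] position_step[of p q] by force
  then have "position p = position p'" using assms by (metis nat_neq_iff)
  then show ?thesis using V position_inj by blast
qed

text \<open>The count never decreases along the path; if it is the same at both ends, no step in
  between can be marked.\<close>

lemma unmarked_path:
  assumes "q \<in> V" "q' \<in> V" "position q \<le> position q'" "marks_before q = marks_before q'"
  shows "(q, q') \<in> A\<^sup>*"
  using assms(2-4)
proof (induction "position q'" arbitrary: q')
  case 0
  then show ?case using position_inj[OF assms(1) \<open>q' \<in> V\<close>] by simp
next
  case (Suc n)
  show ?case
  proof (cases "position q = position q'")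
    case True
    then show ?thesis using position_inj[OF assms(1) \<open>q' \<in> V\<close>] by simp
  next
    case False
    obtain p where p: "(p0, p) \<in> (A \<union> B) ^^ n" "(p, q') \<in> A \<union> B"
      using at_position[OF Suc.prems(1)] Suc.hyps(2) by (metis relpow_Suc_E)
    have pos: "position p = n" using p(1) by (rule position_eq)
    have pV: "p \<in> V" using p(2) steps_closed by auto
    have le: "position q \<le> position p" using False pos Suc.prems Suc.hyps(2) by simp
    have "marks_before q \<le> marks_before p" "marks_before p \<le> marks_before q'"
      using le pos Suc.hyps(2) by (auto intro!: marks_before_mono)
    then have eq: "marks_before q = marks_before p" "marks_before p = marks_before q'"
      using Suc.prems(3) by auto
    then have "(p, q') \<in> A" using p(2) marks_before_marked[of p q'] by auto
    then show ?thesis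
      using Suc.hyps(1)[OF pos[symmetric] pV le eq(1)] by (rule rtrancl_into_rtrancl[rotated])
  qed
qed

text \<open>Replaces the equivalence closure that defines an arc by equality of two numbers.\<close>

lemma same_run_iff:
  assumes "q \<in> V" "q' \<in> V"
  shows "(q, q') \<in> (A \<union> A\<inverse>)\<^sup>* \<longleftrightarrow> marks_before q = marks_before q'"
proof
  assume "(q, q') \<in> (A \<union> A\<inverse>)\<^sup>*"
  then show "marks_before q = marks_before q'"
    by (induction rule: rtrancl_induct) (auto dest: marks_before_unmarked)
next
  assume eq: "marks_before q = marks_before q'"
  have "(q, q') \<in> A\<^sup>* \<or> (q', q) \<in> A\<^sup>*"
    using unmarked_path[OF assms] unmarked_path[OF assms(2,1)] eq by fastforce
  then show "(q, q') \<in> (A \<union> A\<inverse>)\<^sup>*"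
    by (metis in_rtrancl_UnI rtrancl_converseI)
qed

end

section \<open>Steps of a diagram\<close>

lemma tangle_diagram_strip_top:
  assumes "tangle_diagram u D v" "k < length D"
  shows "strip_top (D ! k) = (case k of 0 \<Rightarrow> u | Suc j \<Rightarrow> strip_bottom (D ! j))"
  using assms
proof (induction D arbitrary: u k)
  case (Cons t D)
  show ?case
  proof (cases k)
    case (Suc j)
    then show ?thesis using Cons.IH[of "strip_bottom t" j] Cons.prems by (cases j) auto
  qed (use Cons.prems in simp)
qed simp

lemma tangle_diagram_end:
  "tangle_diagram u D v \<Longrightarrow>
    (case length D of 0 \<Rightarrow> u | Suc j \<Rightarrow> strip_bottom (D ! j)) = v"
proof (induction D arbitrary: u)
  case (Cons t D)
  then show ?case using Cons.IH[of "strip_bottom t"] by (cases D) auto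
qed simp

definition strip_steps :: "strip list \<Rightarrow> nat \<Rightarrow> (point \<times> point) set" where
  "strip_steps D k = vertical_steps D k \<union> piece_steps D k \<union>
    (if k \<in> crossings D then {(under_top D k, under_bottom D k)} else {})"

locale string_knot =
  fixes D :: "strip list"
  assumes diagram: "string_knot_diagram D"
begin

lemma level_strip:
  assumes "k < length D"
  shows "level D k = left_strands (D ! k) @ piece_top (piece_at D k) @ right_strands (D ! k)"
    and "level D (Suc k) = left_strands (D ! k) @ piece_bottom (piece_at D k) @ right_strands (D ! k)"
  using tangle_diagram_strip_top[of "[Down]" D "[Down]" k] diagram assms
  by (simp_all add: string_knot_diagram_def level_def strip_top_def strip_bottom_def)

lemma level_ends: "level D 0 = [Down]" "level D (length D) = [Down]"
  using tangle_diagram_end[of "[Down]" D "[Down]"] diagram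
  by (simp_all add: string_knot_diagram_def level_def)

lemma end_points: "(0, 0) \<in> points D" "(length D, 0) \<in> points D"
  by (simp_all add: points_def level_ends)

lemma finite_points: "finite (points D)"
proof -
  have "points D = Sigma {..length D} (\<lambda>k. {..<length (level D k)})"
    by (auto simp: points_def)
  then show ?thesis by simp
qed

lemma steps_eq: "arc_steps D \<union> under_steps D = (\<Union>k<length D. strip_steps D k)"
  by (auto simp: arc_steps_def under_steps_def strip_steps_def crossings_def split: if_splits)

lemma vertical_steps_cases:
  assumes "k < length D" "(p, q) \<in> vertical_steps D k"
  shows "\<exists>i j. i < length (level D k) \<and> j < length (level D (Suc k)) \<and>
    level D k ! i = level D (Suc k) ! j \<and> (p, q) = oriented (level D k ! i) (k, i) (Suc k, j)"
proof -
  let ?l = "left_strands (D ! k)" and ?r = "right_strands (D ! k)"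
  let ?t = "piece_top (piece_at D k)" and ?b = "piece_bottom (piece_at D k)"
  consider i where "i < length ?l" "(p, q) = oriented (?l ! i) (k, i) (Suc k, i)"
    | i where "i < length ?r"
      "(p, q) = oriented (?r ! i) (k, length ?l + length ?t + i) (Suc k, length ?l + length ?b + i)"
    using assms(2) by (auto simp: vertical_steps_def offset_def Let_def)
  then show ?thesis
  proof cases
    case 1
    then show ?thesis
      by (intro exI[of _ i]) (simp add: level_strip[OF assms(1)] nth_append)
  next
    case 2
    then show ?thesis
      by (intro exI[of _ "length ?l + length ?t + i"] exI[of _ "length ?l + length ?b + i"])
        (simp add: level_strip[OF assms(1)] nth_append)
  qed
qed

text \<open>A step crosses the strip in the direction of its strand, or runs along a cup from its
  downward to its upward leg, or along a cap from its upward to its downward leg. The directions are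
  recorded because they tell on which side of a point its steps lie.\<close>

lemma strip_steps_cases:
  assumes "k < length D" "(p, q) \<in> strip_steps D k"
  shows "(\<exists>i j. i < length (level D k) \<and> j < length (level D (Suc k)) \<and>
      level D k ! i = level D (Suc k) ! j \<and> (p, q) = oriented (level D k ! i) (k, i) (Suc k, j)) \<or>
    (\<exists>i j. i < length (level D k) \<and> j < length (level D k) \<and>
      level D k ! i = Down \<and> level D k ! j = Up \<and> (p, q) = ((k, i), (k, j))) \<or>
    (\<exists>i j. i < length (level D (Suc k)) \<and> j < length (level D (Suc k)) \<and>
      level D (Suc k) ! i = Up \<and> level D (Suc k) ! j = Down \<and> (p, q) = ((Suc k, i), (Suc k, j)))"
proof -
  have top: "offset D k + i < length (level D k) \<and>
      level D k ! (offset D k + i) = piece_top (piece_at D k) ! i"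
    if "i < length (piece_top (piece_at D k))" for i
    using that by (simp add: level_strip[OF assms(1)] offset_def nth_append)
  have bottom: "offset D k + i < length (level D (Suc k)) \<and>
      level D (Suc k) ! (offset D k + i) = piece_bottom (piece_at D k) ! i"
    if "i < length (piece_bottom (piece_at D k))" for i
    using that by (simp add: level_strip[OF assms(1)] offset_def nth_append)
  consider (vertical) "(p, q) \<in> vertical_steps D k"
    | (crossing) i j where "piece_at D k \<in> {Some XPlus, Some XMinus}" "i < 2" "j < 2"
      "p = (k, offset D k + i)" "q = (Suc k, offset D k + j)"
    | (cup) o1 where "piece_at D k = Some (Cup o1)"
      "(p, q) = oriented o1 (k, offset D k) (k, offset D k + 1)"
    | (cap) o1 where "piece_at D k = Some (Cap o1)"
      "(p, q) = oriented o1 (Suc k, offset D k + 1) (Suc k, offset D k)"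
  proof -
    have "(p, q) \<in> vertical_steps D k \<or> (p, q) \<in> piece_steps D k \<or>
        k \<in> crossings D \<and> (p, q) = (under_top D k, under_bottom D k)"
      using assms(2) by (auto simp: strip_steps_def split: if_splits)
    moreover have "\<exists>i j. i < 2 \<and> j < 2 \<and> p = (k, offset D k + i) \<and> q = (Suc k, offset D k + j)"
      if "(p, q) = (under_top D k, under_bottom D k) \<or> (p, q) = (over_top D k, over_bottom D k)"
    proof -
      have "1 < (2 :: nat)" "0 < (2 :: nat)" by simp_all
      then show ?thesis
        using that unfolding under_top_def under_bottom_def over_top_def over_bottom_def
        by (smt (verit) One_nat_def add_0_right prod.inject)
    qed
    ultimately show thesis
      using that by (auto simp: piece_steps_def crossings_def split: option.splits piece.splits)
  qed
  then show ?thesis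
  proof cases
    case vertical
    then show ?thesis using vertical_steps_cases[OF assms(1)] by blast
  next
    case (crossing i j)
    then have "length (piece_top (piece_at D k)) = 2" "length (piece_bottom (piece_at D k)) = 2"
      "piece_top (piece_at D k) ! i = Down" "piece_bottom (piece_at D k) ! j = Down"
      by (auto simp: less_2_cases_iff)
    then show ?thesis
      using crossing top[of i] bottom[of j] by (auto simp: oriented_def)
  next
    case (cup o1)
    then show ?thesis using top[of 0] top[of 1] by (cases o1) (auto simp: oriented_def)
  next
    case (cap o1)
    then show ?thesis using bottom[of 0] bottom[of 1] by (cases o1) (auto simp: oriented_def)
  qed
qed

text \<open>The direction of a strand at a point tells whether the step leaving it lies in the strip
  below or above the point; hence a point belongs to at most one step as source, and to at most
  one as target.\<close>

lemma strip_steps_ends: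
  assumes "k < length D" "(p, q) \<in> strip_steps D k"
  shows "p \<in> points D" "q \<in> points D"
    "k = (if level D (fst p) ! snd p = Down then fst p else fst p - 1)"
    "k = (if level D (fst q) ! snd q = Down then fst q - 1 else fst q)"
    "level D (fst q) ! snd q = Down \<Longrightarrow> fst q \<noteq> 0"
proof -
  have "p \<in> points D \<and> q \<in> points D \<and>
    k = (if level D (fst p) ! snd p = Down then fst p else fst p - 1) \<and>
    k = (if level D (fst q) ! snd q = Down then fst q - 1 else fst q) \<and>
    (level D (fst q) ! snd q = Down \<longrightarrow> fst q \<noteq> 0)"
    using strip_steps_cases[OF assms]
  proof (elim disjE exE conjE)
    fix i j
    assume ij: "i < length (level D k)" "j < length (level D (Suc k))"
      "level D k ! i = level D (Suc k) ! j" "(p, q) = oriented (level D k ! i) (k, i) (Suc k, j)"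
    show ?thesis
    proof (cases "level D k ! i = Down")
      case True
      then have "p = (k, i)" "q = (Suc k, j)" using ij(4) by (simp_all add: oriented_def)
      then show ?thesis using True ij(1-3) assms(1) by (simp add: points_def)
    next
      case False
      then have "q = (k, i)" "p = (Suc k, j)" using ij(4) by (simp_all add: oriented_def)
      then show ?thesis using False ij(1-3) assms(1) by (simp add: points_def)
    qed
  qed (use assms(1) in \<open>simp_all add: points_def\<close>)
  then show "p \<in> points D" "q \<in> points D"
    "k = (if level D (fst p) ! snd p = Down then fst p else fst p - 1)"
    "k = (if level D (fst q) ! snd q = Down then fst q - 1 else fst q)"
    "level D (fst q) ! snd q = Down \<Longrightarrow> fst q \<noteq> 0"
    by blast+
qed

definition inner_steps :: "nat \<Rightarrow> (point \<times> point) set" where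
  "inner_steps k = piece_steps D k \<union>
    (if k \<in> crossings D then {(under_top D k, under_bottom D k)} else {})"

lemma inner_steps_unique:
  assumes "(p, q) \<in> inner_steps k" "(p', q') \<in> inner_steps k"
  shows "p = p' \<longleftrightarrow> q = q'"
proof (cases "k \<in> crossings D")
  case True
  then have "inner_steps k = {(over_top D k, over_bottom D k), (under_top D k, under_bottom D k)}"
    unfolding inner_steps_def piece_steps_def crossings_def by auto
  moreover have "over_top D k \<noteq> under_top D k" "over_bottom D k \<noteq> under_bottom D k"
    by (simp_all add: over_top_def under_top_def over_bottom_def under_bottom_def)
  moreover have "p = p' \<longleftrightarrow> q = q'" if "(p, q) \<in> {(a, b), (c, d)}" "(p', q') \<in> {(a, b), (c, d)}"
    "a \<noteq> c" "b \<noteq> d" for a b c d :: point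
    using that by blast
  ultimately show ?thesis using assms by (simp only:)
next
  case False
  then have "(p, q) \<in> piece_steps D k" "(p', q') \<in> piece_steps D k"
    using assms by (simp_all add: inner_steps_def)
  then have "(p', q') = (p, q)"
    unfolding piece_steps_def by (auto simp: oriented_def split: option.splits piece.splits if_splits)
  then show ?thesis by simp
qed

text \<open>The steps of the piece have both ends among these points and vertical strands avoid
  them, so the two kinds of steps never share a source or a target.\<close>

definition piece_points :: "nat \<Rightarrow> point set" where
  "piece_points k = Pair k ` {offset D k ..< offset D k + length (piece_top (piece_at D k))} \<union>
    Pair (Suc k) ` {offset D k ..< offset D k + length (piece_bottom (piece_at D k))}"

lemma piece_points_iff [simp]:
  "(k, i) \<in> piece_points k \<longleftrightarrow>
    offset D k \<le> i \<and> i < offset D k + length (piece_top (piece_at D k))"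
  "(Suc k, i) \<in> piece_points k \<longleftrightarrow>
    offset D k \<le> i \<and> i < offset D k + length (piece_bottom (piece_at D k))"
  by (auto simp: piece_points_def)

lemma inner_steps_subset: "inner_steps k \<subseteq> piece_points k \<times> piece_points k"
proof (cases "piece_at D k \<in> {Some XPlus, Some XMinus}")
  case True
  then have "inner_steps k \<subseteq> {(over_top D k, over_bottom D k), (under_top D k, under_bottom D k)}"
    "length (piece_top (piece_at D k)) = 2" "length (piece_bottom (piece_at D k)) = 2"
    unfolding inner_steps_def piece_steps_def crossings_def by auto
  moreover have "{(over_top D k, over_bottom D k), (under_top D k, under_bottom D k)}
      \<subseteq> piece_points k \<times> piece_points k"
    using calculation(2,3)
    by (simp add: over_top_def under_top_def over_bottom_def under_bottom_def)
  ultimately show ?thesis by (meson order_trans)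
next
  case False
  then have "inner_steps k = piece_steps D k" by (auto simp: inner_steps_def crossings_def)
  then show ?thesis
    using False unfolding piece_steps_def crossings_def
    by (auto simp: oriented_def piece_points_def split: option.splits piece.splits)
qed

lemma vertical_steps_left_or_right:
  assumes "(p, q) \<in> vertical_steps D k"
  obtains i d where "i < offset D k" "d = left_strands (D ! k) ! i"
      "(p, q) = oriented d (k, i) (Suc k, i)"
    | i d where "d = right_strands (D ! k) ! i"
      "(p, q) = oriented d (k, offset D k + length (piece_top (piece_at D k)) + i)
        (Suc k, offset D k + length (piece_bottom (piece_at D k)) + i)"
  using assms unfolding vertical_steps_def offset_def Let_def by blast

lemma vertical_steps_outside:
  assumes "(p, q) \<in> vertical_steps D k"
  shows "p \<notin> piece_points k \<and> q \<notin> piece_points k"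
  using assms
proof (cases rule: vertical_steps_left_or_right)
  case (1 i d)
  then show ?thesis by (cases d) (simp_all add: oriented_def)
next
  case (2 i d)
  then show ?thesis by (cases d) (simp_all add: oriented_def)
qed

lemma vertical_inner_disjoint:
  assumes "(p, q) \<in> vertical_steps D k" "(p', q') \<in> inner_steps k"
  shows "p \<noteq> p' \<and> q \<noteq> q'"
  using vertical_steps_outside[OF assms(1)] subsetD[OF inner_steps_subset assms(2)] by auto

lemma vertical_steps_unique:
  assumes "(p, q) \<in> vertical_steps D k" "(p', q') \<in> vertical_steps D k"
  shows "p = p' \<longleftrightarrow> q = q'"
  using assms(1)
proof (cases rule: vertical_steps_left_or_right)
  case (1 i d)
  note pq = this
  from assms(2) show ?thesis
  proof (cases rule: vertical_steps_left_or_right)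
    case (1 j d')
    then show ?thesis using pq by (cases d; cases d'; cases "i = j") (simp_all add: oriented_def)
  next
    case (2 j d')
    then show ?thesis using pq by (cases d; cases d') (simp_all add: oriented_def)
  qed
next
  case (2 i d)
  note pq = this
  from assms(2) show ?thesis
  proof (cases rule: vertical_steps_left_or_right)
    case (1 j d')
    then show ?thesis using pq by (cases d; cases d') (simp_all add: oriented_def)
  next
    case (2 j d')
    then show ?thesis using pq by (cases d; cases d'; cases "i = j") (simp_all add: oriented_def)
  qed
qed

lemma strip_steps_eq: "strip_steps D k = vertical_steps D k \<union> inner_steps k"
  by (auto simp: strip_steps_def inner_steps_def)

lemma strip_steps_unique:
  assumes "(p, q) \<in> strip_steps D k" "(p', q') \<in> strip_steps D k"
  shows "p = p' \<longleftrightarrow> q = q'"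
  using assms vertical_inner_disjoint[of p q k p' q'] vertical_inner_disjoint[of p' q' k p q]
    vertical_steps_unique[of p q k p' q'] inner_steps_unique[of p q k p' q']
  unfolding strip_steps_eq by blast

lemma under_step_not_in_strip:
  assumes "k \<in> crossings D"
  shows "(under_top D k, under_bottom D k) \<notin> vertical_steps D k \<union> piece_steps D k"
proof -
  have "(under_top D k, under_bottom D k) \<in> inner_steps k"
    using assms by (simp add: inner_steps_def)
  then have "(under_top D k, under_bottom D k) \<notin> vertical_steps D k"
    using vertical_inner_disjoint[of "under_top D k" _ k "under_top D k"] by blast
  moreover have "piece_steps D k = {(over_top D k, over_bottom D k)}"
    using assms unfolding piece_steps_def crossings_def by auto
  ultimately show ?thesis by (simp add: over_top_def under_top_def)
qed

lemma steps_disjoint: "arc_steps D \<inter> under_steps D = {}"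
proof -
  have False if k: "k \<in> crossings D" and j: "j < length D"
    and m: "(under_top D k, under_bottom D k) \<in> vertical_steps D j \<union> piece_steps D j" for k j
  proof -
    have "(under_top D k, under_bottom D k) \<in> strip_steps D k"
      "(under_top D k, under_bottom D k) \<in> strip_steps D j" "k < length D"
      using k m by (auto simp: strip_steps_def crossings_def)
    then have "k = j"
      using strip_steps_ends(3)[of k "under_top D k" "under_bottom D k"]
        strip_steps_ends(3)[OF j, of "under_top D k" "under_bottom D k"] by simp
    then show False using m under_step_not_in_strip[OF k] by simp
  qed
  then show ?thesis by (fastforce simp: arc_steps_def under_steps_def)
qed

sublocale marked_path "arc_steps D" "under_steps D" "points D" "(0, 0)" "(length D, 0)"
proof
  fix p q q' assume "(p, q) \<in> arc_steps D \<union> under_steps D" "(p, q') \<in> arc_steps D \<union> under_steps D"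
  then obtain k k' where kk: "k < length D" "(p, q) \<in> strip_steps D k"
      "k' < length D" "(p, q') \<in> strip_steps D k'"
    unfolding steps_eq by blast
  have "k = k'"
    using strip_steps_ends(3)[OF kk(1,2)] strip_steps_ends(3)[OF kk(3,4)] by (simp only:)
  then show "q = q'" using kk strip_steps_unique by blast
next
  fix p q p' assume "(p, q) \<in> arc_steps D \<union> under_steps D" "(p', q) \<in> arc_steps D \<union> under_steps D"
  then obtain k k' where kk: "k < length D" "(p, q) \<in> strip_steps D k"
      "k' < length D" "(p', q) \<in> strip_steps D k'"
    unfolding steps_eq by blast
  have "k = k'"
    using strip_steps_ends(4)[OF kk(1,2)] strip_steps_ends(4)[OF kk(3,4)] by (simp only:)
  then show "p = p'" using kk strip_steps_unique by blast
next
  show "arc_steps D \<inter> under_steps D = {}" by (rule steps_disjoint)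
  show "finite (under_steps D)" by (simp add: under_steps_def crossings_def)
  show "arc_steps D \<union> under_steps D \<subseteq> points D \<times> points D"
    unfolding steps_eq using strip_steps_ends(1,2) by fast
  show "(0, 0) \<in> points D" "(length D, 0) \<in> points D" by (rule end_points)+
  show "(p, (0, 0)) \<notin> arc_steps D \<union> under_steps D" for p
    unfolding steps_eq using strip_steps_ends(5)[of _ p "(0, 0)"] by (auto simp: level_ends)
  show "((length D, 0), p) \<notin> arc_steps D \<union> under_steps D" for p
    unfolding steps_eq using strip_steps_ends(3)[of _ "(length D, 0)" p] by (auto simp: level_ends)
  show "((0, 0), q) \<in> (arc_steps D \<union> under_steps D \<union> (arc_steps D \<union> under_steps D)\<inverse>)\<^sup>*"
    if "q \<in> points D" for q
    using diagram that end_points(1) by (simp add: string_knot_diagram_def)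
qed

section \<open>Arcs as runs between under-crossings, and their numbering\<close>

lemma arc_eq_iff:
  assumes "p \<in> points D" "q \<in> points D"
  shows "arc D p = arc D q \<longleftrightarrow> marks_before p = marks_before q"
proof -
  have "equiv UNIV ((arc_steps D \<union> (arc_steps D)\<inverse>)\<^sup>*)"
    by (intro equivI refl_rtrancl sym_rtrancl trans_rtrancl) (auto simp: sym_Un_converse)
  then have "arc D p = arc D q \<longleftrightarrow> (p, q) \<in> (arc_steps D \<union> (arc_steps D)\<inverse>)\<^sup>*"
    unfolding arc_def by (simp add: eq_equiv_class_iff)
  then show ?thesis using same_run_iff[OF assms] by simp
qed

lemma arc_step_eq:
  assumes "(p, q) \<in> arc_steps D"
  shows "arc D p = arc D q"
proof -
  have "p \<in> points D" "q \<in> points D" using step_ends[OF UnI1[OF assms]] by simp_all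
  then show ?thesis using marks_before_unmarked[OF assms] by (simp add: arc_eq_iff)
qed

lemma crossing_points:
  assumes "k \<in> crossings D"
  shows "over_top D k \<in> points D" "over_bottom D k \<in> points D"
    "under_top D k \<in> points D" "under_bottom D k \<in> points D"
proof -
  have k: "k < length D" using assms by (simp add: crossings_def)
  have "(under_top D k, under_bottom D k) \<in> strip_steps D k"
    using assms by (simp add: strip_steps_def)
  then show "under_top D k \<in> points D" "under_bottom D k \<in> points D"
    by (rule strip_steps_ends(1,2)[OF k])+
  have "(over_top D k, over_bottom D k) \<in> strip_steps D k"
    using assms by (auto simp: strip_steps_def piece_steps_def crossings_def)
  then show "over_top D k \<in> points D" "over_bottom D k \<in> points D"
    by (rule strip_steps_ends(1,2)[OF k])+
qed

lemma crossing_arcs: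
  assumes "k \<in> crossings D"
  shows "over_arc D k \<in> arcs D" "upper_under_arc D k \<in> arcs D" "lower_under_arc D k \<in> arcs D"
  using crossing_points[OF assms]
  by (auto simp: arcs_def over_arc_def upper_under_arc_def lower_under_arc_def)

lemma end_arcs: "top_arc D \<in> arcs D" "bottom_arc D \<in> arcs D"
  using end_points by (auto simp: arcs_def top_arc_def bottom_arc_def)

lemma finite_arcs: "finite (arcs D)"
  by (simp add: arcs_def finite_points)

lemma under_step: "k \<in> crossings D \<Longrightarrow> (under_top D k, under_bottom D k) \<in> under_steps D"
  by (auto simp: under_steps_def)

lemma card_under_steps: "card (under_steps D) = card (crossings D)"
  unfolding under_steps_def
  by (rule card_image) (auto simp: inj_on_def under_top_def)

text \<open>On the directed path from the top a new arc is entered only by passing under a crossing.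
  All later recursions, for partial longitudes and for colourings, are handled by this rule.\<close>

lemma arc_induct [consumes 1, case_names top under]:
  assumes "a \<in> arcs D" "P (top_arc D)"
    and step: "\<And>k. \<lbrakk>k \<in> crossings D; P (upper_under_arc D k)\<rbrakk> \<Longrightarrow> P (lower_under_arc D k)"
  shows "P a"
proof -
  obtain q where q: "q \<in> points D" "a = arc D q" using assms(1) by (auto simp: arcs_def)
  have "P (arc D q)" using reachable[OF q(1)]
  proof (induction rule: rtrancl_induct)
    case base
    then show ?case using assms(2) by (simp add: top_arc_def)
  next
    case (step p q)
    from step.hyps(2) consider "(p, q) \<in> arc_steps D"
      | k where "k \<in> crossings D" "p = under_top D k" "q = under_bottom D k"
      by (auto simp: under_steps_def)
    then show ?case
    proof cases
      case 1
      then show ?thesis using step.IH arc_step_eq by simp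
    next
      case (2 k)
      then show ?thesis
        using step.IH assms(3)[of k] by (simp add: upper_under_arc_def lower_under_arc_def)
    qed
  qed
  then show ?thesis using q by simp
qed

text \<open>Counts the under-crossings passed before the arc; by \<open>arc_eq_iff\<close> the
  chosen point does not matter.\<close>

definition arc_index :: "point set \<Rightarrow> nat" where
  "arc_index a = marks_before (SOME p. p \<in> points D \<and> arc D p = a)"

lemma arc_index_arc: "p \<in> points D \<Longrightarrow> arc_index (arc D p) = marks_before p"
  unfolding arc_index_def
  by (rule someI2[of _ p]) (auto simp flip: arc_eq_iff)

lemma arc_index_top: "arc_index (top_arc D) = 0"
  by (simp add: top_arc_def arc_index_arc end_points marks_before_start)

lemma arc_index_bottom: "arc_index (bottom_arc D) = card (crossings D)"
  by (simp add: bottom_arc_def arc_index_arc end_points marks_before_stop card_under_steps)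

lemma arc_index_under:
  "k \<in> crossings D \<Longrightarrow> arc_index (lower_under_arc D k) = Suc (arc_index (upper_under_arc D k))"
  by (simp add: lower_under_arc_def upper_under_arc_def arc_index_arc crossing_points
      marks_before_marked[OF under_step])

text \<open>Gives the definite description its meaning: two under-crossings that end the same arc
  have sources with equal counts, hence the same source, and the line of that source names the
  crossing.\<close>

lemma crossing_after_upper:
  assumes "k \<in> crossings D"
  shows "crossing_after D (upper_under_arc D k) = k"
  unfolding crossing_after_def
proof (rule the_equality)
  fix j assume j: "j \<in> crossings D \<and> upper_under_arc D j = upper_under_arc D k"
  then have "marks_before (under_top D j) = marks_before (under_top D k)"
    using assms arc_eq_iff[of "under_top D j" "under_top D k"]
    by (simp add: upper_under_arc_def crossing_points)
  then have "under_top D j = under_top D k"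
    using marked_unique[OF under_step under_step] j assms by blast
  then show "j = k" by (simp add: under_top_def)
qed (use assms in simp)

lemma travel_arc_index: "a \<in> arcs D \<Longrightarrow> travel_arc D (arc_index a) = a"
  by (induction a rule: arc_induct) (simp_all add: arc_index_top arc_index_under crossing_after_upper)

end

section \<open>Products along horizontal lines\<close>

definition list_product :: "('b, 'm) monoid_scheme \<Rightarrow> 'b list \<Rightarrow> 'b" where
  "list_product H xs = foldr (\<otimes>\<^bsub>H\<^esub>) xs \<one>\<^bsub>H\<^esub>"

lemma list_product_simps [simp]:
  "list_product H [] = \<one>\<^bsub>H\<^esub>"
  "list_product H (y # ys) = y \<otimes>\<^bsub>H\<^esub> list_product H ys"
  by (simp_all add: list_product_def)

lemma (in monoid) list_product_closed:
  "set xs \<subseteq> carrier G \<Longrightarrow> list_product G xs \<in> carrier G"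
  by (induction xs) auto

lemma (in monoid) list_product_append:
  "\<lbrakk>set xs \<subseteq> carrier G; set ys \<subseteq> carrier G\<rbrakk> \<Longrightarrow>
    list_product G (xs @ ys) = list_product G xs \<otimes> list_product G ys"
  by (induction xs) (auto simp: list_product_closed m_assoc)

lemma (in monoid) list_product_collect:
  assumes "set xs \<subseteq> carrier G" "set ys \<subseteq> carrier G" "set zs \<subseteq> carrier G"
  shows "list_product G (xs @ ys @ zs) = list_product G (xs @ [list_product G ys] @ zs)"
  using assms by (simp add: list_product_append list_product_closed)

lemma map_upt_shift: "map f [a..<a + n] = map (\<lambda>i. f (a + i)) [0..<n]"
  by (rule nth_equalityI) simp_all

lemma upt_split3: "[0..<a + b + c] = [0..<a] @ [a..<a + b] @ [a + b..<a + b + c]"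
  using upt_add_eq_append[of 0 a b] upt_add_eq_append[of 0 "a + b" c] by simp

text \<open>The counterpart of \<open>strand_object\<close> in an arbitrary group: the products
  along lines serve both for testing relations in a target group and for colours lifted to
  \<open>E\<close>.\<close>

definition strand_value ::
    "('b, 'm) monoid_scheme \<Rightarrow> strip list \<Rightarrow> (point set \<Rightarrow> 'b) \<Rightarrow> point \<Rightarrow> 'b" where
  "strand_value H D C p =
    (if level D (fst p) ! snd p = Down then C (arc D p) else inv\<^bsub>H\<^esub> C (arc D p))"

definition level_product ::
    "('b, 'm) monoid_scheme \<Rightarrow> strip list \<Rightarrow> (point set \<Rightarrow> 'b) \<Rightarrow> nat \<Rightarrow> 'b" where
  "level_product H D C k =
    list_product H (map (\<lambda>i. strand_value H D C (k, i)) [0..<length (level D k)])"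

definition top_product ::
    "('b, 'm) monoid_scheme \<Rightarrow> strip list \<Rightarrow> (point set \<Rightarrow> 'b) \<Rightarrow> nat \<Rightarrow> 'b" where
  "top_product H D C k = list_product H
    (map (\<lambda>i. strand_value H D C (k, offset D k + i)) [0..<length (piece_top (piece_at D k))])"

definition bottom_product ::
    "('b, 'm) monoid_scheme \<Rightarrow> strip list \<Rightarrow> (point set \<Rightarrow> 'b) \<Rightarrow> nat \<Rightarrow> 'b" where
  "bottom_product H D C k = list_product H
    (map (\<lambda>i. strand_value H D C (Suc k, offset D k + i)) [0..<length (piece_bottom (piece_at D k))])"

definition left_values ::
    "('b, 'm) monoid_scheme \<Rightarrow> strip list \<Rightarrow> (point set \<Rightarrow> 'b) \<Rightarrow> nat \<Rightarrow> 'b list" where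
  "left_values H D C k = map (\<lambda>i. strand_value H D C (k, i)) [0..<offset D k]"

definition right_values ::
    "('b, 'm) monoid_scheme \<Rightarrow> strip list \<Rightarrow> (point set \<Rightarrow> 'b) \<Rightarrow> nat \<Rightarrow> 'b list" where
  "right_values H D C k = map (\<lambda>i. strand_value H D C (k, i))
    [offset D k + length (piece_top (piece_at D k))..<length (level D k)]"

lemma crossing_sign_cases:
  assumes "k \<in> crossings D"
  obtains (plus) "piece_at D k = Some XPlus" "crossing_sign D k = 1"
  | (minus) "piece_at D k = Some XMinus" "crossing_sign D k = -1"
  using assms by (auto simp: crossings_def crossing_sign_def)

text \<open>Only the crossing relations are recorded; that the two ends agree will follow from the
  invariance of the product along a line.\<close>

definition wirtinger_colouring ::
    "('b, 'm) monoid_scheme \<Rightarrow> strip list \<Rightarrow> (point set \<Rightarrow> 'b) \<Rightarrow> bool" where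
  "wirtinger_colouring H D C \<longleftrightarrow> C \<in> arcs D \<rightarrow> carrier H \<and>
    (\<forall>k\<in>crossings D. C (lower_under_arc D k) =
      C (over_arc D k) [^]\<^bsub>H\<^esub> (- crossing_sign D k) \<otimes>\<^bsub>H\<^esub> C (upper_under_arc D k) \<otimes>\<^bsub>H\<^esub>
      C (over_arc D k) [^]\<^bsub>H\<^esub> crossing_sign D k)"

lemma (in group) int_pow_minus_1: "x \<in> carrier G \<Longrightarrow> x [^] (- 1 :: int) = inv x"
  by (simp add: int_pow_neg)

context string_knot
begin

lemma vertical_arcs:
  assumes "k < length D"
  shows "i < offset D k \<Longrightarrow> arc D (Suc k, i) = arc D (k, i)"
    and "i < length (right_strands (D ! k)) \<Longrightarrow>
      arc D (Suc k, offset D k + length (piece_bottom (piece_at D k)) + i) =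
      arc D (k, offset D k + length (piece_top (piece_at D k)) + i)"
proof -
  have arc: "arc D q = arc D p" if "oriented d p q \<in> vertical_steps D k" for d p q
  proof -
    have "oriented d p q \<in> arc_steps D" using that assms by (auto simp: arc_steps_def)
    then show ?thesis using arc_step_eq by (cases d) (auto simp: oriented_def)
  qed
  show "i < offset D k \<Longrightarrow> arc D (Suc k, i) = arc D (k, i)"
    by (rule arc[of "left_strands (D ! k) ! i"]) (auto simp: vertical_steps_def offset_def Let_def)
  show "i < length (right_strands (D ! k)) \<Longrightarrow>
      arc D (Suc k, offset D k + length (piece_bottom (piece_at D k)) + i) =
      arc D (k, offset D k + length (piece_top (piece_at D k)) + i)"
    by (rule arc[of "right_strands (D ! k) ! i"]) (auto simp: vertical_steps_def Let_def)
qed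

lemma length_level:
  assumes "k < length D"
  shows "length (level D k) =
      offset D k + length (piece_top (piece_at D k)) + length (right_strands (D ! k))"
    "length (level D (Suc k)) =
      offset D k + length (piece_bottom (piece_at D k)) + length (right_strands (D ! k))"
  using assms by (simp_all add: level_strip offset_def)

lemma vertical_strand_value:
  assumes "k < length D"
  shows "i < offset D k \<Longrightarrow> strand_value H D C (Suc k, i) = strand_value H D C (k, i)"
    and "i < length (right_strands (D ! k)) \<Longrightarrow>
      strand_value H D C (Suc k, offset D k + length (piece_bottom (piece_at D k)) + i) =
      strand_value H D C (k, offset D k + length (piece_top (piece_at D k)) + i)"
  using vertical_arcs[OF assms, of i]
  by (simp_all add: strand_value_def level_strip[OF assms] offset_def nth_append)

lemma strand_value_closed:
  assumes "group H" "C \<in> arcs D \<rightarrow> carrier H" "k \<le> length D" "i < length (level D k)"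
  shows "strand_value H D C (k, i) \<in> carrier H"
proof -
  interpret H: group H by fact
  have "arc D (k, i) \<in> arcs D" using assms by (auto simp: arcs_def points_def)
  then show ?thesis using assms(2) by (auto simp: strand_value_def)
qed

lemma side_values_closed:
  assumes "group H" "C \<in> arcs D \<rightarrow> carrier H" "k < length D"
  shows "set (left_values H D C k) \<subseteq> carrier H" "set (right_values H D C k) \<subseteq> carrier H"
  using assms by (auto simp: left_values_def right_values_def length_level intro!: strand_value_closed)

lemma top_product_closed:
  assumes "group H" "C \<in> arcs D \<rightarrow> carrier H" "k < length D"
  shows "top_product H D C k \<in> carrier H"
  unfolding top_product_def
  using assms by (intro monoid.list_product_closed group.is_monoid)
    (auto simp: length_level intro!: strand_value_closed)

lemma bottom_product_closed:
  assumes "group H" "C \<in> arcs D \<rightarrow> carrier H" "k < length D"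
  shows "bottom_product H D C k \<in> carrier H"
  unfolding bottom_product_def
  using assms by (intro monoid.list_product_closed group.is_monoid)
    (auto simp: length_level intro!: strand_value_closed)

lemma level_product_top:
  assumes "group H" "C \<in> arcs D \<rightarrow> carrier H" "k < length D"
  shows "level_product H D C k =
    list_product H (left_values H D C k @ [top_product H D C k] @ right_values H D C k)"
proof -
  interpret H: group H by fact
  let ?f = "\<lambda>i. strand_value H D C (k, i)"
  let ?o = "offset D k" and ?t = "length (piece_top (piece_at D k))"
    and ?r = "length (right_strands (D ! k))"
  have "[0..<length (level D k)] = [0..<?o] @ [?o..<?o + ?t] @ [?o + ?t..<?o + ?t + ?r]"
    unfolding length_level(1)[OF assms(3)] by (rule upt_split3)
  then have "map ?f [0..<length (level D k)] = left_values H D C k @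
      map (\<lambda>i. ?f (?o + i)) [0..<?t] @ right_values H D C k"
    using length_level(1)[OF assms(3)]
    by (simp add: left_values_def right_values_def map_upt_shift[of ?f ?o])
  moreover have "set (map (\<lambda>i. ?f (?o + i)) [0..<?t]) \<subseteq> carrier H"
    using assms by (auto simp: length_level intro!: strand_value_closed)
  ultimately show ?thesis
    unfolding level_product_def top_product_def
    using side_values_closed[OF assms] by (simp only: H.list_product_collect)
qed

text \<open>Vertical strands keep their arc and direction, so the outer factors can be read on the
  top line, as in \<open>level_product_top\<close>. Comparing two consecutive lines thus reduces to
  the piece between them.\<close>

lemma level_product_bottom:
  assumes "group H" "C \<in> arcs D \<rightarrow> carrier H" "k < length D"
  shows "level_product H D C (Suc k) =
    list_product H (left_values H D C k @ [bottom_product H D C k] @ right_values H D C k)"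
proof -
  interpret H: group H by fact
  let ?f = "\<lambda>i. strand_value H D C (Suc k, i)"
  let ?o = "offset D k" and ?t = "length (piece_top (piece_at D k))"
    and ?b = "length (piece_bottom (piece_at D k))" and ?r = "length (right_strands (D ! k))"
  have "[0..<length (level D (Suc k))] = [0..<?o] @ [?o..<?o + ?b] @ [?o + ?b..<?o + ?b + ?r]"
    unfolding length_level(2)[OF assms(3)] by (rule upt_split3)
  moreover have "map ?f [0..<?o] = left_values H D C k"
    using assms(3) by (simp add: left_values_def vertical_strand_value)
  moreover have "map ?f [?o + ?b..<?o + ?b + ?r] = right_values H D C k"
    unfolding right_values_def length_level(1)[OF assms(3)] map_upt_shift
    using assms(3) by (simp add: vertical_strand_value)
  ultimately have "map ?f [0..<length (level D (Suc k))] = left_values H D C k @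
      map (\<lambda>i. ?f (?o + i)) [0..<?b] @ right_values H D C k"
    by (simp add: map_upt_shift[of ?f ?o])
  moreover have "set (map (\<lambda>i. ?f (?o + i)) [0..<?b]) \<subseteq> carrier H"
    using assms by (auto simp: length_level intro!: strand_value_closed)
  ultimately show ?thesis
    unfolding level_product_def bottom_product_def
    using side_values_closed[OF assms] by (simp only: H.list_product_collect)
qed

lemma level_product_ends:
  assumes "group H" "C \<in> arcs D \<rightarrow> carrier H"
  shows "level_product H D C 0 = C (top_arc D)" "level_product H D C (length D) = C (bottom_arc D)"
proof -
  interpret H: group H by fact
  have "C (top_arc D) \<in> carrier H" "C (bottom_arc D) \<in> carrier H"
    using assms(2) end_arcs by auto
  then show "level_product H D C 0 = C (top_arc D)" "level_product H D C (length D) = C (bottom_arc D)"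
    by (simp_all add: level_product_def level_ends strand_value_def top_arc_def bottom_arc_def)
qed

lemma over_bottom_arc:
  assumes "k \<in> crossings D"
  shows "arc D (over_bottom D k) = over_arc D k"
proof -
  have "(over_top D k, over_bottom D k) \<in> piece_steps D k" "k < length D"
    using assms by (auto simp: piece_steps_def crossings_def)
  then have "(over_top D k, over_bottom D k) \<in> arc_steps D" by (auto simp: arc_steps_def)
  then show ?thesis using arc_step_eq by (simp add: over_arc_def)
qed

lemma piece_directions:
  assumes "k < length D"
  shows "i < length (piece_top (piece_at D k)) \<Longrightarrow>
      level D k ! (offset D k + i) = piece_top (piece_at D k) ! i"
    "i < length (piece_bottom (piece_at D k)) \<Longrightarrow>
      level D (Suc k) ! (offset D k + i) = piece_bottom (piece_at D k) ! i"
  by (simp_all add: level_strip[OF assms] offset_def nth_append)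

lemma crossing_products:
  assumes "group H" "C \<in> arcs D \<rightarrow> carrier H" "k \<in> crossings D"
  shows "top_product H D C k =
      (if piece_at D k = Some XPlus then C (upper_under_arc D k) \<otimes>\<^bsub>H\<^esub> C (over_arc D k)
       else C (over_arc D k) \<otimes>\<^bsub>H\<^esub> C (upper_under_arc D k))"
    "bottom_product H D C k =
      (if piece_at D k = Some XPlus then C (over_arc D k) \<otimes>\<^bsub>H\<^esub> C (lower_under_arc D k)
       else C (lower_under_arc D k) \<otimes>\<^bsub>H\<^esub> C (over_arc D k))"
proof -
  interpret H: group H by fact
  have k: "k < length D" using assms(3) by (simp add: crossings_def)
  have C: "C (over_arc D k) \<in> carrier H" "C (upper_under_arc D k) \<in> carrier H"
    "C (lower_under_arc D k) \<in> carrier H"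
    using assms(2) crossing_arcs[OF assms(3)] by auto
  have "top_product H D C k =
      (if piece_at D k = Some XPlus then C (upper_under_arc D k) \<otimes>\<^bsub>H\<^esub> C (over_arc D k)
       else C (over_arc D k) \<otimes>\<^bsub>H\<^esub> C (upper_under_arc D k)) \<and>
    bottom_product H D C k =
      (if piece_at D k = Some XPlus then C (over_arc D k) \<otimes>\<^bsub>H\<^esub> C (lower_under_arc D k)
       else C (lower_under_arc D k) \<otimes>\<^bsub>H\<^esub> C (over_arc D k))"
    using assms(3)
  proof (cases rule: crossing_sign_cases)
    case plus
    then show ?thesis
      using C over_bottom_arc[OF assms(3)] piece_directions[OF k, of 0] piece_directions[OF k, of 1]
      by (simp add: top_product_def bottom_product_def strand_value_def upt_rec over_arc_def
          upper_under_arc_def lower_under_arc_def over_top_def over_bottom_def under_top_def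
          under_bottom_def)
  next
    case minus
    then show ?thesis
      using C over_bottom_arc[OF assms(3)] piece_directions[OF k, of 0] piece_directions[OF k, of 1]
      by (simp add: top_product_def bottom_product_def strand_value_def upt_rec over_arc_def
          upper_under_arc_def lower_under_arc_def over_top_def over_bottom_def under_top_def
          under_bottom_def)
  qed
  then show "top_product H D C k =
      (if piece_at D k = Some XPlus then C (upper_under_arc D k) \<otimes>\<^bsub>H\<^esub> C (over_arc D k)
       else C (over_arc D k) \<otimes>\<^bsub>H\<^esub> C (upper_under_arc D k))"
    "bottom_product H D C k =
      (if piece_at D k = Some XPlus then C (over_arc D k) \<otimes>\<^bsub>H\<^esub> C (lower_under_arc D k)
       else C (lower_under_arc D k) \<otimes>\<^bsub>H\<^esub> C (over_arc D k))"
    by blast+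
qed

text \<open>Both legs of a turn lie on one arc with opposite directions, so one value is the inverse
  of the other. This applies to cups and caps of either orientation.\<close>

lemma turn_product:
  assumes "group H" "C \<in> arcs D \<rightarrow> carrier H" "l \<le> length D" "Suc i < length (level D l)"
    and "arc D (l, i) = arc D (l, Suc i)" "level D l ! Suc i = opposite (level D l ! i)"
  shows "strand_value H D C (l, i) \<otimes>\<^bsub>H\<^esub> strand_value H D C (l, Suc i) = \<one>\<^bsub>H\<^esub>"
proof -
  interpret H: group H by fact
  have "arc D (l, Suc i) \<in> arcs D" using assms(3,4) by (auto simp: arcs_def points_def)
  then have "C (arc D (l, Suc i)) \<in> carrier H" using assms(2) by auto
  then show ?thesis using assms(5,6) by (cases "level D l ! i") (simp_all add: strand_value_def)
qed

lemma non_crossing_products: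
  assumes "group H" "C \<in> arcs D \<rightarrow> carrier H" "k < length D" "k \<notin> crossings D"
  shows "top_product H D C k = \<one>\<^bsub>H\<^esub>" "bottom_product H D C k = \<one>\<^bsub>H\<^esub>"
proof -
  interpret H: group H by fact
  consider (none) "piece_at D k = None" | (cup) o1 where "piece_at D k = Some (Cup o1)"
    | (cap) o1 where "piece_at D k = Some (Cap o1)"
    using assms(3,4) by (cases "piece_at D k" rule: piece_top.cases) (auto simp: crossings_def)
  then have "top_product H D C k = \<one>\<^bsub>H\<^esub> \<and> bottom_product H D C k = \<one>\<^bsub>H\<^esub>"
  proof cases
    case none
    then show ?thesis by (simp add: top_product_def bottom_product_def)
  next
    case (cup o1)
    have "oriented o1 (k, offset D k) (k, Suc (offset D k)) \<in> piece_steps D k"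
      using cup by (simp add: piece_steps_def)
    then have "oriented o1 (k, offset D k) (k, Suc (offset D k)) \<in> arc_steps D"
      using assms(3) by (auto simp: arc_steps_def)
    then have arc: "arc D (k, offset D k) = arc D (k, Suc (offset D k))"
      using arc_step_eq by (cases o1) (auto simp: oriented_def)
    have "strand_value H D C (k, offset D k) \<otimes>\<^bsub>H\<^esub> strand_value H D C (k, Suc (offset D k)) = \<one>\<^bsub>H\<^esub>"
      using assms(3) length_level[OF assms(3)] cup piece_directions[OF assms(3), of 0]
        piece_directions[OF assms(3), of 1]
      by (intro turn_product[OF assms(1,2)] arc) simp_all
    moreover have "strand_value H D C (k, Suc (offset D k)) \<in> carrier H"
      using assms length_level[OF assms(3)] cup by (intro strand_value_closed) simp_all
    ultimately show ?thesis
      using cup by (simp add: top_product_def bottom_product_def upt_rec)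
  next
    case (cap o1)
    have "oriented o1 (Suc k, Suc (offset D k)) (Suc k, offset D k) \<in> piece_steps D k"
      using cap by (simp add: piece_steps_def)
    then have "oriented o1 (Suc k, Suc (offset D k)) (Suc k, offset D k) \<in> arc_steps D"
      using assms(3) by (auto simp: arc_steps_def)
    then have arc: "arc D (Suc k, offset D k) = arc D (Suc k, Suc (offset D k))"
      using arc_step_eq by (cases o1) (auto simp: oriented_def)
    have "strand_value H D C (Suc k, offset D k) \<otimes>\<^bsub>H\<^esub> strand_value H D C (Suc k, Suc (offset D k)) = \<one>\<^bsub>H\<^esub>"
      using assms(3) length_level[OF assms(3)] cap piece_directions[OF assms(3), of 0]
        piece_directions[OF assms(3), of 1]
      by (intro turn_product[OF assms(1,2)] arc) simp_all
    moreover have "strand_value H D C (Suc k, Suc (offset D k)) \<in> carrier H"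
      using assms length_level[OF assms(3)] cap by (intro strand_value_closed) simp_all
    ultimately show ?thesis
      using cap by (simp add: top_product_def bottom_product_def upt_rec)
  qed
  then show "top_product H D C k = \<one>\<^bsub>H\<^esub>" "bottom_product H D C k = \<one>\<^bsub>H\<^esub>" by simp_all
qed

text \<open>The crossing relations leave the product of the strands on a horizontal line unchanged, so in
  any group they already force the two ends of the string knot to have the same colour.\<close>

lemma wirtinger_colouring_ends:
  assumes "group H" "wirtinger_colouring H D C"
  shows "C (bottom_arc D) = C (top_arc D)"
proof -
  interpret H: group H by fact
  have C: "C \<in> arcs D \<rightarrow> carrier H" using assms(2) by (simp add: wirtinger_colouring_def)
  have "level_product H D C (Suc k) = level_product H D C k" if k: "k < length D" for k
  proof (cases "k \<in> crossings D")
    case True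
    have c: "C (over_arc D k) \<in> carrier H" "C (upper_under_arc D k) \<in> carrier H"
      using C crossing_arcs[OF True] by auto
    have low: "C (lower_under_arc D k) =
        C (over_arc D k) [^]\<^bsub>H\<^esub> (- crossing_sign D k) \<otimes>\<^bsub>H\<^esub> C (upper_under_arc D k) \<otimes>\<^bsub>H\<^esub>
        C (over_arc D k) [^]\<^bsub>H\<^esub> crossing_sign D k"
      using assms(2) True by (simp add: wirtinger_colouring_def)
    have "bottom_product H D C k = top_product H D C k"
      using True
    proof (cases rule: crossing_sign_cases)
      case plus
      then show ?thesis using c low
        by (simp add: crossing_products[OF assms(1) C True] H.int_pow_minus_1 H.m_assoc H.inv_cancel)
    next
      case minus
      then show ?thesis using c low
        by (simp add: crossing_products[OF assms(1) C True] H.int_pow_minus_1 H.m_assoc H.inv_cancel)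
    qed
    then show ?thesis
      by (simp add: level_product_top[OF assms(1) C k] level_product_bottom[OF assms(1) C k])
  next
    case False
    then show ?thesis
      by (simp add: level_product_top[OF assms(1) C k] level_product_bottom[OF assms(1) C k]
          non_crossing_products[OF assms(1) C k])
  qed
  then have "level_product H D C k = level_product H D C 0" if "k \<le> length D" for k
    using that by (induction k) simp_all
  then show ?thesis using level_product_ends[OF assms(1) C] by simp
qed

section \<open>The knot group and the partial longitudes\<close>

lemma group_knot_group: "group (knot_group D)"
  unfolding knot_group_def by (rule group_presented)

lemma wirtinger_generator_closed:
  "a \<in> arcs D \<Longrightarrow> wirtinger_generator D a \<in> carrier (knot_group D)"
  by (simp add: knot_group_def wirtinger_generator_def generator_closed)

lemma wirtinger_word_value:
  assumes "group H" "C \<in> arcs D \<rightarrow> carrier H" "k \<in> crossings D"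
  shows "word_value H C [(over_arc D k, crossing_sign D k = -1), (upper_under_arc D k, True),
      (over_arc D k, crossing_sign D k = 1)] =
    C (over_arc D k) [^]\<^bsub>H\<^esub> (- crossing_sign D k) \<otimes>\<^bsub>H\<^esub> C (upper_under_arc D k) \<otimes>\<^bsub>H\<^esub>
    C (over_arc D k) [^]\<^bsub>H\<^esub> crossing_sign D k"
proof -
  interpret H: group H by fact
  have "C (over_arc D k) \<in> carrier H" "C (upper_under_arc D k) \<in> carrier H"
    using assms(2) crossing_arcs[OF assms(3)] by auto
  with assms(3) show ?thesis
    by (cases rule: crossing_sign_cases) (simp_all add: H.int_pow_minus_1 H.m_assoc)
qed

lemma wirtinger_hom_exists:
  assumes "group H" "wirtinger_colouring H D C"
  obtains F where "F \<in> hom (knot_group D) H"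
    "\<And>a. a \<in> arcs D \<Longrightarrow> F (wirtinger_generator D a) = C a"
proof -
  interpret H: group H by fact
  have C: "C \<in> arcs D \<rightarrow> carrier H" using assms(2) by (simp add: wirtinger_colouring_def)
  have "word_value H C r = word_value H C r'" if r: "(r, r') \<in> wirtinger_relations D" for r r'
  proof -
    have ends: "word_value H C [(bottom_arc D, True)] = word_value H C [(top_arc D, True)]"
      by (simp add: wirtinger_colouring_ends[OF assms])
    have "word_value H C [(lower_under_arc D k, True)] =
        word_value H C [(over_arc D k, crossing_sign D k = -1), (upper_under_arc D k, True),
          (over_arc D k, crossing_sign D k = 1)]" if k: "k \<in> crossings D" for k
    proof -
      have "C (lower_under_arc D k) \<in> carrier H" using C crossing_arcs[OF k] by auto
      then show ?thesis
        using assms(2) k unfolding wirtinger_word_value[OF assms(1) C k]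
        by (simp add: wirtinger_colouring_def)
    qed
    then show ?thesis using r ends by (auto simp only: wirtinger_relations_def)
  qed
  then show ?thesis
    using H.presented_hom_exists[OF C, of "wirtinger_relations D"] that
    unfolding knot_group_def wirtinger_generator_def by blast
qed

lemma wirtinger_colouring_generator:
  "wirtinger_colouring (knot_group D) D (wirtinger_generator D)"
proof -
  interpret P: group "knot_group D" by (rule group_knot_group)
  have C: "wirtinger_generator D \<in> arcs D \<rightarrow> carrier (knot_group D)"
    by (simp add: wirtinger_generator_closed)
  have "wirtinger_generator D (lower_under_arc D k) =
      wirtinger_generator D (over_arc D k) [^]\<^bsub>knot_group D\<^esub> (- crossing_sign D k) \<otimes>\<^bsub>knot_group D\<^esub>
      wirtinger_generator D (upper_under_arc D k) \<otimes>\<^bsub>knot_group D\<^esub>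
      wirtinger_generator D (over_arc D k) [^]\<^bsub>knot_group D\<^esub> crossing_sign D k"
    if k: "k \<in> crossings D" for k
  proof -
    have "([(lower_under_arc D k, True)], [(over_arc D k, crossing_sign D k = -1),
        (upper_under_arc D k, True), (over_arc D k, crossing_sign D k = 1)]) \<in> wirtinger_relations D"
      using k by (auto simp: wirtinger_relations_def)
    from presented_relation[OF this, of "arcs D"]
    have "word_value (knot_group D) (wirtinger_generator D) [(lower_under_arc D k, True)] =
        word_value (knot_group D) (wirtinger_generator D) [(over_arc D k, crossing_sign D k = -1),
        (upper_under_arc D k, True), (over_arc D k, crossing_sign D k = 1)]"
      using crossing_arcs[OF k] unfolding knot_group_def wirtinger_generator_def by simp
    then show ?thesis
      unfolding wirtinger_word_value[OF group_knot_group C k]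
      using wirtinger_generator_closed crossing_arcs[OF k] by simp
  qed
  then show ?thesis using C by (simp add: wirtinger_colouring_def)
qed

lemma knot_group_hom_eq:
  assumes "group H" "F \<in> hom (knot_group D) H" "F' \<in> hom (knot_group D) H"
    and "\<And>a. a \<in> arcs D \<Longrightarrow> F (wirtinger_generator D a) = F' (wirtinger_generator D a)"
    and "A \<in> carrier (knot_group D)"
  shows "F A = F' A"
  using group.presented_hom_eq[OF assms(1), of F "arcs D" "wirtinger_relations D" F' A] assms
  unfolding knot_group_def wirtinger_generator_def by blast

lemma arc_index_le: "p \<in> points D \<Longrightarrow> arc_index (arc D p) \<le> card (crossings D)"
  using marks_finite by (auto simp: arc_index_arc marks_before_def simp flip: card_under_steps
      intro!: card_mono)

text \<open>The map is injective and stays below the number of crossings, so it is onto by counting.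
  Hence each factor of the longitude belongs to an actual crossing.\<close>

lemma upper_index_image:
  "(\<lambda>k. arc_index (upper_under_arc D k)) ` crossings D = {..<card (crossings D)}"
proof (rule card_subset_eq)
  show "(\<lambda>k. arc_index (upper_under_arc D k)) ` crossings D \<subseteq> {..<card (crossings D)}"
  proof (rule image_subsetI)
    fix k assume k: "k \<in> crossings D"
    have "arc_index (lower_under_arc D k) \<le> card (crossings D)"
      unfolding lower_under_arc_def using k by (intro arc_index_le crossing_points)
    then show "arc_index (upper_under_arc D k) \<in> {..<card (crossings D)}"
      using arc_index_under[OF k] by simp
  qed
  have "inj_on (\<lambda>k. arc_index (upper_under_arc D k)) (crossings D)"
  proof (rule inj_onI)
    fix j k assume jk: "j \<in> crossings D" "k \<in> crossings D"
      "arc_index (upper_under_arc D j) = arc_index (upper_under_arc D k)"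
    then have "upper_under_arc D j = upper_under_arc D k"
      by (metis travel_arc_index crossing_arcs(2))
    then show "j = k" using jk crossing_after_upper by metis
  qed
  then show "card ((\<lambda>k. arc_index (upper_under_arc D k)) ` crossings D) = card {..<card (crossings D)}"
    by (simp add: card_image)
qed simp

lemma longitude_factor_upper:
  assumes "k \<in> crossings D"
  shows "longitude_factor D (arc_index (upper_under_arc D k)) =
    wirtinger_generator D (upper_under_arc D k) [^]\<^bsub>knot_group D\<^esub> (- crossing_sign D k)
    \<otimes>\<^bsub>knot_group D\<^esub> wirtinger_generator D (over_arc D k) [^]\<^bsub>knot_group D\<^esub> crossing_sign D k"
  using assms crossing_arcs[OF assms]
  by (simp add: longitude_factor_def travel_arc_index crossing_after_upper)

lemma longitude_factor_closed:
  assumes "i < card (crossings D)"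
  shows "longitude_factor D i \<in> carrier (knot_group D)"
proof -
  interpret P: group "knot_group D" by (rule group_knot_group)
  obtain k where "k \<in> crossings D" "i = arc_index (upper_under_arc D k)"
    using assms upper_index_image by (metis imageE lessThan_iff)
  then show ?thesis
    using crossing_arcs[of k] by (simp add: longitude_factor_upper wirtinger_generator_closed)
qed

definition partial_longitude :: "point set \<Rightarrow> point set word set" where
  "partial_longitude a = list_product (knot_group D) (map (longitude_factor D) [0..<arc_index a])"

lemma partial_longitude_closed:
  assumes "a \<in> arcs D"
  shows "partial_longitude a \<in> carrier (knot_group D)"
proof -
  interpret P: group "knot_group D" by (rule group_knot_group)
  have "arc_index a \<le> card (crossings D)" using assms arc_index_le by (auto simp: arcs_def)
  then show ?thesis
    unfolding partial_longitude_def
    by (intro P.list_product_closed) (auto intro!: longitude_factor_closed)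
qed

lemma partial_longitude_top: "partial_longitude (top_arc D) = \<one>\<^bsub>knot_group D\<^esub>"
  by (simp add: partial_longitude_def arc_index_top)

lemma partial_longitude_bottom: "partial_longitude (bottom_arc D) = longitude D"
  by (simp add: partial_longitude_def arc_index_bottom longitude_def list_product_def foldr_map comp_def)

lemma partial_longitude_under:
  assumes "k \<in> crossings D"
  shows "partial_longitude (lower_under_arc D k) =
    partial_longitude (upper_under_arc D k) \<otimes>\<^bsub>knot_group D\<^esub>
    (wirtinger_generator D (upper_under_arc D k) [^]\<^bsub>knot_group D\<^esub> (- crossing_sign D k)
    \<otimes>\<^bsub>knot_group D\<^esub> wirtinger_generator D (over_arc D k) [^]\<^bsub>knot_group D\<^esub> crossing_sign D k)"
proof -
  interpret P: group "knot_group D" by (rule group_knot_group)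
  have i: "arc_index (upper_under_arc D k) < card (crossings D)"
    using assms upper_index_image by blast
  have "set (map (longitude_factor D) [0..<arc_index (upper_under_arc D k)]) \<subseteq> carrier (knot_group D)"
    using i by (auto intro!: longitude_factor_closed)
  then show ?thesis
    using longitude_factor_closed[OF i]
    by (simp add: partial_longitude_def arc_index_under[OF assms] P.list_product_append
        longitude_factor_upper[OF assms])
qed

text \<open>A generator commutes with its own powers, so conjugating the upper under-generator by
  the whole longitude factor is the same as conjugating it by the power of the over-generator alone,
  and that is the Wirtinger relation. The power of the under-generator makes each factor have total
  exponent zero.\<close>

lemma generator_conjugate_meridian:
  assumes "a \<in> arcs D"
  shows "wirtinger_generator D a = inv\<^bsub>knot_group D\<^esub> (partial_longitude a) \<otimes>\<^bsub>knot_group D\<^esub>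
    meridian D \<otimes>\<^bsub>knot_group D\<^esub> partial_longitude a"
  using assms
proof (induction a rule: arc_induct)
  case top
  interpret P: group "knot_group D" by (rule group_knot_group)
  show ?case
    using wirtinger_generator_closed[OF end_arcs(1)] by (simp add: partial_longitude_top meridian_def)
next
  case (under k)
  interpret P: group "knot_group D" by (rule group_knot_group)
  define u where "u = partial_longitude (upper_under_arc D k)"
  define m where "m = meridian D"
  define g where "g = wirtinger_generator D (over_arc D k)"
  have c: "u \<in> carrier (knot_group D)" "m \<in> carrier (knot_group D)" "g \<in> carrier (knot_group D)"
    using crossing_arcs[OF under(1)] end_arcs(1)
    by (simp_all add: u_def m_def g_def partial_longitude_closed wirtinger_generator_closed meridian_def)
  have low: "wirtinger_generator D (lower_under_arc D k) =
      g [^]\<^bsub>knot_group D\<^esub> (- crossing_sign D k) \<otimes>\<^bsub>knot_group D\<^esub>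
      wirtinger_generator D (upper_under_arc D k) \<otimes>\<^bsub>knot_group D\<^esub>
      g [^]\<^bsub>knot_group D\<^esub> crossing_sign D k"
    using wirtinger_colouring_generator under(1) by (simp add: wirtinger_colouring_def g_def)
  from under(1) show ?case
    unfolding partial_longitude_under[OF under(1)] low under(2)
      u_def[symmetric] m_def[symmetric] g_def[symmetric]
    using c by (cases rule: crossing_sign_cases)
      (simp_all add: P.int_pow_minus_1 P.m_assoc P.inv_mult_group P.inv_cancel)
qed

text \<open>Both generators at a crossing are conjugates of the meridian, hence \<open>h\<close> is
  the conjugate of \<open>g\<close> by \<open>t\<close>; so \<open>g^-1 h\<close> and
  \<open>g h^-1\<close> are commutators with \<open>t\<close>.\<close>

lemma longitude_in_derived:
  "longitude D \<in> derived (knot_group D) (carrier (knot_group D))"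
proof -
  interpret P: group "knot_group D" by (rule group_knot_group)
  interpret P': subgroup "derived (knot_group D) (carrier (knot_group D))" "knot_group D"
    by (rule P.derived_is_subgroup) simp
  have "partial_longitude a \<in> derived (knot_group D) (carrier (knot_group D))" if "a \<in> arcs D" for a
    using that
  proof (induction a rule: arc_induct)
    case top
    then show ?case by (simp add: partial_longitude_top P'.one_closed)
  next
    case (under k)
    define m where "m = meridian D"
    define u where "u = partial_longitude (upper_under_arc D k)"
    define v where "v = partial_longitude (over_arc D k)"
    define g where "g = wirtinger_generator D (upper_under_arc D k)"
    define h where "h = wirtinger_generator D (over_arc D k)"
    have c: "u \<in> carrier (knot_group D)" "v \<in> carrier (knot_group D)" "m \<in> carrier (knot_group D)"
        "g \<in> carrier (knot_group D)" "h \<in> carrier (knot_group D)"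
      using crossing_arcs[OF under(1)] end_arcs(1)
      by (simp_all add: u_def v_def m_def g_def h_def partial_longitude_closed
          wirtinger_generator_closed meridian_def)
    define t where "t = inv\<^bsub>knot_group D\<^esub> v \<otimes>\<^bsub>knot_group D\<^esub> u"
    have t: "t \<in> carrier (knot_group D)" using c by (simp add: t_def)
    have gh: "g = inv\<^bsub>knot_group D\<^esub> u \<otimes>\<^bsub>knot_group D\<^esub> m \<otimes>\<^bsub>knot_group D\<^esub> u"
        "h = inv\<^bsub>knot_group D\<^esub> v \<otimes>\<^bsub>knot_group D\<^esub> m \<otimes>\<^bsub>knot_group D\<^esub> v"
      using generator_conjugate_meridian crossing_arcs[OF under(1)]
      by (simp_all add: g_def h_def u_def v_def m_def)
    have h: "h = t \<otimes>\<^bsub>knot_group D\<^esub> g \<otimes>\<^bsub>knot_group D\<^esub> inv\<^bsub>knot_group D\<^esub> t"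
      using c by (simp add: gh t_def P.m_assoc P.inv_mult_group P.inv_cancel)
    have "g [^]\<^bsub>knot_group D\<^esub> (- crossing_sign D k) \<otimes>\<^bsub>knot_group D\<^esub>
        h [^]\<^bsub>knot_group D\<^esub> crossing_sign D k \<in> derived (knot_group D) (carrier (knot_group D))"
      using under(1)
    proof (cases rule: crossing_sign_cases)
      case plus
      have "inv\<^bsub>knot_group D\<^esub> g \<otimes>\<^bsub>knot_group D\<^esub> h = commutator (knot_group D) (inv\<^bsub>knot_group D\<^esub> g) t"
        using c t by (simp add: h commutator_def P.m_assoc)
      then show ?thesis
        using plus c t by (simp add: P.int_pow_minus_1 P.commutator_in_derived)
    next
      case minus
      have "g \<otimes>\<^bsub>knot_group D\<^esub> inv\<^bsub>knot_group D\<^esub> h = commutator (knot_group D) g t"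
        using c t by (simp add: h commutator_def P.m_assoc P.inv_mult_group)
      then show ?thesis
        using minus c t by (simp add: P.int_pow_minus_1 P.commutator_in_derived)
    qed
    then show ?case
      unfolding partial_longitude_under[OF under(1)] using under(2)
      by (simp add: g_def h_def P'.m_closed)
  qed
  then show ?thesis using end_arcs(2) by (simp flip: partial_longitude_bottom)
qed

end

section \<open>Evaluation of colourings that lift\<close>

context crossed_module
begin

text \<open>Consider the category with objects the elements of \<open>E\<close> and exactly one
  arrow between any two of them. The arrow from \<open>U\<close> to \<open>V\<close> is sent to the
  morphism labelled \<open>V U^-1\<close>; the next lemmas say that this assignment respects
  identities, composition and tensor product.\<close>

definition lifts :: "'e \<Rightarrow> 'e \<Rightarrow> 'g \<times> 'e \<Rightarrow> bool" where
  "lifts U V m \<longleftrightarrow> U \<in> carrier E \<and> V \<in> carrier E \<and> m = (bd U, V \<otimes>\<^bsub>E\<^esub> inv\<^bsub>E\<^esub> U)"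

lemma lifts_id: "U \<in> carrier E \<Longrightarrow> lifts U U (cat_id (bd U))"
  by (simp add: lifts_def cat_id_def)

lemma lifts_comp: "lifts U V m \<Longrightarrow> lifts V W m' \<Longrightarrow> lifts U W (cat_comp m m')"
  by (auto simp: lifts_def cat_comp_def G.m_assoc G.inv_cancel)

text \<open>The target of \<open>m\<close> is \<open>bd V\<close>, so by the Peiffer identity its
  action is conjugation by \<open>V\<close>, and \<open>(V V' U'^-1 V^-1) (V U^-1)\<close> equals
  \<open>(V V') (U U')^-1\<close>.\<close>

lemma lifts_tensor:
  assumes "lifts U V m" "lifts U' V' m'"
  shows "lifts (U \<otimes>\<^bsub>E\<^esub> U') (V \<otimes>\<^bsub>E\<^esub> V') (cat_tensor m m')"
proof -
  have c: "U \<in> carrier E" "V \<in> carrier E" "U' \<in> carrier E" "V' \<in> carrier E"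
    and m: "m = (bd U, V \<otimes>\<^bsub>E\<^esub> inv\<^bsub>E\<^esub> U)" "m' = (bd U', V' \<otimes>\<^bsub>E\<^esub> inv\<^bsub>E\<^esub> U')"
    using assms by (auto simp: lifts_def)
  have "cat_target m = bd (V \<otimes>\<^bsub>E\<^esub> inv\<^bsub>E\<^esub> U \<otimes>\<^bsub>E\<^esub> U)"
    using c by (simp add: cat_target_def m del: hom_mult hom_inv flip: hom_mult)
  also have "V \<otimes>\<^bsub>E\<^esub> inv\<^bsub>E\<^esub> U \<otimes>\<^bsub>E\<^esub> U = V"
    using c by (simp add: G.m_assoc)
  finally show ?thesis
    using c peiffer[of V "V' \<otimes>\<^bsub>E\<^esub> inv\<^bsub>E\<^esub> U'"]
    by (simp add: lifts_def cat_tensor_def m G.m_assoc G.inv_mult_group G.inv_cancel)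
qed

lemma lifts_foldr_tensor:
  assumes "list_all2 (\<lambda>p m. lifts (fst p) (snd p) m) ps ms"
  shows "lifts (list_product E (map fst ps)) (list_product E (map snd ps))
    (foldr cat_tensor ms (cat_id \<one>\<^bsub>G\<^esub>))"
  using assms
proof (induction rule: list_all2_induct)
  case Nil
  then show ?case using lifts_id[of "\<one>\<^bsub>E\<^esub>"] by simp
next
  case (Cons p ps m ms)
  then show ?case by (simp add: lifts_tensor)
qed

end

context unframed_reidemeister_pair
begin

lemma strand_object_lift:
  assumes "string_knot D" "C \<in> arcs D \<rightarrow> carrier E" "\<And>a. a \<in> arcs D \<Longrightarrow> bd (C a) = c a"
    and "k \<le> length D" "i < length (level D k)"
  shows "strand_object D c (k, i) = bd (strand_value E D C (k, i))"
proof -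
  have "arc D (k, i) \<in> arcs D" using assms(4,5) by (auto simp: arcs_def points_def)
  then have "C (arc D (k, i)) \<in> carrier E" "bd (C (arc D (k, i))) = c (arc D (k, i))"
    using assms(2,3) by auto
  then show ?thesis by (simp add: strand_object_def strand_value_def)
qed

text \<open>Cups, caps and empty pieces have trivial products at top and bottom, in accordance with
  their trivial label; the assumption on \<open>w\<close> is therefore a condition at crossings
  only.\<close>

lemma piece_morphism_lift:
  assumes D: "string_knot D" and C: "C \<in> arcs D \<rightarrow> carrier E"
    and bd: "\<And>a. a \<in> arcs D \<Longrightarrow> bd (C a) = c a"
    and w: "k \<in> crossings D \<Longrightarrow> w k \<in> carrier E \<and>
      w k \<otimes>\<^bsub>E\<^esub> top_product E D C k = bottom_product E D C k"
    and k: "k < length D"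
  shows "lifts (top_product E D C k) (bottom_product E D C k) (piece_morphism D c w k)"
proof -
  interpret string_knot D by fact
  note T = top_product_closed[OF G.is_group C k] and B = bottom_product_closed[OF G.is_group C k]
  have "piece_morphism D c w k =
    (bd (top_product E D C k), bottom_product E D C k \<otimes>\<^bsub>E\<^esub> inv\<^bsub>E\<^esub> top_product E D C k)"
  proof (cases "k \<in> crossings D")
    case True
    have "bottom_product E D C k \<otimes>\<^bsub>E\<^esub> inv\<^bsub>E\<^esub> top_product E D C k = w k"
      using w[OF True] T by (metis G.inv_solve_right' B)
    moreover have "C (over_arc D k) \<in> carrier E" "C (upper_under_arc D k) \<in> carrier E"
      using C crossing_arcs[OF True] by auto
    then have "piece_morphism D c w k = (bd (top_product E D C k), w k)"
      using crossing_arcs[OF True] crossing_products(1)[OF G.is_group C True]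
      by (cases rule: crossing_sign_cases[OF True]) (simp_all add: piece_morphism_def bd)
    ultimately show ?thesis by simp
  next
    case False
    note one = non_crossing_products[OF G.is_group C k False]
    consider (none) "piece_at D k = None" | (cup) o1 where "piece_at D k = Some (Cup o1)"
      | (cap) o1 where "piece_at D k = Some (Cap o1)"
      using k False by (cases "piece_at D k" rule: piece_top.cases) (auto simp: crossings_def)
    then show ?thesis
    proof cases
      case (cup o1)
      let ?p = "strand_value E D C (k, offset D k)" and ?q = "strand_value E D C (k, Suc (offset D k))"
      have pq: "offset D k < length (level D k)" "Suc (offset D k) < length (level D k)"
        using length_level(1)[OF k] cup by simp_all
      then have c: "?p \<in> carrier E" "?q \<in> carrier E"
        using k by (auto intro!: strand_value_closed[OF G.is_group C])
      then have "?p \<otimes>\<^bsub>E\<^esub> ?q = \<one>\<^bsub>E\<^esub>"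
        using one(1) cup by (simp add: top_product_def upt_rec)
      then have "bd ?p \<otimes>\<^bsub>G\<^esub> bd ?q = \<one>\<^bsub>G\<^esub>"
        using c by (simp flip: hom_mult)
      then show ?thesis
        using cup one k pq by (simp add: piece_morphism_def strand_object_lift[OF D C bd])
    qed (use one in \<open>simp_all add: piece_morphism_def cat_id_def\<close>)
  qed
  then show ?thesis using T B by (simp add: lifts_def)
qed

lemma strip_morphism_lift:
  assumes D: "string_knot D" and C: "C \<in> arcs D \<rightarrow> carrier E"
    and bd: "\<And>a. a \<in> arcs D \<Longrightarrow> bd (C a) = c a"
    and w: "k \<in> crossings D \<Longrightarrow> w k \<in> carrier E \<and>
      w k \<otimes>\<^bsub>E\<^esub> top_product E D C k = bottom_product E D C k"
    and k: "k < length D"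
  shows "lifts (level_product E D C k) (level_product E D C (Suc k)) (strip_morphism D c w k)"
proof -
  interpret string_knot D by fact
  let ?f = "\<lambda>i. strand_value E D C (k, i)"
  let ?n = "length (level D k)" and ?m = "offset D k + length (piece_top (piece_at D k))"
  let ?ps = "map (\<lambda>i. (?f i, ?f i)) [0..<offset D k] @ [(top_product E D C k, bottom_product E D C k)] @
    map (\<lambda>i. (?f i, ?f i)) [?m..<?n]"
  have top: "strip_top (D ! k) = level D k"
    by (simp add: strip_top_def level_strip[OF k])
  have id: "lifts (?f i) (?f i) (cat_id (strand_object D c (k, i)))" if "i < ?n" for i
    using that k strand_value_closed[OF G.is_group C, of k i]
    by (simp add: strand_object_lift[OF D C bd] lifts_id)
  have "list_all2 (\<lambda>p m. lifts (fst p) (snd p) m) ?ps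
    (map (\<lambda>i. cat_id (strand_object D c (k, i))) [0..<offset D k] @ [piece_morphism D c w k] @
     map (\<lambda>i. cat_id (strand_object D c (k, i))) [?m..<?n])"
    using piece_morphism_lift[where w = w and k = k, OF D C bd w k] id length_level(1)[OF k]
    by (intro list_all2_appendI) (auto simp: list_all2_map1 list_all2_map2 list_all2_same)
  from lifts_foldr_tensor[OF this] show ?thesis
    unfolding strip_morphism_def top level_product_top[OF G.is_group C k]
      level_product_bottom[OF G.is_group C k]
    by (simp add: left_values_def right_values_def comp_def)
qed

text \<open>The quotients of consecutive line products telescope, and the first and the last line
  carry a single downward strand each.\<close>

lemma evaluation_lift:
  assumes D: "string_knot D" and C: "C \<in> arcs D \<rightarrow> carrier E"
    and bd: "\<And>a. a \<in> arcs D \<Longrightarrow> bd (C a) = c a"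
    and w: "\<And>k. k \<in> crossings D \<Longrightarrow> w k \<in> carrier E \<and>
      w k \<otimes>\<^bsub>E\<^esub> top_product E D C k = bottom_product E D C k"
  shows "lifts (C (top_arc D)) (C (bottom_arc D)) (evaluation D c w)"
proof -
  interpret string_knot D by fact
  note ends = level_product_ends[OF G.is_group C]
  have top: "C (top_arc D) \<in> carrier E" "bd (C (top_arc D)) = c (top_arc D)"
    using C bd end_arcs(1) by auto
  have "lifts (C (top_arc D)) (level_product E D C n)
      (foldl cat_comp (cat_id (c (top_arc D))) (map (strip_morphism D c w) [0..<n]))"
    if "n \<le> length D" for n
    using that
  proof (induction n)
    case 0
    show ?case using lifts_id[OF top(1)] by (simp add: ends top(2))
  next
    case (Suc n)
    then show ?case
      using strip_morphism_lift[where w = w and k = n, OF D C bd w] by (auto intro: lifts_comp)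
  qed
  from this[of "length D"] show ?thesis by (simp add: evaluation_def ends)
qed

end

section \<open>Colourings and homomorphisms\<close>

context group
begin

text \<open>Both sides are rearrangements of \<open>x Y = Z (X^-1 x X)\<close>. Substituting either
  one into the other leaves a free group identity; \<open>minus_rule\<close> is the same with
  \<open>Y\<close> and \<open>Z\<close> exchanged in this equation.\<close>

lemma plus_rule:
  assumes "X \<in> carrier G" "Y \<in> carrier G" "Z \<in> carrier G" "x \<in> carrier G"
  shows "Z = inv (commutator G X Y \<otimes> commutator G (Y \<otimes> inv X) x) \<otimes> X \<otimes> Y \<otimes> inv X \<longleftrightarrow>
    Y = Z \<otimes> (inv (inv Z \<otimes> x \<otimes> Z) \<otimes> (inv X \<otimes> x \<otimes> X))"
proof
  assume Z: "Z = inv (commutator G X Y \<otimes> commutator G (Y \<otimes> inv X) x) \<otimes> X \<otimes> Y \<otimes> inv X"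
  show "Y = Z \<otimes> (inv (inv Z \<otimes> x \<otimes> Z) \<otimes> (inv X \<otimes> x \<otimes> X))"
    unfolding Z commutator_def using assms(1,2,4) by (simp only: word_simps)
next
  assume Y: "Y = Z \<otimes> (inv (inv Z \<otimes> x \<otimes> Z) \<otimes> (inv X \<otimes> x \<otimes> X))"
  show "Z = inv (commutator G X Y \<otimes> commutator G (Y \<otimes> inv X) x) \<otimes> X \<otimes> Y \<otimes> inv X"
    unfolding Y commutator_def using assms(1,3,4) by (simp only: word_simps)
qed

lemma minus_rule:
  assumes "X \<in> carrier G" "Y \<in> carrier G" "Z \<in> carrier G" "x \<in> carrier G"
  shows "Z = inv X \<otimes> inv (commutator G (Y \<otimes> inv x) (X \<otimes> inv x)) \<otimes> Y \<otimes> X \<longleftrightarrow>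
    Y = Z \<otimes> ((inv Z \<otimes> x \<otimes> Z) \<otimes> inv (inv X \<otimes> x \<otimes> X))"
proof
  assume Z: "Z = inv X \<otimes> inv (commutator G (Y \<otimes> inv x) (X \<otimes> inv x)) \<otimes> Y \<otimes> X"
  show "Y = Z \<otimes> ((inv Z \<otimes> x \<otimes> Z) \<otimes> inv (inv X \<otimes> x \<otimes> X))"
    unfolding Z commutator_def using assms(1,2,4) by (simp only: word_simps)
next
  assume Y: "Y = Z \<otimes> ((inv Z \<otimes> x \<otimes> Z) \<otimes> inv (inv X \<otimes> x \<otimes> X))"
  show "Z = inv X \<otimes> inv (commutator G (Y \<otimes> inv x) (X \<otimes> inv x)) \<otimes> Y \<otimes> X"
    unfolding Y commutator_def using assms(1,3,4) by (simp only: word_simps)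
qed

text \<open>Meant for \<open>E\<close>: if the lifted colours satisfy the recursion exactly, then
  the crossing weight is exactly bottom times inverse of top, and not merely up to the kernel of
  \<open>bd\<close>.\<close>

lemma plus_value:
  assumes "X \<in> carrier G" "Z \<in> carrier G" "x \<in> carrier G"
    and "Y = Z \<otimes> (inv (inv Z \<otimes> x \<otimes> Z) \<otimes> (inv X \<otimes> x \<otimes> X))"
  shows "commutator G X Y \<otimes> commutator G (Y \<otimes> inv X) x \<otimes> (Z \<otimes> X) = X \<otimes> Y"
  unfolding assms(4) commutator_def using assms(1-3) by (simp only: word_simps)

lemma minus_value:
  assumes "X \<in> carrier G" "Z \<in> carrier G" "x \<in> carrier G"
    and "Y = Z \<otimes> ((inv Z \<otimes> x \<otimes> Z) \<otimes> inv (inv X \<otimes> x \<otimes> X))"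
  shows "commutator G (Y \<otimes> inv x) (X \<otimes> inv x) \<otimes> (X \<otimes> Z) = Y \<otimes> X"
  unfolding assms(4) commutator_def using assms(1-3) by (simp only: word_simps)

end

definition conjugate_to ::
    "('b, 'm) monoid_scheme \<Rightarrow> 'b \<Rightarrow> 'b \<Rightarrow> 'b" where
  "conjugate_to H x c = inv\<^bsub>H\<^esub> c \<otimes>\<^bsub>H\<^esub> x \<otimes>\<^bsub>H\<^esub> c"

text \<open>The recursion \<open>partial_longitude_under\<close> with each generator replaced by the
  conjugate of \<open>x\<close> by the colour of its arc, so that only colours occur. The colour of
  the top arc is left free.\<close>

definition longitude_colouring ::
    "('b, 'm) monoid_scheme \<Rightarrow> strip list \<Rightarrow> 'b \<Rightarrow> (point set \<Rightarrow> 'b) \<Rightarrow> bool" where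
  "longitude_colouring H D x c \<longleftrightarrow> c \<in> arcs D \<rightarrow> carrier H \<and>
    (\<forall>k\<in>crossings D. c (lower_under_arc D k) = c (upper_under_arc D k) \<otimes>\<^bsub>H\<^esub>
      (conjugate_to H x (c (upper_under_arc D k)) [^]\<^bsub>H\<^esub> (- crossing_sign D k) \<otimes>\<^bsub>H\<^esub>
       conjugate_to H x (c (over_arc D k)) [^]\<^bsub>H\<^esub> crossing_sign D k))"

lemma (in group) conjugate_to_closed [simp]:
  "x \<in> carrier G \<Longrightarrow> c \<in> carrier G \<Longrightarrow> conjugate_to G x c \<in> carrier G"
  by (simp add: conjugate_to_def)

text \<open>The cancellation behind \<open>generator_conjugate_meridian\<close>, in an arbitrary
  group: the conjugate of \<open>x\<close> by \<open>Z\<close> commutes with its own powers, and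
  only the powers of \<open>h\<close> remain.\<close>

lemma (in group) conjugate_to_step:
  assumes "x \<in> carrier G" "Z \<in> carrier G" "h \<in> carrier G" "k \<in> crossings D"
    and "Y = Z \<otimes> (conjugate_to G x Z [^] (- crossing_sign D k) \<otimes> h [^] crossing_sign D k)"
  shows "conjugate_to G x Y =
    h [^] (- crossing_sign D k) \<otimes> conjugate_to G x Z \<otimes> h [^] crossing_sign D k"
  using assms(4)
proof (cases rule: crossing_sign_cases)
  case plus
  then show ?thesis
    unfolding assms(5) using assms(1-3)
    by (simp add: int_pow_minus_1 conjugate_to_def m_assoc inv_mult_group inv_cancel)
next
  case minus
  then show ?thesis
    unfolding assms(5) using assms(1-3)
    by (simp add: int_pow_minus_1 conjugate_to_def m_assoc inv_mult_group inv_cancel)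
qed

context string_knot
begin

lemma conjugate_to_wirtinger:
  assumes "group H" "x \<in> carrier H" "longitude_colouring H D x c"
  shows "wirtinger_colouring H D (\<lambda>a. conjugate_to H x (c a))"
proof -
  interpret H: group H by fact
  have c: "c \<in> arcs D \<rightarrow> carrier H" using assms(3) by (simp add: longitude_colouring_def)
  show ?thesis
    unfolding wirtinger_colouring_def
  proof (intro conjI ballI)
    show "(\<lambda>a. conjugate_to H x (c a)) \<in> arcs D \<rightarrow> carrier H"
      using c assms(2) by (simp add: Pi_iff)
    fix k assume k: "k \<in> crossings D"
    have "c (upper_under_arc D k) \<in> carrier H" "c (over_arc D k) \<in> carrier H"
      using c crossing_arcs[OF k] by auto
    then show "conjugate_to H x (c (lower_under_arc D k)) =
        conjugate_to H x (c (over_arc D k)) [^]\<^bsub>H\<^esub> (- crossing_sign D k) \<otimes>\<^bsub>H\<^esub>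
        conjugate_to H x (c (upper_under_arc D k)) \<otimes>\<^bsub>H\<^esub>
        conjugate_to H x (c (over_arc D k)) [^]\<^bsub>H\<^esub> crossing_sign D k"
      using assms(2,3) k
      by (intro H.conjugate_to_step) (simp_all add: longitude_colouring_def)
  qed
qed

lemma hom_longitude_colouring:
  assumes "group H" "f \<in> hom (knot_group D) H"
  shows "longitude_colouring H D (f (meridian D)) (\<lambda>a. f (partial_longitude a))"
    and "a \<in> arcs D \<Longrightarrow>
      f (wirtinger_generator D a) = conjugate_to H (f (meridian D)) (f (partial_longitude a))"
proof -
  interpret P: group "knot_group D" by (rule group_knot_group)
  interpret H: group H by fact
  interpret f: group_hom "knot_group D" H f using assms(2) by unfold_locales
  have m: "meridian D \<in> carrier (knot_group D)"
    using end_arcs(1) by (simp add: meridian_def wirtinger_generator_closed)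
  show gen: "f (wirtinger_generator D a) = conjugate_to H (f (meridian D)) (f (partial_longitude a))"
    if "a \<in> arcs D" for a
    unfolding generator_conjugate_meridian[OF that]
    using m partial_longitude_closed[OF that] by (simp add: conjugate_to_def)
  have "f (partial_longitude (lower_under_arc D k)) = f (partial_longitude (upper_under_arc D k)) \<otimes>\<^bsub>H\<^esub>
      (conjugate_to H (f (meridian D)) (f (partial_longitude (upper_under_arc D k)))
        [^]\<^bsub>H\<^esub> (- crossing_sign D k) \<otimes>\<^bsub>H\<^esub>
      conjugate_to H (f (meridian D)) (f (partial_longitude (over_arc D k))) [^]\<^bsub>H\<^esub> crossing_sign D k)"
    if k: "k \<in> crossings D" for k
    unfolding partial_longitude_under[OF k]
    using crossing_arcs[OF k]
    by (simp add: f.hom_int_pow partial_longitude_closed wirtinger_generator_closed flip: gen)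
  then show "longitude_colouring H D (f (meridian D)) (\<lambda>a. f (partial_longitude a))"
    by (auto simp: longitude_colouring_def partial_longitude_closed)
qed

text \<open>At a crossing the induction knows the colour of the upper under-arc but perhaps not that
  of the over-arc. The latter enters only through its conjugate of \<open>x\<close>, which is why
  equality of all conjugates is assumed.\<close>

lemma longitude_colouring_unique:
  assumes "longitude_colouring H D x c" "longitude_colouring H D x c'"
    and "c (top_arc D) = c' (top_arc D)"
    and "\<And>a. a \<in> arcs D \<Longrightarrow> conjugate_to H x (c a) = conjugate_to H x (c' a)"
    and "a \<in> arcs D"
  shows "c a = c' a"
  using assms(5)
proof (induction a rule: arc_induct)
  case top
  then show ?case by (rule assms(3))
next
  case (under k)
  then show ?case
    using assms(1,2) assms(4)[of "over_arc D k"] crossing_arcs[OF under(1)]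
    by (simp add: longitude_colouring_def)
qed

lemma longitude_colouring_cong:
  assumes "longitude_colouring H D x c" "\<And>a. a \<in> arcs D \<Longrightarrow> c' a = c a"
  shows "longitude_colouring H D x c'"
  using assms crossing_arcs by (auto simp: longitude_colouring_def)

end

section \<open>Colourings by the derived Reidemeister pair\<close>

locale knot_extension = central_extension E G bd + string_knot D
  for E :: "('e, 'm) monoid_scheme" and G :: "('g, 'n) monoid_scheme"
    and bd :: "'e \<Rightarrow> 'g" and D :: "strip list" +
  fixes s :: "'g \<Rightarrow> 'e" and x :: 'g
  assumes splitting: "is_section E G bd s" and x: "x \<in> carrier G"

sublocale knot_extension \<subseteq> R: unframed_reidemeister_pair E G bd "section_action E s"
  "psi_at E G s x" "phi_at E G s x"
  by (rule derived_reidemeister_pair[OF splitting x])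

context knot_extension
begin

lemma bd_bracket: "\<lbrakk>g \<in> carrier G; h \<in> carrier G\<rbrakk> \<Longrightarrow> bd (bracket E s g h) = commutator G g h"
  by (simp add: bracket_def bd_commutator s_closed[OF splitting] bd_s[OF splitting])

lemma bracket_closed: "\<lbrakk>g \<in> carrier G; h \<in> carrier G\<rbrakk> \<Longrightarrow> bracket E s g h \<in> carrier E"
  by (simp add: bracket_def s_closed[OF splitting])

definition weight :: "(point set \<Rightarrow> 'g) \<Rightarrow> nat \<Rightarrow> 'e" where
  "weight c k =
    (if piece_at D k = Some XPlus then psi_at E G s x (c (over_arc D k)) (c (lower_under_arc D k))
     else phi_at E G s x (c (over_arc D k)) (c (lower_under_arc D k)))"

lemma weight_closed:
  assumes "c \<in> arcs D \<rightarrow> carrier G" "k \<in> crossings D"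
  shows "weight c k \<in> carrier E"
proof -
  have "c (over_arc D k) \<in> carrier G" "c (lower_under_arc D k) \<in> carrier G"
    using assms crossing_arcs[OF assms(2)] by auto
  then show ?thesis by (simp add: weight_def R.psi_closed R.phi_closed)
qed

lemma coloured_at_iff:
  assumes "c \<in> arcs D \<rightarrow> carrier G" "k \<in> crossings D"
  shows "R.coloured_at D c w k \<longleftrightarrow> w k = weight c k \<and>
    c (lower_under_arc D k) = c (upper_under_arc D k) \<otimes>\<^bsub>G\<^esub>
      (conjugate_to G x (c (upper_under_arc D k)) [^]\<^bsub>G\<^esub> (- crossing_sign D k) \<otimes>\<^bsub>G\<^esub>
       conjugate_to G x (c (over_arc D k)) [^]\<^bsub>G\<^esub> crossing_sign D k)"
proof -
  have c: "c (over_arc D k) \<in> carrier G" "c (lower_under_arc D k) \<in> carrier G"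
    "c (upper_under_arc D k) \<in> carrier G"
    using assms crossing_arcs[OF assms(2)] by auto
  show ?thesis
    using assms(2)
  proof (cases rule: crossing_sign_cases)
    case plus
    then show ?thesis
      using H.plus_rule[OF c x] c x
      by (simp add: R.coloured_at_def Let_def weight_def psi_at_def bd_bracket bracket_closed
          conjugate_to_def H.int_pow_minus_1)
  next
    case minus
    then show ?thesis
      using H.minus_rule[OF c x] c x
      by (simp add: R.coloured_at_def Let_def weight_def phi_at_def bd_bracket bracket_closed
          conjugate_to_def H.int_pow_minus_1)
  qed
qed

lemma colourings_iff:
  "(c, w) \<in> R.colourings D \<one>\<^bsub>G\<^esub> b \<longleftrightarrow>
    c \<in> extensional (arcs D) \<and> longitude_colouring G D x c \<and> c (top_arc D) = \<one>\<^bsub>G\<^esub> \<and>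
    c (bottom_arc D) = b \<and> w = restrict (weight c) (crossings D)"
proof (cases "c \<in> arcs D \<rightarrow> carrier G")
  case True
  have "w \<in> crossings D \<rightarrow>\<^sub>E carrier E \<and> (\<forall>k\<in>crossings D. w k = weight c k) \<longleftrightarrow>
      w = restrict (weight c) (crossings D)"
    using weight_closed[OF True] by (auto simp: PiE_iff extensional_def)
  then show ?thesis
    using True coloured_at_iff[OF True]
    by (auto simp: R.colourings_def longitude_colouring_def PiE_def)
qed (auto simp: R.colourings_def longitude_colouring_def PiE_def)

definition hom_colouring :: "(point set word set \<Rightarrow> 'g) \<Rightarrow> (point set \<Rightarrow> 'g) \<times> (nat \<Rightarrow> 'e)" where
  "hom_colouring f = (let c = (\<lambda>a\<in>arcs D. f (partial_longitude a)) in
    (c, restrict (weight c) (crossings D)))"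

definition knot_homs :: "(point set word set \<Rightarrow> 'g) set" where
  "knot_homs = {f \<in> hom (knot_group D) G. f \<in> extensional (carrier (knot_group D)) \<and>
    f (meridian D) = x}"

lemma hom_colouring_bij:
  "bij_betw hom_colouring knot_homs (\<Union>b\<in>carrier G. R.colourings D \<one>\<^bsub>G\<^esub> b)"
proof (rule bij_betw_imageI)
  interpret P: group "knot_group D" by (rule group_knot_group)
  show "inj_on hom_colouring knot_homs"
  proof (rule inj_onI)
    fix f f' assume ff: "f \<in> knot_homs" "f' \<in> knot_homs" "hom_colouring f = hom_colouring f'"
    have eq: "f (partial_longitude a) = f' (partial_longitude a)" if "a \<in> arcs D" for a
      using ff(3) that by (simp add: hom_colouring_def Let_def restrict_def fun_eq_iff) metis
    have conj: "g (wirtinger_generator D a) = conjugate_to G x (g (partial_longitude a))"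
      if "a \<in> arcs D" "g \<in> knot_homs" for a g
      using hom_longitude_colouring(2)[OF H.is_group _ that(1), of g] that(2)
      by (simp add: knot_homs_def)
    have gen: "f (wirtinger_generator D a) = f' (wirtinger_generator D a)"
      if "a \<in> arcs D" for a
      by (simp only: conj[OF that ff(1)] conj[OF that ff(2)] eq[OF that])
    show "f = f'"
    proof (rule extensionalityI)
      show "f \<in> extensional (carrier (knot_group D))" "f' \<in> extensional (carrier (knot_group D))"
        using ff(1,2) by (simp_all add: knot_homs_def)
      show "f A = f' A" if "A \<in> carrier (knot_group D)" for A
      proof (rule knot_group_hom_eq[OF H.is_group])
        show "f \<in> hom (knot_group D) G" "f' \<in> hom (knot_group D) G"
          using ff(1,2) by (simp_all add: knot_homs_def)
      qed (fact gen that)+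
    qed
  qed
  show "hom_colouring ` knot_homs = (\<Union>b\<in>carrier G. R.colourings D \<one>\<^bsub>G\<^esub> b)"
  proof (intro equalityI subsetI)
    fix cw assume "cw \<in> hom_colouring ` knot_homs"
    then obtain f where f: "f \<in> knot_homs" "cw = hom_colouring f" by blast
    let ?c = "\<lambda>a\<in>arcs D. f (partial_longitude a)"
    have hom: "f \<in> hom (knot_group D) G" "f (meridian D) = x" using f by (simp_all add: knot_homs_def)
    interpret f: group_hom "knot_group D" G f using hom(1) by unfold_locales
    have lc: "longitude_colouring G D x ?c"
      using hom_longitude_colouring(1)[OF H.is_group hom(1), unfolded hom(2)]
      by (rule longitude_colouring_cong) simp
    moreover have "?c (top_arc D) = \<one>\<^bsub>G\<^esub>" by (simp add: end_arcs partial_longitude_top)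
    ultimately have "hom_colouring f \<in> R.colourings D \<one>\<^bsub>G\<^esub> (?c (bottom_arc D))"
      unfolding hom_colouring_def Let_def colourings_iff by (simp only: restrict_extensional simp_thms)
    moreover have "?c (bottom_arc D) \<in> carrier G"
      using end_arcs(2) by (simp add: partial_longitude_closed)
    ultimately show "cw \<in> (\<Union>b\<in>carrier G. R.colourings D \<one>\<^bsub>G\<^esub> b)"
      using f(2) by blast
  next
    fix cw assume "cw \<in> (\<Union>b\<in>carrier G. R.colourings D \<one>\<^bsub>G\<^esub> b)"
    then obtain b c w where cw: "cw = (c, w)" "(c, w) \<in> R.colourings D \<one>\<^bsub>G\<^esub> b"
      by (cases cw) blast
    then have c: "c \<in> extensional (arcs D)" "longitude_colouring G D x c" "c (top_arc D) = \<one>\<^bsub>G\<^esub>"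
      "w = restrict (weight c) (crossings D)"
      by (simp_all add: colourings_iff)
    obtain F where F: "F \<in> hom (knot_group D) G"
        "\<And>a. a \<in> arcs D \<Longrightarrow> F (wirtinger_generator D a) = conjugate_to G x (c a)"
      using wirtinger_hom_exists[OF H.is_group conjugate_to_wirtinger[OF H.is_group x c(2)]] by blast
    define f where "f = restrict F (carrier (knot_group D))"
    have hom: "f \<in> hom (knot_group D) G"
      using F(1) by (simp add: f_def hom_def Pi_iff)
    have gen: "f (wirtinger_generator D a) = conjugate_to G x (c a)" if "a \<in> arcs D" for a
      using F(2) that by (simp add: f_def wirtinger_generator_closed)
    \<comment> \<open>Here the top colour 1 enters: conjugating \<open>x\<close> by it gives
      \<open>x\<close>, and the generator of the top arc is the meridian.\<close>
    have m: "f (meridian D) = x"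
      using gen[OF end_arcs(1)] c(3) x by (simp add: meridian_def conjugate_to_def)
    interpret f: group_hom "knot_group D" G f using hom by unfold_locales
    \<comment> \<open>Both colourings obey the recursion, start at 1 and have the same conjugates of
      \<open>x\<close>, namely the images of the generators under \<open>f\<close>.\<close>
    have "f (partial_longitude a) = c a" if "a \<in> arcs D" for a
    proof (rule longitude_colouring_unique[OF _ c(2) _ _ that])
      show "longitude_colouring G D x (\<lambda>a. f (partial_longitude a))"
        using hom_longitude_colouring(1)[OF H.is_group hom] m by simp
      show "f (partial_longitude (top_arc D)) = c (top_arc D)"
        by (simp add: partial_longitude_top c(3))
      show "conjugate_to G x (f (partial_longitude a)) = conjugate_to G x (c a)" if "a \<in> arcs D" for a
        using hom_longitude_colouring(2)[OF H.is_group hom that] gen[OF that] m by simp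
    qed
    then have "(\<lambda>a\<in>arcs D. f (partial_longitude a)) = c"
      by (intro extensionalityI[OF _ c(1)]) auto
    then have "hom_colouring f = cw"
      using cw(1) c(4) by (simp add: hom_colouring_def)
    moreover have "f \<in> knot_homs"
      using hom m by (simp add: knot_homs_def f_def)
    ultimately show "cw \<in> hom_colouring ` knot_homs" by blast
  qed
qed

text \<open>Conjugates in a central extension depend only on the image of the conjugator, so the images of
  the Wirtinger generators lift canonically and \<open>f\<close> lifts to \<open>E\<close>.\<close>

lemma lift_exists:
  assumes "f \<in> knot_homs"
  obtains F where "F \<in> hom (knot_group D) E" "\<And>u. u \<in> carrier (knot_group D) \<Longrightarrow> f u = bd (F u)"
proof -
  interpret P: group "knot_group D" by (rule group_knot_group)
  have hom: "f \<in> hom (knot_group D) G" and m: "f (meridian D) = x"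
    using assms by (simp_all add: knot_homs_def)
  interpret f: group_hom "knot_group D" G f using hom by unfold_locales
  let ?c = "\<lambda>a. f (partial_longitude a)"
  let ?C = "\<lambda>a. conjugate_to E (s x) (s (?c a))"
  have lc: "longitude_colouring G D x ?c"
    using hom_longitude_colouring(1)[OF H.is_group hom] m by simp
  have c: "?c a \<in> carrier G" if "a \<in> arcs D" for a
    using that by (simp add: partial_longitude_closed)
  note s_closed = s_closed[OF splitting] and bd_s = bd_s[OF splitting]
  have bdC: "bd (?C a) = conjugate_to G x (?c a)" if "a \<in> arcs D" for a
    using c[OF that] x by (simp add: conjugate_to_def s_closed bd_s)
  have "wirtinger_colouring E D ?C"
    unfolding wirtinger_colouring_def
  proof (intro conjI ballI)
    show "?C \<in> arcs D \<rightarrow> carrier E" using c x by (simp add: s_closed)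
    fix k assume k: "k \<in> crossings D"
    let ?X = "over_arc D k" and ?Y = "lower_under_arc D k" and ?Z = "upper_under_arc D k"
    \<comment> \<open>This lift of the lower colour satisfies the recursion exactly in
      \<open>E\<close>. It may differ from \<open>s (?c ?Y)\<close> by a central element, which
      conjugation of \<open>s x\<close> does not notice.\<close>
    let ?y = "s (?c ?Z) \<otimes>\<^bsub>E\<^esub> (?C ?Z [^]\<^bsub>E\<^esub> (- crossing_sign D k) \<otimes>\<^bsub>E\<^esub> ?C ?X [^]\<^bsub>E\<^esub> crossing_sign D k)"
    note arcs = crossing_arcs[OF k]
    have y: "?y \<in> carrier E" using c arcs x by (simp add: s_closed)
    have "bd ?y = ?c ?Z \<otimes>\<^bsub>G\<^esub> (conjugate_to G x (?c ?Z) [^]\<^bsub>G\<^esub> (- crossing_sign D k) \<otimes>\<^bsub>G\<^esub>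
        conjugate_to G x (?c ?X) [^]\<^bsub>G\<^esub> crossing_sign D k)"
      using c arcs x by (simp add: s_closed bd_s bdC hom_int_pow)
    also have "\<dots> = ?c ?Y" using lc k by (simp add: longitude_colouring_def)
    finally have "bd ?y = bd (s (?c ?Y))" using c arcs by (simp add: bd_s)
    \<comment> \<open>\<open>conj_lift\<close> has the inverse on the right and
      \<open>conjugate_to\<close> has it on the left, so it is applied to inverse elements.\<close>
    then have "conjugate_to E (s x) ?y = ?C ?Y"
      using conj_lift[of "inv\<^bsub>E\<^esub> ?y" "inv\<^bsub>E\<^esub> (s (?c ?Y))" "s x"] y c arcs x
      by (simp add: conjugate_to_def s_closed del: hom_mult)
    then show "?C ?Y = ?C ?X [^]\<^bsub>E\<^esub> (- crossing_sign D k) \<otimes>\<^bsub>E\<^esub> ?C ?Z \<otimes>\<^bsub>E\<^esub> ?C ?X [^]\<^bsub>E\<^esub> crossing_sign D k"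
      using G.conjugate_to_step[of "s x" "s (?c ?Z)" "?C ?X" k D ?y] c arcs x k
      by (simp add: s_closed)
  qed
  then obtain F where F: "F \<in> hom (knot_group D) E"
      "\<And>a. a \<in> arcs D \<Longrightarrow> F (wirtinger_generator D a) = ?C a"
    using wirtinger_hom_exists[OF G.is_group] by blast
  have bdF: "bd \<circ> F \<in> hom (knot_group D) G"
    using F(1) homh by (rule Group.hom_compose)
  have "f u = (bd \<circ> F) u" if u: "u \<in> carrier (knot_group D)" for u
  proof (rule knot_group_hom_eq[OF H.is_group hom bdF _ u])
    fix a assume a: "a \<in> arcs D"
    show "f (wirtinger_generator D a) = (bd \<circ> F) (wirtinger_generator D a)"
      using hom_longitude_colouring(2)[OF H.is_group hom a]
      by (simp only: m comp_apply F(2)[OF a] bdC[OF a])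
  qed
  then show ?thesis using that[OF F(1)] by simp
qed

lemma evaluation_hom_colouring:
  assumes "f \<in> knot_homs" "hom_colouring f = (c, w)"
  shows "snd (R.evaluation D c w) = hat E s (knot_group D) f (longitude D)"
proof -
  obtain F where F: "F \<in> hom (knot_group D) E"
      "\<And>u. u \<in> carrier (knot_group D) \<Longrightarrow> f u = bd (F u)"
    using lift_exists[OF assms(1)] by blast
  interpret P: group "knot_group D" by (rule group_knot_group)
  interpret F: group_hom "knot_group D" E F using F(1) by unfold_locales
  let ?C = "\<lambda>a. F (partial_longitude a)"
  have cw: "c = (\<lambda>a\<in>arcs D. f (partial_longitude a))" "w = restrict (weight c) (crossings D)"
    using assms(2) by (auto simp: hom_colouring_def Let_def)
  have m: "meridian D \<in> carrier (knot_group D)"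
    using end_arcs(1) by (simp add: meridian_def wirtinger_generator_closed)
  \<comment> \<open>All that is known of \<open>F\<close> is that it lifts \<open>f\<close>, so
    \<open>x'\<close> is some lift of \<open>x\<close>. Brackets depend only on images, so the
    weights may be computed with it, and \<open>F\<close> carries the recursion of partial
    longitudes to \<open>E\<close> with base \<open>x'\<close>.\<close>
  define x' where "x' = F (meridian D)"
  have x': "x' \<in> carrier E" "bd x' = x"
    using m F(2)[OF m] assms(1) by (simp_all add: x'_def knot_homs_def)
  have C: "?C \<in> arcs D \<rightarrow> carrier E" by (simp add: partial_longitude_closed)
  have bdC: "bd (?C a) = c a" if "a \<in> arcs D" for a
    using that F(2) by (simp add: cw(1) partial_longitude_closed)
  have cG: "c \<in> arcs D \<rightarrow> carrier G" 
  proof (rule Pi_I)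
    fix a assume a: "a \<in> arcs D"
    have "bd (?C a) \<in> carrier G"
      by (intro hom_closed F.hom_closed partial_longitude_closed a)
    then show "c a \<in> carrier G" by (simp only: bdC[OF a])
  qed
  have "w k \<in> carrier E \<and> w k \<otimes>\<^bsub>E\<^esub> top_product E D ?C k = bottom_product E D ?C k"
    if k: "k \<in> crossings D" for k
  proof
    show "w k \<in> carrier E" using k weight_closed[OF cG k] by (simp add: cw(2))
    let ?X = "?C (over_arc D k)" and ?Y = "?C (lower_under_arc D k)" and ?Z = "?C (upper_under_arc D k)"
    note arcs = crossing_arcs[OF k]
    have XYZ: "?X \<in> carrier E" "?Y \<in> carrier E" "?Z \<in> carrier E"
      using C arcs by auto
    have col: "c (over_arc D k) = bd ?X" "c (lower_under_arc D k) = bd ?Y"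
      using bdC arcs by simp_all
    have step: "?Y = ?Z \<otimes>\<^bsub>E\<^esub> (conjugate_to E x' ?Z [^]\<^bsub>E\<^esub> (- crossing_sign D k) \<otimes>\<^bsub>E\<^esub>
        conjugate_to E x' ?X [^]\<^bsub>E\<^esub> crossing_sign D k)"
      using hom_longitude_colouring(1)[OF G.is_group F(1)] k
      by (simp add: longitude_colouring_def x'_def)
    have br: "bracket E s (bd a) (bd b) = commutator E a b" if "a \<in> carrier E" "b \<in> carrier E" for a b
      using bracket_lift[OF splitting that] .
    show "w k \<otimes>\<^bsub>E\<^esub> top_product E D ?C k = bottom_product E D ?C k"
      using k
    proof (cases rule: crossing_sign_cases)
      case plus
      have "weight c k = commutator E ?X ?Y \<otimes>\<^bsub>E\<^esub> commutator E (?Y \<otimes>\<^bsub>E\<^esub> inv\<^bsub>E\<^esub> ?X) x'"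
        using plus XYZ x'(1) br[of ?X ?Y] br[of "?Y \<otimes>\<^bsub>E\<^esub> inv\<^bsub>E\<^esub> ?X" x']
        by (simp add: weight_def psi_at_def col x'(2))
      moreover have "?Y = ?Z \<otimes>\<^bsub>E\<^esub> (inv\<^bsub>E\<^esub> (inv\<^bsub>E\<^esub> ?Z \<otimes>\<^bsub>E\<^esub> x' \<otimes>\<^bsub>E\<^esub> ?Z) \<otimes>\<^bsub>E\<^esub> (inv\<^bsub>E\<^esub> ?X \<otimes>\<^bsub>E\<^esub> x' \<otimes>\<^bsub>E\<^esub> ?X))"
        using step plus(2) XYZ x'(1) by (simp add: conjugate_to_def G.int_pow_minus_1)
      ultimately show ?thesis
        using plus(1) k G.plus_value[OF XYZ(1,3) x'(1)]
        by (simp add: cw(2) crossing_products[OF G.is_group C k])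
    next
      case minus
      have "weight c k = commutator E (?Y \<otimes>\<^bsub>E\<^esub> inv\<^bsub>E\<^esub> x') (?X \<otimes>\<^bsub>E\<^esub> inv\<^bsub>E\<^esub> x')"
        using minus XYZ x'(1) br[of "?Y \<otimes>\<^bsub>E\<^esub> inv\<^bsub>E\<^esub> x'" "?X \<otimes>\<^bsub>E\<^esub> inv\<^bsub>E\<^esub> x'"]
        by (simp add: weight_def phi_at_def col x'(2))
      moreover have "?Y = ?Z \<otimes>\<^bsub>E\<^esub> ((inv\<^bsub>E\<^esub> ?Z \<otimes>\<^bsub>E\<^esub> x' \<otimes>\<^bsub>E\<^esub> ?Z) \<otimes>\<^bsub>E\<^esub> inv\<^bsub>E\<^esub> (inv\<^bsub>E\<^esub> ?X \<otimes>\<^bsub>E\<^esub> x' \<otimes>\<^bsub>E\<^esub> ?X))"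
        using step minus(2) XYZ x'(1) by (simp add: conjugate_to_def G.int_pow_minus_1)
      ultimately show ?thesis
        using minus(1) k G.minus_value[OF XYZ(1,3) x'(1)]
        by (simp add: cw(2) crossing_products[OF G.is_group C k])
    qed
  qed
  then have "R.lifts (?C (top_arc D)) (?C (bottom_arc D)) (R.evaluation D c w)"
    using string_knot_axioms C bdC by (intro R.evaluation_lift) auto
  then have "snd (R.evaluation D c w) = F (longitude D)"
    using C end_arcs by (auto simp: R.lifts_def partial_longitude_top partial_longitude_bottom)
  also have "\<dots> = hat E s (knot_group D) f (longitude D)"
    using hat_eq_lift[OF splitting P.is_group F longitude_in_derived] by simp
  finally show ?thesis .
qed

text \<open>\<open>E\<close> may be infinite, but the colours of the crossings are determined by
  those of the arcs, which take values in the finite group \<open>G\<close>.\<close>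

lemma finite_colourings:
  assumes "finite (carrier G)"
  shows "finite (R.colourings D \<one>\<^bsub>G\<^esub> b)"
proof (rule finite_subset)
  show "R.colourings D \<one>\<^bsub>G\<^esub> b \<subseteq>
      (\<lambda>c. (c, restrict (weight c) (crossings D))) ` (arcs D \<rightarrow>\<^sub>E carrier G)"
  proof
    fix cw assume "cw \<in> R.colourings D \<one>\<^bsub>G\<^esub> b"
    then obtain c w where cw: "cw = (c, w)" "(c, w) \<in> R.colourings D \<one>\<^bsub>G\<^esub> b" by (cases cw) simp
    then show "cw \<in> (\<lambda>c. (c, restrict (weight c) (crossings D))) ` (arcs D \<rightarrow>\<^sub>E carrier G)"
      by (intro image_eqI[of _ _ c]) (auto simp: colourings_iff longitude_colouring_def PiE_def)
  qed
  show "finite ((\<lambda>c. (c, restrict (weight c) (crossings D))) ` (arcs D \<rightarrow>\<^sub>E carrier G))"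
    using assms finite_arcs by (simp add: finite_PiE)
qed

lemma state_sum_from_one_eq:
  assumes "finite (carrier G)"
  shows "R.state_sum_from_one D a =
    (\<Sum>(c, w)\<in>R.colourings D \<one>\<^bsub>G\<^esub> a. frag_of (snd (R.evaluation D c w)))"
  unfolding R.state_sum_from_one_def R.state_sum_def
  by (subst frag_extend_sum[OF finite_colourings[OF assms]])
    (simp add: case_prod_beta comp_def)

lemma sum_state_sums:
  assumes "finite (carrier G)"
  shows "(\<Sum>a\<in>carrier G. R.state_sum_from_one D a) =
    (\<Sum>f\<in>knot_homs. frag_of (hat E s (knot_group D) f (longitude D)))"
proof -
  let ?v = "\<lambda>(c, w). frag_of (snd (R.evaluation D c w))"
  have "(\<Sum>a\<in>carrier G. R.state_sum_from_one D a) = (\<Sum>a\<in>carrier G. sum ?v (R.colourings D \<one>\<^bsub>G\<^esub> a))"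
    by (simp add: state_sum_from_one_eq[OF assms])
  \<comment> \<open>The sets are disjoint because the index is the colour of the bottom arc.\<close>
  also have "\<dots> = sum ?v (\<Union>a\<in>carrier G. R.colourings D \<one>\<^bsub>G\<^esub> a)"
    using assms finite_colourings[OF assms]
    by (intro sum.UNION_disjoint[symmetric]) (auto simp: colourings_iff)
  also have "\<dots> = (\<Sum>f\<in>knot_homs. ?v (hom_colouring f))"
    by (rule sum.reindex_bij_betw[OF hom_colouring_bij, symmetric])
  also have "\<dots> = (\<Sum>f\<in>knot_homs. frag_of (hat E s (knot_group D) f (longitude D)))"
  proof (rule sum.cong)
    fix f assume "f \<in> knot_homs"
    then show "?v (hom_colouring f) = frag_of (hat E s (knot_group D) f (longitude D))"
      using evaluation_hom_colouring[of f "fst (hom_colouring f)" "snd (hom_colouring f)"]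
      by (simp add: case_prod_beta)
  qed simp
  finally show ?thesis .
qed

end

theorem theorem4p20:
  fixes E :: "('e, 'm) monoid_scheme" and G :: "('g, 'n) monoid_scheme"
    and bd :: "'e \<Rightarrow> 'g" and s :: "'g \<Rightarrow> 'e" and x :: 'g and D :: "strip list"
  assumes "central_extension E G bd"
    and "finite (carrier G)"
    and "x \<in> carrier G"
    and "is_section E G bd s"
    and "string_knot_diagram D"
  shows "(\<Sum>a\<in>carrier G.
            unframed_reidemeister_pair.state_sum_from_one E G bd (section_action E s)
              (psi_at E G s x) (phi_at E G s x) D a) =
         (\<Sum>f\<in>{f \<in> hom (knot_group D) G.
                  f \<in> extensional (carrier (knot_group D)) \<and> f (meridian D) = x}.
            frag_of (hat E s (knot_group D) f (longitude D)))"
proof -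
  interpret knot_extension E G bd D s x
    using assms by (simp add: knot_extension_def knot_extension_axioms_def string_knot_def)
  show ?thesis
    using sum_state_sums[OF assms(2)] unfolding knot_homs_def .
qed

end
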